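(* The family $\mathit{Conc}:=(\mathit{Conc}_{\mathbb{C}}(\mathsf{S}))_{(\mathbb{C},\mathsf{S})}$, indexed by the objects of ${}_{conc}\mathbf{IntSem}_{nd}$, is a natural transformation $\mathit{Mult}\Rightarrow \mathit{TrHull}\circ \mathsf{Conv}_{nd}$ between functors from ${}_{conc}\mathbf{IntSem}_{nd}$ to $\mathbf{Mon}$, and it is a natural epimorphism (each component is onto).
   Context: $\mathbf{Mon}$ is the category of ordinary monoids; $|-|$ is the forgetful functor from monoids to semigroups. A semigroup object in a monoidal category $\mathbb{C}=(C,\otimes,I,\alpha,\lambda,\rho)$ is $\mathsf{S}=(S,\mu\colon S\otimes S\to S)$ with $\mu$ associative (no unit required). Multiplier monoid and convolution. $\mathsf{Mult}_{\mathbb{C}}(\mathsf{S})$ is the monoid of pairs $(L,R)$ of $C$-morphisms $S\to S$ with $L\circ\mu=\mu\circ(L\otimes id_S)$, $R\circ\mu=\mu\circ(id_S\otimes R)$ and $\mu\circ(id_S\otimes L)=\mu\circ(R\otimes id_S)$, with product $(L',R')\star(L,R)=(L'\circ L,R\circ R')$ and identity $(id_S,id_S)$. $\mathsf{Conv}_I(\mathsf{S})$ is the ordinary semigroup $(C(I,S),\bullet_\mu)$, $g\bullet_\mu f=\mu\circ(g\otimes f)\circ\lambda_I^{-1}$. The homomorphism $\mathcal{M}_{\mathbb{C},\mathsf{S}}\colon\mathsf{Conv}_I(\mathsf{S})\to|\mathsf{Mult}_{\mathbb{C}}(\mathsf{S})|$ is $f\mapsto(L_f,R_f)$ with $L_f=\mu\circ(f\otimes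 id_S)\circ\lambda_S^{-1}$, $R_f=\mu\circ(id_S\otimes f)\circ\rho_S^{-1}$. Translational hull. For an ordinary semigroup $\mathsf{A}=(A,* )$, $\mathsf{TrHull}(\mathsf{A})$ is the monoid of pairs $(L,R)$ of maps $A\to A$ with $L(x*y)=L(x)*y$, $R(x*y)=x*R(y)$, $R(x)*y=x*L(y)$ for all $x,y$, with product $(L',R')\star(L,R)=(L'\circ L,R\circ R')$; $\mathfrak{M}_{\mathsf{A}}\colon\mathsf{A}\to|\mathsf{TrHull}(\mathsf{A})|$ sends $x$ to $(y\mapsto x*y,\ y\mapsto y*x)$. $\mathsf{A}$ is globally idempotent when $A=\{x*y\colon x,y\in A\}$, and non-degenerate when ($x*y=x*z$ for all $x$ implies $y=z$) and ($y*x=z*x$ for all $x$ implies $y=z$). A homomorphism $g\colon(B,* )\to(A,* )$ is non-degenerate when $A=\{g(b)*a\colon b\in B,a\in A\}=\{a*g(b)\colon b\in B,a\in A\}$. $\mathbf{Sem}_{nd}$ is the category of globally idempotent non-degenerate semigroups and non-degenerate homomorphisms; the functor $\mathit{TrHull}\colon\mathbf{Sem}_{nd}\to\mathbf{Mon}$ sends $\mathsf{A}$ to $\mathsf{TrHull}(\mathsf{A})$ and $g\colon\mathsf{B}\to\mathsf{A}$ to the unique homomorphism of monoids $\mathit{TrHull}(g)$ with $|\mathit{TrHull}(g)|\circ\mathfrak{M}_{\mathsf{B}}=\mathfrak{M}_{\mathsf{A}}\circ g$. Concretization. $\mathit{Conc}_{\mathbb{C}}(\mathsf{S})\colon\mathsf{Mult}_{\mathbb{C}}(\mathsf{S})\to\mathsf{TrHull}(\mathsf{Conv}_I(\mathsf{S}))$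 is the monoid homomorphism $(L,R)\mapsto(h\mapsto L\circ h,\ h\mapsto R\circ h)$, $h\in C(I,S)$. $\mathsf{S}$ is concrete when it is onto. Categories. A lax monoidal functor $\mathbb{F}=(F,\Phi,\phi)\colon(C,\otimes_C,I)\to(D,\otimes_D,J)$, with $\Phi_{c,d}\colon Fc\otimes_D Fd\to F(c\otimes_C d)$ and $\phi\colon J\to FI$, induces $\widetilde{\mathbb{F}}(S,\mu)=(FS,F(\mu)\circ\Phi_{S,S})$ on semigroup objects, $\widetilde{\mathbb{F}}(f)=F(f)$. $\mathbf{IntSem}$ has objects the pairs $(\mathbb{C},\mathsf{S})$ of a monoidal category and a semigroup object in it; morphisms $(\mathbb{C},\mathsf{S})\to(\mathbb{D},\mathsf{T})$ are pairs $(\mathbb{F},f)$ with $\mathbb{F}\colon\mathbb{C}\to\mathbb{D}$ lax monoidal and $f\colon\widetilde{\mathbb{F}}(\mathsf{S})\to\mathsf{T}$ a morphism of semigroup objects; $(\mathbb{G},g)\circ(\mathbb{F},f)=(\mathbb{G}\circ\mathbb{F},g\circ\widetilde{\mathbb{G}}(f))$. $\mathsf{Conv}$ sends $(\mathbb{C},\mathsf{S})$ to $\mathsf{Conv}_I(\mathsf{S})$ and $(\mathbb{F},f)$ to $g\mapsto f\circ F(g)\circ\phi$. $\mathbf{IntSem}_{nd}$ is the subcategory of the $(\mathbb{C},\mathsf{S})$ with $\mathsf{Conv}_I(\mathsf{S})$ globally idempotent and non-degenerate, and of the $(\mathbb{F},f)$ with $\mathsf{Conv}(\mathbb{F},f)$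 non-degenerate; $\mathsf{Conv}_{nd}\colon\mathbf{IntSem}_{nd}\to\mathbf{Sem}_{nd}$ is the restriction of $\mathsf{Conv}$ (also written $\mathsf{Conv}_{nd}$ when further restricted). ${}_{conc}\mathbf{IntSem}_{nd}$ is the full subcategory of $\mathbf{IntSem}_{nd}$ on the $(\mathbb{C},\mathsf{S})$ with $\mathsf{S}$ concrete. The functor $\mathit{Mult}\colon{}_{conc}\mathbf{IntSem}_{nd}\to\mathbf{Mon}$ is given on objects by $\mathit{Mult}(\mathbb{C},\mathsf{S})=\mathsf{Mult}_{\mathbb{C}}(\mathsf{S})$ and on a morphism $(\mathbb{F},f)\colon(\mathbb{C},\mathsf{S})\to(\mathbb{D},\mathsf{T})$ by taking $\mathit{Mult}(\mathbb{F},f)$ to be the unique homomorphism of monoids $\mathsf{Mult}_{\mathbb{C}}(\mathsf{S})\to\mathsf{Mult}_{\mathbb{D}}(\mathsf{T})$ with $|\mathit{Mult}(\mathbb{F},f)|\circ\mathcal{M}_{\mathbb{C},\mathsf{S}}=\mathcal{M}_{\mathbb{D},\mathsf{T}}\circ\mathsf{Conv}(\mathbb{F},f)$.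
   Formalization: Mult need not exist on the whole category when "concrete" only means Conc is onto, so naturality is stated on every subcategory where each Mult(F,f) exists and is unique; on the whole category the naturality square is shown for any homomorphism satisfying the defining equation of Mult(F,f). *)

theory Defs
  imports "HOL-Algebra.Group"
begin

section \<open>Categories, functors, natural transformations\<close>

text \<open>Categories are small: objects and arrows form subsets of types, and hom-sets are disjoint
  because every arrow has one domain and one codomain. Composition is written in the order of
  function composition.\<close>

record ('o, 'm) category =
  Obj :: "'o set"
  Arr :: "'m set"
  Dom :: "'m \<Rightarrow> 'o"
  Cod :: "'m \<Rightarrow> 'o"
  Id :: "'o \<Rightarrow> 'm"
  Comp :: "'m \<Rightarrow> 'm \<Rightarrow> 'm"  (infixl "\<cdot>\<index>" 55)

definition Hom :: "('o, 'm, 'x) category_scheme \<Rightarrow> 'o \<Rightarrow> 'o \<Rightarrow> 'm set" where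
  "Hom C a b = {f \<in> Arr C. Dom C f = a \<and> Cod C f = b}"

locale category =
  fixes C :: "('o, 'm, 'x) category_scheme" (structure)
  assumes dom_cod: "f \<in> Arr C \<Longrightarrow> Dom C f \<in> Obj C \<and> Cod C f \<in> Obj C"
    and id_hom: "a \<in> Obj C \<Longrightarrow> Id C a \<in> Hom C a a"
    and comp_hom: "\<lbrakk>f \<in> Hom C a b; g \<in> Hom C b c\<rbrakk> \<Longrightarrow> g \<cdot> f \<in> Hom C a c"
    and id_left: "f \<in> Hom C a b \<Longrightarrow> Id C b \<cdot> f = f"
    and id_right: "f \<in> Hom C a b \<Longrightarrow> f \<cdot> Id C a = f"
    and comp_assoc: "\<lbrakk>f \<in> Hom C a b; g \<in> Hom C b c; h \<in> Hom C c d\<rbrakk>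
      \<Longrightarrow> (h \<cdot> g) \<cdot> f = h \<cdot> (g \<cdot> f)"

definition is_inverse :: "('o, 'm, 'x) category_scheme \<Rightarrow> 'm \<Rightarrow> 'm \<Rightarrow> bool" where
  "is_inverse C f g \<longleftrightarrow> f \<in> Arr C \<and> g \<in> Hom C (Cod C f) (Dom C f) \<and>
     g \<cdot>\<^bsub>C\<^esub> f = Id C (Dom C f) \<and> f \<cdot>\<^bsub>C\<^esub> g = Id C (Cod C f)"

definition is_iso :: "('o, 'm, 'x) category_scheme \<Rightarrow> 'm \<Rightarrow> bool" where
  "is_iso C f \<longleftrightarrow> (\<exists>g. is_inverse C f g)"

definition inverse_arr :: "('o, 'm, 'x) category_scheme \<Rightarrow> 'm \<Rightarrow> 'm" where
  "inverse_arr C f = (THE g. is_inverse C f g)"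

definition subcategory :: "('o, 'm) category \<Rightarrow> ('o, 'm) category \<Rightarrow> bool" where
  "subcategory K C \<longleftrightarrow> category K \<and> category C \<and> Obj K \<subseteq> Obj C \<and> Arr K \<subseteq> Arr C \<and>
     (\<forall>f \<in> Arr K. Dom K f = Dom C f \<and> Cod K f = Cod C f) \<and>
     (\<forall>a \<in> Obj K. Id K a = Id C a) \<and>
     (\<forall>f \<in> Arr K. \<forall>g \<in> Arr K. Dom K g = Cod K f \<longrightarrow> g \<cdot>\<^bsub>K\<^esub> f = g \<cdot>\<^bsub>C\<^esub> f)"

definition restrict_category ::
  "('o, 'm) category \<Rightarrow> ('o \<Rightarrow> bool) \<Rightarrow> ('m \<Rightarrow> bool) \<Rightarrow> ('o, 'm) category" where
  "restrict_category C P Q =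
     C\<lparr>Obj := {a \<in> Obj C. P a}, Arr := {f \<in> Arr C. P (Dom C f) \<and> P (Cod C f) \<and> Q f}\<rparr>"

definition full_subcategory :: "('o, 'm) category \<Rightarrow> ('o \<Rightarrow> bool) \<Rightarrow> ('o, 'm) category" where
  "full_subcategory C P = restrict_category C P (\<lambda>_. True)"

record ('o, 'm, 'p, 'n) functor_data =
  FOb :: "'o \<Rightarrow> 'p"
  FAr :: "'m \<Rightarrow> 'n"

locale cat_functor = source: category C + target: category D
  for C :: "('o, 'm, 'x) category_scheme" and D :: "('p, 'n, 'y) category_scheme" +
  fixes F :: "('o, 'm, 'p, 'n, 'z) functor_data_scheme"
  assumes ob: "a \<in> Obj C \<Longrightarrow> FOb F a \<in> Obj D"
    and ar: "f \<in> Hom C a b \<Longrightarrow> FAr F f \<in> Hom D (FOb F a) (FOb F b)"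
    and pres_id: "a \<in> Obj C \<Longrightarrow> FAr F (Id C a) = Id D (FOb F a)"
    and pres_comp: "\<lbrakk>f \<in> Hom C a b; g \<in> Hom C b c\<rbrakk>
      \<Longrightarrow> FAr F (g \<cdot>\<^bsub>C\<^esub> f) = FAr F g \<cdot>\<^bsub>D\<^esub> FAr F f"

definition functor_comp ::
  "('p, 'n, 'q, 'k) functor_data \<Rightarrow> ('o, 'm, 'p, 'n) functor_data \<Rightarrow> ('o, 'm, 'q, 'k) functor_data"
  (infixl "\<circ>\<^sub>F" 55) where
  "G \<circ>\<^sub>F F = \<lparr>FOb = FOb G \<circ> FOb F, FAr = FAr G \<circ> FAr F\<rparr>"

locale natural_transformation = F: cat_functor C D F + G: cat_functor C D G
  for C :: "('o, 'm) category" and D :: "('p, 'n) category"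
    and F G :: "('o, 'm, 'p, 'n) functor_data" +
  fixes \<tau> :: "'o \<Rightarrow> 'n"
  assumes component: "a \<in> Obj C \<Longrightarrow> \<tau> a \<in> Hom D (FOb F a) (FOb G a)"
    and naturality: "f \<in> Hom C a b \<Longrightarrow> FAr G f \<cdot>\<^bsub>D\<^esub> \<tau> a = \<tau> b \<cdot>\<^bsub>D\<^esub> FAr F f"

text \<open>Arrows of the concrete categories below carry their source and target.\<close>

datatype ('o, 'f) arrow = Arrow (arr_src: 'o) (arr_tgt: 'o) (arr_data: 'f)


section \<open>Monoidal categories and lax monoidal functors\<close>

record ('o, 'm) monoidal_data = "('o, 'm) category" +
  TenO :: "'o \<Rightarrow> 'o \<Rightarrow> 'o"  (infixr "\<boxtimes>\<^sub>o\<index>" 70)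
  TenA :: "'m \<Rightarrow> 'm \<Rightarrow> 'm"  (infixr "\<boxtimes>\<^sub>a\<index>" 70)
  Unit :: 'o
  Assoc :: "'o \<Rightarrow> 'o \<Rightarrow> 'o \<Rightarrow> 'm"  \<comment> \<open>\<open>(a \<otimes> b) \<otimes> c \<rightarrow> a \<otimes> (b \<otimes> c)\<close>\<close>
  LUnit :: "'o \<Rightarrow> 'm"  \<comment> \<open>\<open>I \<otimes> a \<rightarrow> a\<close>\<close>
  RUnit :: "'o \<Rightarrow> 'm"  \<comment> \<open>\<open>a \<otimes> I \<rightarrow> a\<close>\<close>

locale monoidal_category = category C
  for C :: "('o, 'm) monoidal_data" (structure) +
  assumes unit_ob: "Unit C \<in> Obj C"
    and ten_ob: "\<lbrakk>a \<in> Obj C; b \<in> Obj C\<rbrakk> \<Longrightarrow> a \<boxtimes>\<^sub>o b \<in> Obj C"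
    and ten_hom: "\<lbrakk>f \<in> Hom C a a'; g \<in> Hom C b b'\<rbrakk>
      \<Longrightarrow> f \<boxtimes>\<^sub>a g \<in> Hom C (a \<boxtimes>\<^sub>o b) (a' \<boxtimes>\<^sub>o b')"
    and ten_id: "\<lbrakk>a \<in> Obj C; b \<in> Obj C\<rbrakk> \<Longrightarrow> Id C a \<boxtimes>\<^sub>a Id C b = Id C (a \<boxtimes>\<^sub>o b)"
    and ten_comp: "\<lbrakk>f \<in> Hom C a a'; f' \<in> Hom C a' a''; g \<in> Hom C b b'; g' \<in> Hom C b' b''\<rbrakk>
      \<Longrightarrow> (f' \<cdot> f) \<boxtimes>\<^sub>a (g' \<cdot> g) = (f' \<boxtimes>\<^sub>a g') \<cdot> (f \<boxtimes>\<^sub>a g)"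
    and assoc_iso: "\<lbrakk>a \<in> Obj C; b \<in> Obj C; c \<in> Obj C\<rbrakk>
      \<Longrightarrow> Assoc C a b c \<in> Hom C ((a \<boxtimes>\<^sub>o b) \<boxtimes>\<^sub>o c) (a \<boxtimes>\<^sub>o (b \<boxtimes>\<^sub>o c)) \<and> is_iso C (Assoc C a b c)"
    and assoc_nat: "\<lbrakk>f \<in> Hom C a a'; g \<in> Hom C b b'; h \<in> Hom C c c'\<rbrakk>
      \<Longrightarrow> Assoc C a' b' c' \<cdot> ((f \<boxtimes>\<^sub>a g) \<boxtimes>\<^sub>a h) = (f \<boxtimes>\<^sub>a (g \<boxtimes>\<^sub>a h)) \<cdot> Assoc C a b c"
    and lunit_iso: "a \<in> Obj C
      \<Longrightarrow> LUnit C a \<in> Hom C (Unit C \<boxtimes>\<^sub>o a) a \<and> is_iso C (LUnit C a)"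
    and lunit_nat: "f \<in> Hom C a b \<Longrightarrow> LUnit C b \<cdot> (Id C (Unit C) \<boxtimes>\<^sub>a f) = f \<cdot> LUnit C a"
    and runit_iso: "a \<in> Obj C
      \<Longrightarrow> RUnit C a \<in> Hom C (a \<boxtimes>\<^sub>o Unit C) a \<and> is_iso C (RUnit C a)"
    and runit_nat: "f \<in> Hom C a b \<Longrightarrow> RUnit C b \<cdot> (f \<boxtimes>\<^sub>a Id C (Unit C)) = f \<cdot> RUnit C a"
    and pentagon: "\<lbrakk>a \<in> Obj C; b \<in> Obj C; c \<in> Obj C; d \<in> Obj C\<rbrakk>
      \<Longrightarrow> Assoc C a b (c \<boxtimes>\<^sub>o d) \<cdot> Assoc C (a \<boxtimes>\<^sub>o b) c d =
          (Id C a \<boxtimes>\<^sub>a Assoc C b c d) \<cdot> Assoc C a (b \<boxtimes>\<^sub>o c) d \<cdot> (Assoc C a b c \<boxtimes>\<^sub>a Id C d)"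
    and triangle: "\<lbrakk>a \<in> Obj C; b \<in> Obj C\<rbrakk>
      \<Longrightarrow> (Id C a \<boxtimes>\<^sub>a LUnit C b) \<cdot> Assoc C a (Unit C) b = RUnit C a \<boxtimes>\<^sub>a Id C b"

record ('o, 'm, 'p, 'n) lax_data = "('o, 'm, 'p, 'n) functor_data" +
  LaxTen :: "'o \<times> 'o \<Rightarrow> 'n"  \<comment> \<open>\<open>F c \<otimes> F d \<rightarrow> F (c \<otimes> d)\<close>\<close>
  LaxUnit :: 'n  \<comment> \<open>\<open>J \<rightarrow> F I\<close>\<close>

locale lax_monoidal_functor =
  source: monoidal_category C + target: monoidal_category D + cat_functor C D F
  for C :: "('o, 'm) monoidal_data" and D :: "('p, 'n) monoidal_data"
    and F :: "('o, 'm, 'p, 'n) lax_data" +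
  assumes phi_hom: "\<lbrakk>a \<in> Obj C; b \<in> Obj C\<rbrakk>
      \<Longrightarrow> LaxTen F (a, b) \<in> Hom D (FOb F a \<boxtimes>\<^sub>o\<^bsub>D\<^esub> FOb F b) (FOb F (a \<boxtimes>\<^sub>o\<^bsub>C\<^esub> b))"
    and phi_nat: "\<lbrakk>f \<in> Hom C a a'; g \<in> Hom C b b'\<rbrakk>
      \<Longrightarrow> FAr F (f \<boxtimes>\<^sub>a\<^bsub>C\<^esub> g) \<cdot>\<^bsub>D\<^esub> LaxTen F (a, b) = LaxTen F (a', b') \<cdot>\<^bsub>D\<^esub> (FAr F f \<boxtimes>\<^sub>a\<^bsub>D\<^esub> FAr F g)"
    and unit_hom: "LaxUnit F \<in> Hom D (Unit D) (FOb F (Unit C))"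
    and lax_assoc: "\<lbrakk>a \<in> Obj C; b \<in> Obj C; c \<in> Obj C\<rbrakk>
      \<Longrightarrow> FAr F (Assoc C a b c) \<cdot>\<^bsub>D\<^esub> LaxTen F (a \<boxtimes>\<^sub>o\<^bsub>C\<^esub> b, c) \<cdot>\<^bsub>D\<^esub> (LaxTen F (a, b) \<boxtimes>\<^sub>a\<^bsub>D\<^esub> Id D (FOb F c)) =
          LaxTen F (a, b \<boxtimes>\<^sub>o\<^bsub>C\<^esub> c) \<cdot>\<^bsub>D\<^esub> (Id D (FOb F a) \<boxtimes>\<^sub>a\<^bsub>D\<^esub> LaxTen F (b, c)) \<cdot>\<^bsub>D\<^esub>
            Assoc D (FOb F a) (FOb F b) (FOb F c)"
    and lax_lunit: "a \<in> Obj C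
      \<Longrightarrow> FAr F (LUnit C a) \<cdot>\<^bsub>D\<^esub> LaxTen F (Unit C, a) \<cdot>\<^bsub>D\<^esub> (LaxUnit F \<boxtimes>\<^sub>a\<^bsub>D\<^esub> Id D (FOb F a)) =
          LUnit D (FOb F a)"
    and lax_runit: "a \<in> Obj C
      \<Longrightarrow> FAr F (RUnit C a) \<cdot>\<^bsub>D\<^esub> LaxTen F (a, Unit C) \<cdot>\<^bsub>D\<^esub> (Id D (FOb F a) \<boxtimes>\<^sub>a\<^bsub>D\<^esub> LaxUnit F) =
          RUnit D (FOb F a)"

text \<open>Functions serving as data of an arrow are \<open>undefined\<close> outside their domain, so that HOL
  equality of arrows is equality of functors, resp. maps, on the carriers.\<close>

definition lax_extensional ::
  "('o, 'm) monoidal_data \<Rightarrow> ('o, 'm, 'p, 'n) lax_data \<Rightarrow> bool" where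
  "lax_extensional C F \<longleftrightarrow> FOb F \<in> extensional (Obj C) \<and> FAr F \<in> extensional (Arr C) \<and>
     LaxTen F \<in> extensional (Obj C \<times> Obj C)"

definition lax_id :: "('o, 'm) monoidal_data \<Rightarrow> ('o, 'm, 'o, 'm) lax_data" where
  "lax_id C =
     \<lparr>FOb = (\<lambda>a \<in> Obj C. a), FAr = (\<lambda>f \<in> Arr C. f),
      LaxTen = (\<lambda>(a, b) \<in> Obj C \<times> Obj C. Id C (a \<boxtimes>\<^sub>o\<^bsub>C\<^esub> b)), LaxUnit = Id C (Unit C)\<rparr>"

definition lax_comp ::
  "('o, 'm) monoidal_data \<Rightarrow> ('q, 'k) monoidal_data \<Rightarrow> ('p, 'n, 'q, 'k) lax_data \<Rightarrow>
   ('o, 'm, 'p, 'n) lax_data \<Rightarrow> ('o, 'm, 'q, 'k) lax_data" where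
  "lax_comp C E G F =
     \<lparr>FOb = compose (Obj C) (FOb G) (FOb F), FAr = compose (Arr C) (FAr G) (FAr F),
      LaxTen = (\<lambda>(a, b) \<in> Obj C \<times> Obj C. FAr G (LaxTen F (a, b)) \<cdot>\<^bsub>E\<^esub> LaxTen G (FOb F a, FOb F b)),
      LaxUnit = FAr G (LaxUnit F) \<cdot>\<^bsub>E\<^esub> LaxUnit G\<rparr>"


section \<open>Semigroup objects and the category \<open>IntSem\<close>\<close>

record ('o, 'm) sg_object =
  SOb :: 'o
  SMu :: 'm

definition is_sg_object :: "('o, 'm) monoidal_data \<Rightarrow> ('o, 'm) sg_object \<Rightarrow> bool" where
  "is_sg_object C S \<longleftrightarrow> SOb S \<in> Obj C \<and> SMu S \<in> Hom C (SOb S \<boxtimes>\<^sub>o\<^bsub>C\<^esub> SOb S) (SOb S) \<and>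
     SMu S \<cdot>\<^bsub>C\<^esub> (SMu S \<boxtimes>\<^sub>a\<^bsub>C\<^esub> Id C (SOb S)) =
     SMu S \<cdot>\<^bsub>C\<^esub> (Id C (SOb S) \<boxtimes>\<^sub>a\<^bsub>C\<^esub> SMu S) \<cdot>\<^bsub>C\<^esub> Assoc C (SOb S) (SOb S) (SOb S)"

definition sg_object_hom ::
  "('o, 'm) monoidal_data \<Rightarrow> ('o, 'm) sg_object \<Rightarrow> ('o, 'm) sg_object \<Rightarrow> 'm set" where
  "sg_object_hom C S T =
     {f \<in> Hom C (SOb S) (SOb T). f \<cdot>\<^bsub>C\<^esub> SMu S = SMu T \<cdot>\<^bsub>C\<^esub> (f \<boxtimes>\<^sub>a\<^bsub>C\<^esub> f)}"

definition sg_image ::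
  "('p, 'n) monoidal_data \<Rightarrow> ('o, 'm, 'p, 'n) lax_data \<Rightarrow> ('o, 'm) sg_object \<Rightarrow> ('p, 'n) sg_object" where
  "sg_image D F S =
     \<lparr>SOb = FOb F (SOb S), SMu = FAr F (SMu S) \<cdot>\<^bsub>D\<^esub> LaxTen F (SOb S, SOb S)\<rparr>"

type_synonym ('o, 'm) intsem_ob = "('o, 'm) monoidal_data \<times> ('o, 'm) sg_object"
type_synonym ('o, 'm) intsem_ar =
  "(('o, 'm) intsem_ob, ('o, 'm, 'o, 'm) lax_data \<times> 'm) arrow"

definition intsem_obs :: "('o, 'm) intsem_ob set" where
  "intsem_obs = {(C, S) | C S. monoidal_category C \<and> is_sg_object C S}"

definition IntSem :: "(('o, 'm) intsem_ob, ('o, 'm) intsem_ar) category" where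
  "IntSem =
     \<lparr>Obj = intsem_obs,
      Arr = {Arrow (C, S) (D, T) (F, f) | C S D T F f.
               (C, S) \<in> intsem_obs \<and> (D, T) \<in> intsem_obs \<and>
               lax_monoidal_functor C D F \<and> lax_extensional C F \<and>
               f \<in> sg_object_hom D (sg_image D F S) T},
      Dom = arr_src, Cod = arr_tgt,
      Id = (\<lambda>(C, S). Arrow (C, S) (C, S) (lax_id C, Id C (SOb S))),
      Comp = (\<lambda>q p. case (arr_src p, arr_tgt q, arr_data q, arr_data p) of
                ((C, S), (E, U), (G, g), (F, f)) \<Rightarrow>
                  Arrow (C, S) (E, U) (lax_comp C E G F, g \<cdot>\<^bsub>E\<^esub> FAr G f))\<rparr>"


section \<open>Ordinary semigroups and monoids\<close>

record 'a sgrp = "'a partial_object" +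
  sprod :: "'a \<Rightarrow> 'a \<Rightarrow> 'a"  (infixl "\<star>\<index>" 70)

definition is_sgrp :: "'a sgrp \<Rightarrow> bool" where
  "is_sgrp A \<longleftrightarrow> (\<forall>x \<in> carrier A. \<forall>y \<in> carrier A. x \<star>\<^bsub>A\<^esub> y \<in> carrier A) \<and>
     (\<forall>x \<in> carrier A. \<forall>y \<in> carrier A. \<forall>z \<in> carrier A.
        (x \<star>\<^bsub>A\<^esub> y) \<star>\<^bsub>A\<^esub> z = x \<star>\<^bsub>A\<^esub> (y \<star>\<^bsub>A\<^esub> z))"

definition sgrp_hom :: "'b sgrp \<Rightarrow> 'a sgrp \<Rightarrow> ('b \<Rightarrow> 'a) set" where
  "sgrp_hom B A = {g \<in> carrier B \<rightarrow>\<^sub>E carrier A.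
     \<forall>x \<in> carrier B. \<forall>y \<in> carrier B. g (x \<star>\<^bsub>B\<^esub> y) = g x \<star>\<^bsub>A\<^esub> g y}"

definition Sem :: "('a sgrp, ('a sgrp, 'a \<Rightarrow> 'a) arrow) category" where
  "Sem =
     \<lparr>Obj = {A. is_sgrp A},
      Arr = {Arrow B A g | B A g. is_sgrp B \<and> is_sgrp A \<and> g \<in> sgrp_hom B A},
      Dom = arr_src, Cod = arr_tgt,
      Id = (\<lambda>A. Arrow A A (\<lambda>x \<in> carrier A. x)),
      Comp = (\<lambda>q p. Arrow (arr_src p) (arr_tgt q)
                (compose (carrier (arr_src p)) (arr_data q) (arr_data p)))\<rparr>"

definition globally_idempotent :: "'a sgrp \<Rightarrow> bool" where
  "globally_idempotent A \<longleftrightarrow> carrier A = {x \<star>\<^bsub>A\<^esub> y | x y. x \<in> carrier A \<and> y \<in> carrier A}"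

definition nondegenerate :: "'a sgrp \<Rightarrow> bool" where
  "nondegenerate A \<longleftrightarrow>
     (\<forall>y \<in> carrier A. \<forall>z \<in> carrier A. (\<forall>x \<in> carrier A. x \<star>\<^bsub>A\<^esub> y = x \<star>\<^bsub>A\<^esub> z) \<longrightarrow> y = z) \<and>
     (\<forall>y \<in> carrier A. \<forall>z \<in> carrier A. (\<forall>x \<in> carrier A. y \<star>\<^bsub>A\<^esub> x = z \<star>\<^bsub>A\<^esub> x) \<longrightarrow> y = z)"

definition nd_ob :: "'a sgrp \<Rightarrow> bool" where
  "nd_ob A \<longleftrightarrow> globally_idempotent A \<and> nondegenerate A"

definition nd_ar :: "('a sgrp, 'a \<Rightarrow> 'a) arrow \<Rightarrow> bool" where
  "nd_ar p \<longleftrightarrow> (let B = arr_src p; A = arr_tgt p; g = arr_data p in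
     carrier A = {g b \<star>\<^bsub>A\<^esub> a | b a. b \<in> carrier B \<and> a \<in> carrier A} \<and>
     carrier A = {a \<star>\<^bsub>A\<^esub> g b | b a. b \<in> carrier B \<and> a \<in> carrier A})"

definition Sem_nd :: "('a sgrp, ('a sgrp, 'a \<Rightarrow> 'a) arrow) category" where
  "Sem_nd = restrict_category Sem nd_ob nd_ar"

definition monoid_hom :: "'a monoid \<Rightarrow> 'b monoid \<Rightarrow> ('a \<Rightarrow> 'b) set" where
  "monoid_hom M N = {h \<in> hom M N. h \<in> extensional (carrier M) \<and> h \<one>\<^bsub>M\<^esub> = \<one>\<^bsub>N\<^esub>}"

definition Mon :: "('a monoid, ('a monoid, 'a \<Rightarrow> 'a) arrow) category" where
  "Mon =
     \<lparr>Obj = {M. monoid M},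
      Arr = {Arrow M N h | M N h. monoid M \<and> monoid N \<and> h \<in> monoid_hom M N},
      Dom = arr_src, Cod = arr_tgt,
      Id = (\<lambda>M. Arrow M M (\<lambda>x \<in> carrier M. x)),
      Comp = (\<lambda>q p. Arrow (arr_src p) (arr_tgt q)
                (compose (carrier (arr_src p)) (arr_data q) (arr_data p)))\<rparr>"

definition onto :: "('a monoid, 'a \<Rightarrow> 'a) arrow \<Rightarrow> bool" where
  "onto p \<longleftrightarrow> arr_data p ` carrier (arr_src p) = carrier (arr_tgt p)"


section \<open>Multipliers, translational hulls, convolution\<close>

text \<open>Multipliers are pairs of arrows of a category, elements of a translational hull are pairs of
  maps. The two kinds of pairs are put into one type so that the monoids of both kinds are objects
  of one category of monoids.\<close>

datatype 'a pairs = ArrPair 'a 'a | MapPair "'a \<Rightarrow> 'a" "'a \<Rightarrow> 'a"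

fun mult_prod :: "('o, 'm) monoidal_data \<Rightarrow> 'm pairs \<Rightarrow> 'm pairs \<Rightarrow> 'm pairs" where
  "mult_prod C (ArrPair L' R') (ArrPair L R) = ArrPair (L' \<cdot>\<^bsub>C\<^esub> L) (R \<cdot>\<^bsub>C\<^esub> R')"
| "mult_prod C _ _ = undefined"

definition MultMon :: "('o, 'm) monoidal_data \<Rightarrow> ('o, 'm) sg_object \<Rightarrow> 'm pairs monoid" where
  "MultMon C S = (let s = SOb S; \<mu> = SMu S in
     \<lparr>carrier = {ArrPair L R | L R. L \<in> Hom C s s \<and> R \<in> Hom C s s \<and>
         L \<cdot>\<^bsub>C\<^esub> \<mu> = \<mu> \<cdot>\<^bsub>C\<^esub> (L \<boxtimes>\<^sub>a\<^bsub>C\<^esub> Id C s) \<and>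
         R \<cdot>\<^bsub>C\<^esub> \<mu> = \<mu> \<cdot>\<^bsub>C\<^esub> (Id C s \<boxtimes>\<^sub>a\<^bsub>C\<^esub> R) \<and>
         \<mu> \<cdot>\<^bsub>C\<^esub> (Id C s \<boxtimes>\<^sub>a\<^bsub>C\<^esub> L) = \<mu> \<cdot>\<^bsub>C\<^esub> (R \<boxtimes>\<^sub>a\<^bsub>C\<^esub> Id C s)},
      mult = mult_prod C, one = ArrPair (Id C s) (Id C s)\<rparr>)"

fun hull_prod :: "'a set \<Rightarrow> 'a pairs \<Rightarrow> 'a pairs \<Rightarrow> 'a pairs" where
  "hull_prod A (MapPair L' R') (MapPair L R) = MapPair (compose A L' L) (compose A R R')"
| "hull_prod A _ _ = undefined"

definition TrHullMon :: "'a sgrp \<Rightarrow> 'a pairs monoid" where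
  "TrHullMon A =
     \<lparr>carrier = {MapPair L R | L R.
         L \<in> carrier A \<rightarrow>\<^sub>E carrier A \<and> R \<in> carrier A \<rightarrow>\<^sub>E carrier A \<and>
         (\<forall>x \<in> carrier A. \<forall>y \<in> carrier A.
            L (x \<star>\<^bsub>A\<^esub> y) = L x \<star>\<^bsub>A\<^esub> y \<and> R (x \<star>\<^bsub>A\<^esub> y) = x \<star>\<^bsub>A\<^esub> R y \<and> R x \<star>\<^bsub>A\<^esub> y = x \<star>\<^bsub>A\<^esub> L y)},
      mult = hull_prod (carrier A),
      one = MapPair (\<lambda>x \<in> carrier A. x) (\<lambda>x \<in> carrier A. x)\<rparr>"

definition canon :: "'a sgrp \<Rightarrow> 'a \<Rightarrow> 'a pairs" where
  "canon A x = MapPair (\<lambda>y \<in> carrier A. x \<star>\<^bsub>A\<^esub> y) (\<lambda>y \<in> carrier A. y \<star>\<^bsub>A\<^esub> x)"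

definition hull_extension ::
  "('a sgrp, 'a \<Rightarrow> 'a) arrow \<Rightarrow> ('a pairs monoid, 'a pairs \<Rightarrow> 'a pairs) arrow \<Rightarrow> bool" where
  "hull_extension p m \<longleftrightarrow> m \<in> Hom Mon (TrHullMon (arr_src p)) (TrHullMon (arr_tgt p)) \<and>
     (\<forall>b \<in> carrier (arr_src p). arr_data m (canon (arr_src p) b) = canon (arr_tgt p) (arr_data p b))"

definition TrHull ::
  "('a sgrp, ('a sgrp, 'a \<Rightarrow> 'a) arrow,
    'a pairs monoid, ('a pairs monoid, 'a pairs \<Rightarrow> 'a pairs) arrow) functor_data" where
  "TrHull = \<lparr>FOb = TrHullMon, FAr = (\<lambda>p. THE m. hull_extension p m)\<rparr>"

definition conv_sgrp :: "('o, 'm) intsem_ob \<Rightarrow> 'm sgrp" where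
  "conv_sgrp X = (case X of (C, S) \<Rightarrow>
     \<lparr>carrier = Hom C (Unit C) (SOb S),
      sprod = (\<lambda>g f. SMu S \<cdot>\<^bsub>C\<^esub> (g \<boxtimes>\<^sub>a\<^bsub>C\<^esub> f) \<cdot>\<^bsub>C\<^esub> inverse_arr C (LUnit C (Unit C)))\<rparr>)"

definition Conv ::
  "(('o, 'm) intsem_ob, ('o, 'm) intsem_ar, 'm sgrp, ('m sgrp, 'm \<Rightarrow> 'm) arrow) functor_data" where
  "Conv =
     \<lparr>FOb = conv_sgrp,
      FAr = (\<lambda>p. case (arr_tgt p, arr_data p) of ((D, T), (F, f)) \<Rightarrow>
               Arrow (conv_sgrp (arr_src p)) (conv_sgrp (arr_tgt p))
                 (\<lambda>g \<in> carrier (conv_sgrp (arr_src p)). f \<cdot>\<^bsub>D\<^esub> FAr F g \<cdot>\<^bsub>D\<^esub> LaxUnit F))\<rparr>"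

definition IntSem_nd :: "(('o, 'm) intsem_ob, ('o, 'm) intsem_ar) category" where
  "IntSem_nd = restrict_category IntSem (\<lambda>X. nd_ob (FOb Conv X)) (\<lambda>p. nd_ar (FAr Conv p))"

text \<open>A restriction of \<open>Conv\<close> has the same underlying maps: functor data carry neither source nor
  target, those are arguments of \<^const>\<open>cat_functor\<close>.\<close>

abbreviation Conv_nd ::
  "(('o, 'm) intsem_ob, ('o, 'm) intsem_ar, 'm sgrp, ('m sgrp, 'm \<Rightarrow> 'm) arrow) functor_data" where
  "Conv_nd \<equiv> Conv"


section \<open>Concretization and the functor \<open>Mult\<close>\<close>

definition Conc ::
  "('o, 'm) intsem_ob \<Rightarrow> ('m pairs monoid, 'm pairs \<Rightarrow> 'm pairs) arrow" where
  "Conc X = (case X of (C, S) \<Rightarrow> let H = Hom C (Unit C) (SOb S) in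
     Arrow (MultMon C S) (TrHullMon (conv_sgrp X))
       (\<lambda>p \<in> carrier (MultMon C S). case p of
          ArrPair L R \<Rightarrow> MapPair (\<lambda>h \<in> H. L \<cdot>\<^bsub>C\<^esub> h) (\<lambda>h \<in> H. R \<cdot>\<^bsub>C\<^esub> h)))"

definition concrete :: "('o, 'm) intsem_ob \<Rightarrow> bool" where
  "concrete X \<longleftrightarrow> onto (Conc X)"

definition conc_IntSem_nd :: "(('o, 'm) intsem_ob, ('o, 'm) intsem_ar) category" where
  "conc_IntSem_nd = full_subcategory IntSem_nd concrete"

definition mult_canon :: "('o, 'm) intsem_ob \<Rightarrow> 'm \<Rightarrow> 'm pairs" where
  "mult_canon X f = (case X of (C, S) \<Rightarrow> let s = SOb S; \<mu> = SMu S in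
     ArrPair (\<mu> \<cdot>\<^bsub>C\<^esub> (f \<boxtimes>\<^sub>a\<^bsub>C\<^esub> Id C s) \<cdot>\<^bsub>C\<^esub> inverse_arr C (LUnit C s))
             (\<mu> \<cdot>\<^bsub>C\<^esub> (Id C s \<boxtimes>\<^sub>a\<^bsub>C\<^esub> f) \<cdot>\<^bsub>C\<^esub> inverse_arr C (RUnit C s)))"

text \<open>\<open>mult_extension p m\<close>: the homomorphism of monoids \<open>m\<close> between the multiplier monoids satisfies
  the equation that is to determine the value of \<open>Mult\<close> at \<open>p\<close>.\<close>

definition mult_extension ::
  "('o, 'm) intsem_ar \<Rightarrow> ('m pairs monoid, 'm pairs \<Rightarrow> 'm pairs) arrow \<Rightarrow> bool" where
  "mult_extension p m \<longleftrightarrow>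
     m \<in> Hom Mon (case_prod MultMon (arr_src p)) (case_prod MultMon (arr_tgt p)) \<and>
     (\<forall>g \<in> carrier (conv_sgrp (arr_src p)).
        arr_data m (mult_canon (arr_src p) g) = mult_canon (arr_tgt p) (arr_data (FAr Conv p) g))"

definition Mult ::
  "(('o, 'm) intsem_ob, ('o, 'm) intsem_ar,
    'm pairs monoid, ('m pairs monoid, 'm pairs \<Rightarrow> 'm pairs) arrow) functor_data" where
  "Mult = \<lparr>FOb = case_prod MultMon, FAr = (\<lambda>p. THE m. mult_extension p m)\<rparr>"

text \<open>The description of \<open>Mult\<close> on arrows presupposes that there is exactly one extension. Since
  \<open>Conc\<close> need not be injective on a concrete semigroup object, this can fail. Example: the strict
  monoidal category with objects \<open>I\<close> and \<open>T = T \<otimes> T\<close>, arrows \<open>id\<^sub>I\<close>, \<open>e : I \<rightarrow> T\<close> and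
  \<open>id\<^sub>T, q : T \<rightarrow> T\<close> with \<open>q \<cdot> q = q\<close>, \<open>q \<cdot> e = e\<close>, \<open>e \<otimes> id\<^sub>T = q\<close>, and the semigroup objects \<open>I\<close>
  and \<open>T\<close> whose multiplications are identities. Both are concrete with one-element convolution
  semigroups, but for the arrow given by \<open>e\<close> an extension would have to send the identity of
  \<open>Mult I\<close> both to the identity and to \<open>(q, q)\<close>. Hence the presupposition is made
  explicit, relative to a category \<open>K\<close>; the case \<open>K = conc_IntSem_nd\<close> is the one in which \<open>Mult\<close>
  is a functor on all of \<open>conc_IntSem_nd\<close>.\<close>

definition Mult_defined_on :: "(('o, 'm) intsem_ob, ('o, 'm) intsem_ar) category \<Rightarrow> bool" where
  "Mult_defined_on K \<longleftrightarrow> (\<forall>p \<in> Arr K. \<exists>!m. mult_extension p m)"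

end

theory Submission
  imports Defs
begin

text \<open>Let \<open>g : B \<rightarrow> A\<close> be a non-degenerate homomorphism into a non-degenerate semigroup. A translation
  \<open>(L, R)\<close> of \<open>B\<close> extends to exactly one translation \<open>(L', R')\<close> of \<open>A\<close> with
  \<open>L' (g b * a) = g (L b) * a\<close> and \<open>R' (a * g b) = a * g (R b)\<close>: the identity
  \<open>a' * g c * g (L b) * a = a' * g (R c) * g b * a\<close> shows that \<open>L'\<close> is well defined.
  This is the value of \<open>TrHull\<close> at \<open>g\<close>.

  For a multiplier \<open>x = (L, R)\<close> and a point \<open>b : I \<rightarrow> S\<close>, the product of \<open>x\<close> and the canonical multiplier
  of \<open>b\<close> is the canonical multiplier of \<open>L \<cdot> b\<close>, respectively \<open>R \<cdot> b\<close> in the other order. Hence, for any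
  homomorphism \<open>m\<close> between multiplier monoids that agrees with \<open>Conv p\<close> on canonical multipliers,
  \<open>Conc (m x)\<close> extends \<open>Conc x\<close> along \<open>Conv p\<close>; uniqueness of the extension is naturality.\<close>

section \<open>Categories\<close>

text \<open>A homomorphism m as above is known at a multiplier x only through the products of m x
  with canonical multipliers. In a multiplier monoid these products need not determine m x. In the
  translational hull of A they do: the products with \<open>canon A (g b)\<close> fix the left map
  at all \<open>g b * a\<close> and the right map at all \<open>a * g b\<close>, and by
  non-degeneracy of g both families exhaust A. So the comparison is made after concretization.
  \<open>lifts_of_hom\<close> carries it out once, for an arbitrary monoid M with distinguished
  elements \<open>c b\<close>: with M the hull of B it yields uniqueness of the value of
  \<open>TrHull\<close>, with M the multiplier monoid it yields naturality.

  The product formulas for canonical multipliers follow from the multiplier equations and naturality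
  of the unitors. That canonical multipliers are multipliers, and that they concretize to canonical
  translations, rests moreover on \<lambda>_I = \<rho>_I and the unit laws for tensor products.
  These are not among the axioms of \<open>monoidal_category\<close> and are derived from pentagon
  and triangle.\<close>

lemma Hom_iff: "f \<in> Hom C a b \<longleftrightarrow> f \<in> Arr C \<and> Dom C f = a \<and> Cod C f = b"
  by (simp add: Hom_def)

context category
begin

text \<open>The category axioms are restated through \<open>Arr\<close>, \<open>Dom\<close> and
  \<open>Cod\<close>: the intermediate objects of a composite are then computed by the simplifier,
  whereas with \<open>Hom\<close> they would have to be instantiated.\<close>

lemma dom_obj [simp]: "f \<in> Arr C \<Longrightarrow> Dom C f \<in> Obj C"
  and cod_obj [simp]: "f \<in> Arr C \<Longrightarrow> Cod C f \<in> Obj C"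
  using dom_cod by auto

lemma id_arr [simp]:
  assumes "a \<in> Obj C"
  shows "Id C a \<in> Arr C" "Dom C (Id C a) = a" "Cod C (Id C a) = a"
  using id_hom[OF assms] by (simp_all add: Hom_iff)

lemma comp_arr [simp]:
  assumes "f \<in> Arr C" "g \<in> Arr C" "Cod C f = Dom C g"
  shows "g \<cdot> f \<in> Arr C" "Dom C (g \<cdot> f) = Dom C f" "Cod C (g \<cdot> f) = Cod C g"
  using comp_hom[of f "Dom C f" "Dom C g" g "Cod C g"] assms by (simp_all add: Hom_iff)

lemma id_comp [simp]: "\<lbrakk>f \<in> Arr C; Cod C f = b\<rbrakk> \<Longrightarrow> Id C b \<cdot> f = f"
  by (rule id_left) (simp add: Hom_iff)

lemma comp_id [simp]: "\<lbrakk>f \<in> Arr C; Dom C f = a\<rbrakk> \<Longrightarrow> f \<cdot> Id C a = f"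
  by (rule id_right) (simp add: Hom_iff)

lemma comp_assoc' [simp]:
  "\<lbrakk>f \<in> Arr C; g \<in> Arr C; h \<in> Arr C; Cod C f = Dom C g; Cod C g = Dom C h\<rbrakk>
    \<Longrightarrow> (h \<cdot> g) \<cdot> f = h \<cdot> (g \<cdot> f)"
  using comp_assoc[of f "Dom C f" "Dom C g" g "Dom C h" h "Cod C h"] by (simp add: Hom_iff)

text \<open>Composites are kept bracketed to the right by \<open>comp_assoc'\<close>, so an equation
  for g \<cdot> f does not match inside g \<cdot> (f \<cdot> k). This lemma and the next produce the
  form that does, the second one for equations between two composites such as naturality
  squares.\<close>

lemma comp_extend:
  "\<lbrakk>g \<cdot> f = h; f \<in> Arr C; g \<in> Arr C; k \<in> Arr C; Cod C f = Dom C g; Cod C k = Dom C f\<rbrakk>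
    \<Longrightarrow> g \<cdot> (f \<cdot> k) = h \<cdot> k"
  using comp_assoc'[of k f g] by simp

lemma comp_extend2:
  "\<lbrakk>g \<cdot> f = h \<cdot> l; f \<in> Arr C; g \<in> Arr C; h \<in> Arr C; l \<in> Arr C; k \<in> Arr C; Cod C f = Dom C g;
     Cod C l = Dom C h; Cod C k = Dom C f; Dom C l = Dom C f\<rbrakk>
    \<Longrightarrow> g \<cdot> (f \<cdot> k) = h \<cdot> (l \<cdot> k)"
  using comp_extend[of g f "h \<cdot> l" k] by simp

lemma is_inverse_unique:
  assumes "is_inverse C f g" "is_inverse C f h"
  shows "g = h"
proof -
  have "g = g \<cdot> (f \<cdot> h)" "h = (g \<cdot> f) \<cdot> h"
    using assms by (auto simp: is_inverse_def Hom_iff)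
  moreover have "(g \<cdot> f) \<cdot> h = g \<cdot> (f \<cdot> h)"
    by (rule comp_assoc') (use assms in \<open>auto simp: is_inverse_def Hom_iff\<close>)
  ultimately show ?thesis by simp
qed

lemma is_inverse_inverse_arr: "is_iso C f \<Longrightarrow> is_inverse C f (inverse_arr C f)"
  unfolding is_iso_def inverse_arr_def using is_inverse_unique by (metis theI)

lemma iso_arr: "is_iso C f \<Longrightarrow> f \<in> Arr C"
  by (auto simp: is_iso_def is_inverse_def)

lemma inverse_arr [simp]:
  assumes "is_iso C f"
  shows "inverse_arr C f \<in> Arr C" "Dom C (inverse_arr C f) = Cod C f"
    "Cod C (inverse_arr C f) = Dom C f"
    "inverse_arr C f \<cdot> f = Id C (Dom C f)" "f \<cdot> inverse_arr C f = Id C (Cod C f)"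
  using is_inverse_inverse_arr[OF assms] by (auto simp: is_inverse_def Hom_iff)

lemma inverse_arr_extend [simp]:
  assumes "is_iso C f" "k \<in> Arr C"
  shows "Cod C k = Dom C f \<Longrightarrow> inverse_arr C f \<cdot> (f \<cdot> k) = k"
    "Cod C k = Cod C f \<Longrightarrow> f \<cdot> (inverse_arr C f \<cdot> k) = k"
  using assms comp_extend[of "inverse_arr C f" f "Id C (Dom C f)" k]
    comp_extend[of f "inverse_arr C f" "Id C (Cod C f)" k] iso_arr by simp_all

lemma iso_cancel_left:
  assumes "is_iso C f" "g \<in> Arr C" "h \<in> Arr C" "Cod C g = Dom C f" "Cod C h = Dom C f"
    and "f \<cdot> g = f \<cdot> h"
  shows "g = h"
  using inverse_arr_extend(1)[OF assms(1)] assms(2-) by metis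

lemma iso_cancel_right:
  assumes f: "is_iso C f" and g: "g \<in> Arr C" "h \<in> Arr C" "Dom C g = Cod C f" "Dom C h = Cod C f"
    and eq: "g \<cdot> f = h \<cdot> f"
  shows "g = h"
proof -
  have "(g \<cdot> f) \<cdot> inverse_arr C f = g" "(h \<cdot> f) \<cdot> inverse_arr C f = h"
    using f g iso_arr[OF f] by simp_all
  then show ?thesis using eq by metis
qed

end

section \<open>Functors, subcategories and restrictions\<close>

lemma (in cat_functor) functor_arr [simp]:
  assumes "f \<in> Arr C"
  shows "FAr F f \<in> Arr D" "Dom D (FAr F f) = FOb F (Dom C f)" "Cod D (FAr F f) = FOb F (Cod C f)"
  using ar[of f "Dom C f" "Cod C f"] assms by (simp_all add: Hom_iff)

lemma (in cat_functor) functor_id [simp]: "a \<in> Obj C \<Longrightarrow> FAr F (Id C a) = Id D (FOb F a)"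
  by (rule pres_id)

lemma (in cat_functor) functor_ob [simp]: "a \<in> Obj C \<Longrightarrow> FOb F a \<in> Obj D"
  by (rule ob)

lemma (in cat_functor) functor_comp [simp]:
  "\<lbrakk>f \<in> Arr C; g \<in> Arr C; Cod C f = Dom C g\<rbrakk> \<Longrightarrow> FAr F (g \<cdot>\<^bsub>C\<^esub> f) = FAr F g \<cdot>\<^bsub>D\<^esub> FAr F f"
  using pres_comp[of f "Dom C f" "Dom C g" g "Cod C g"] by (simp add: Hom_iff)

lemma functor_comp_cat_functor:
  assumes "cat_functor C D F" "cat_functor D E G"
  shows "cat_functor C E (G \<circ>\<^sub>F F)"
proof -
  interpret F: cat_functor C D F by fact
  interpret G: cat_functor D E G by fact
  show ?thesis
    by unfold_locales (auto simp: functor_comp_def Hom_iff)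
qed

lemma cat_functor_subcategory:
  assumes "cat_functor C D F" "subcategory K C"
  shows "cat_functor K D F"
proof -
  interpret F: cat_functor C D F by fact
  interpret K: category K using assms by (simp add: subcategory_def)
  show ?thesis
  proof unfold_locales
    fix f g a b c assume "f \<in> Hom K a b" "g \<in> Hom K b c"
    then show "FAr F (g \<cdot>\<^bsub>K\<^esub> f) = FAr F g \<cdot>\<^bsub>D\<^esub> FAr F f"
      using assms(2) by (auto simp: Hom_iff subcategory_def subset_iff)
  qed (use assms(2) in \<open>auto simp: Hom_iff subcategory_def subset_iff\<close>)
qed

lemma restrict_category_simps [simp]:
  "Obj (restrict_category C P Q) = {a \<in> Obj C. P a}"
  "Arr (restrict_category C P Q) = {f \<in> Arr C. P (Dom C f) \<and> P (Cod C f) \<and> Q f}"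
  "Dom (restrict_category C P Q) = Dom C" "Cod (restrict_category C P Q) = Cod C"
  "Id (restrict_category C P Q) = Id C" "Comp (restrict_category C P Q) = Comp C"
  by (simp_all add: restrict_category_def)

lemma restrict_category_category:
  assumes "category C"
    and Q_id: "\<And>a. \<lbrakk>a \<in> Obj C; P a\<rbrakk> \<Longrightarrow> Q (Id C a)"
    and Q_comp: "\<And>f g. \<lbrakk>f \<in> Arr C; g \<in> Arr C; Cod C f = Dom C g;
      P (Dom C f); P (Cod C f); P (Cod C g); Q f; Q g\<rbrakk> \<Longrightarrow> Q (g \<cdot>\<^bsub>C\<^esub> f)"
  shows "category (restrict_category C P Q)"
proof -
  interpret category C by fact
  show ?thesis
  proof unfold_locales
    fix a b c f g assume "f \<in> Hom (restrict_category C P Q) a b" "g \<in> Hom (restrict_category C P Q) b c"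
    then show "g \<cdot>\<^bsub>restrict_category C P Q\<^esub> f \<in> Hom (restrict_category C P Q) a c"
      using Q_comp[of f g] by (auto simp: Hom_iff)
  qed (auto simp: Hom_iff Q_id)
qed

lemma restrict_category_functor:
  assumes "cat_functor C D F"
    and "category (restrict_category C P Q)" "category (restrict_category D P' Q')"
    and P: "\<And>a. \<lbrakk>a \<in> Obj C; P a\<rbrakk> \<Longrightarrow> P' (FOb F a)"
    and Q: "\<And>f. \<lbrakk>f \<in> Arr C; P (Dom C f); P (Cod C f); Q f\<rbrakk> \<Longrightarrow> Q' (FAr F f)"
  shows "cat_functor (restrict_category C P Q) (restrict_category D P' Q') F"
proof -
  interpret F: cat_functor C D F by fact
  interpret R: category "restrict_category C P Q" by fact
  interpret R': category "restrict_category D P' Q'" by fact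
  show ?thesis by unfold_locales (auto simp: Hom_iff P Q)
qed

section \<open>Monoids and semigroups\<close>

lemma Mon_simps [simp]:
  "Obj Mon = {M. monoid M}" "Dom Mon = arr_src" "Cod Mon = arr_tgt"
  "Id Mon = (\<lambda>M. Arrow M M (\<lambda>x \<in> carrier M. x))"
  "q \<cdot>\<^bsub>Mon\<^esub> p = Arrow (arr_src p) (arr_tgt q) (compose (carrier (arr_src p)) (arr_data q) (arr_data p))"
  by (simp_all add: Mon_def)

lemma Hom_Mon_iff:
  "p \<in> Hom Mon M N \<longleftrightarrow>
    (\<exists>h. p = Arrow M N h \<and> monoid M \<and> monoid N \<and> h \<in> monoid_hom M N)"
  by (auto simp: Hom_iff Mon_def)

lemma monoid_hom_compose:
  assumes "h \<in> monoid_hom M N" "k \<in> monoid_hom N U" "monoid M"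
  shows "compose (carrier M) k h \<in> monoid_hom M U"
  using assms by (auto simp: monoid_hom_def hom_def compose_def Pi_def monoid.m_closed monoid.one_closed)

lemma compose_id_left: "f \<in> A \<rightarrow> B \<Longrightarrow> f \<in> extensional A \<Longrightarrow> compose A (\<lambda>x \<in> B. x) f = f"
  and compose_id_right: "f \<in> extensional A \<Longrightarrow> compose A f (\<lambda>x \<in> A. x) = f"
  by (auto simp: compose_def fun_eq_iff extensional_def)

lemma category_Mon: "category Mon"
proof unfold_locales
  show "g \<cdot>\<^bsub>Mon\<^esub> f \<in> Hom Mon a c" if "f \<in> Hom Mon a b" "g \<in> Hom Mon b c" for a b c f g
    using that by (auto simp: Hom_Mon_iff monoid_hom_compose)
  show "Id Mon a \<in> Hom Mon a a" if "a \<in> Obj Mon" for a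
    using that by (auto simp: Hom_Mon_iff monoid_hom_def hom_def monoid.m_closed monoid.one_closed)
  show "Id Mon b \<cdot>\<^bsub>Mon\<^esub> f = f" "f \<cdot>\<^bsub>Mon\<^esub> Id Mon a = f" if "f \<in> Hom Mon a b" for a b f
    using that by (auto simp: Hom_Mon_iff monoid_hom_def hom_def compose_id_left compose_id_right)
  show "(h \<cdot>\<^bsub>Mon\<^esub> g) \<cdot>\<^bsub>Mon\<^esub> f = h \<cdot>\<^bsub>Mon\<^esub> (g \<cdot>\<^bsub>Mon\<^esub> f)"
    if "f \<in> Hom Mon a b" "g \<in> Hom Mon b c" "h \<in> Hom Mon c d" for a b c d f g h
    using that by (auto simp: Hom_Mon_iff monoid_hom_def hom_def compose_def fun_eq_iff)
qed (auto simp: Mon_def)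

section \<open>Semigroups and their non-degenerate homomorphisms\<close>

lemma Sem_simps [simp]:
  "Obj Sem = {A. is_sgrp A}" "Dom Sem = arr_src" "Cod Sem = arr_tgt"
  "Id Sem = (\<lambda>A. Arrow A A (\<lambda>x \<in> carrier A. x))"
  "q \<cdot>\<^bsub>Sem\<^esub> p = Arrow (arr_src p) (arr_tgt q) (compose (carrier (arr_src p)) (arr_data q) (arr_data p))"
  by (simp_all add: Sem_def)

lemma Hom_Sem_iff:
  "p \<in> Hom Sem B A \<longleftrightarrow> (\<exists>g. p = Arrow B A g \<and> is_sgrp B \<and> is_sgrp A \<and> g \<in> sgrp_hom B A)"
  by (auto simp: Hom_iff Sem_def)

lemma Arr_Sem_iff:
  "p \<in> Arr Sem \<longleftrightarrow> (\<exists>B A g. p = Arrow B A g \<and> is_sgrp B \<and> is_sgrp A \<and> g \<in> sgrp_hom B A)"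
  by (auto simp: Sem_def)

lemma sgrp_closed: "\<lbrakk>is_sgrp A; x \<in> carrier A; y \<in> carrier A\<rbrakk> \<Longrightarrow> x \<star>\<^bsub>A\<^esub> y \<in> carrier A"
  and sgrp_assoc: "\<lbrakk>is_sgrp A; x \<in> carrier A; y \<in> carrier A; z \<in> carrier A\<rbrakk>
    \<Longrightarrow> (x \<star>\<^bsub>A\<^esub> y) \<star>\<^bsub>A\<^esub> z = x \<star>\<^bsub>A\<^esub> (y \<star>\<^bsub>A\<^esub> z)"
  by (auto simp: is_sgrp_def)

lemma sgrp_hom_closed: "\<lbrakk>g \<in> sgrp_hom B A; b \<in> carrier B\<rbrakk> \<Longrightarrow> g b \<in> carrier A"
  and sgrp_hom_mult: "\<lbrakk>g \<in> sgrp_hom B A; b \<in> carrier B; c \<in> carrier B\<rbrakk>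
    \<Longrightarrow> g (b \<star>\<^bsub>B\<^esub> c) = g b \<star>\<^bsub>A\<^esub> g c"
  by (auto simp: sgrp_hom_def)

lemma sgrp_hom_compose:
  "\<lbrakk>g \<in> sgrp_hom B A; h \<in> sgrp_hom A E; is_sgrp B\<rbrakk> \<Longrightarrow> compose (carrier B) h g \<in> sgrp_hom B E"
  by (auto simp: sgrp_hom_def compose_def sgrp_closed PiE_def Pi_def extensional_def)

lemma category_Sem: "category Sem"
proof unfold_locales
  show "g \<cdot>\<^bsub>Sem\<^esub> f \<in> Hom Sem a c" if "f \<in> Hom Sem a b" "g \<in> Hom Sem b c" for a b c f g
    using that by (auto simp: Hom_Sem_iff sgrp_hom_compose)
  show "Id Sem a \<in> Hom Sem a a" if "a \<in> Obj Sem" for a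
    using that by (auto simp: Hom_Sem_iff sgrp_hom_def sgrp_closed)
  show "Id Sem b \<cdot>\<^bsub>Sem\<^esub> f = f" "f \<cdot>\<^bsub>Sem\<^esub> Id Sem a = f" if "f \<in> Hom Sem a b" for a b f
    using that by (auto simp: Hom_Sem_iff sgrp_hom_def compose_id_left compose_id_right PiE_def)
  show "(h \<cdot>\<^bsub>Sem\<^esub> g) \<cdot>\<^bsub>Sem\<^esub> f = h \<cdot>\<^bsub>Sem\<^esub> (g \<cdot>\<^bsub>Sem\<^esub> f)"
    if "f \<in> Hom Sem a b" "g \<in> Hom Sem b c" "h \<in> Hom Sem c d" for a b c d f g h
    using that by (auto simp: Hom_Sem_iff sgrp_hom_def compose_def fun_eq_iff)
qed (auto simp: Sem_def)

text \<open>One inclusion in each set equation of \<open>nd_ar\<close> is closure under the product;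
  what remains is that every element factors.\<close>

lemma nd_ar_Arrow:
  assumes "is_sgrp A" "g \<in> sgrp_hom B A"
  shows "nd_ar (Arrow B A g) \<longleftrightarrow> (\<forall>x \<in> carrier A.
    (\<exists>b \<in> carrier B. \<exists>a \<in> carrier A. x = g b \<star>\<^bsub>A\<^esub> a) \<and>
    (\<exists>b \<in> carrier B. \<exists>a \<in> carrier A. x = a \<star>\<^bsub>A\<^esub> g b))"
  using sgrp_closed[OF assms(1)] sgrp_hom_closed[OF assms(2)]
  unfolding nd_ar_def Let_def by auto blast+

text \<open>For an identity, both factorization conditions of \<open>nd_ar\<close> coincide with
  global idempotence; this is how that property secures the identities of
  \<open>Sem_nd\<close>.\<close>

lemma nd_ar_id:
  assumes "is_sgrp A" "globally_idempotent A"
  shows "nd_ar (Arrow A A (\<lambda>x \<in> carrier A. x))"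
proof -
  have "(\<lambda>x \<in> carrier A. x) \<in> sgrp_hom A A"
    using assms by (auto simp: sgrp_hom_def sgrp_closed)
  moreover have "\<exists>b \<in> carrier A. \<exists>a \<in> carrier A. x = b \<star>\<^bsub>A\<^esub> a" if "x \<in> carrier A" for x
    using assms(2) that unfolding globally_idempotent_def by blast
  ultimately show ?thesis
    using assms(1) by (subst nd_ar_Arrow) (auto, metis+)
qed

text \<open>Factor twice: from x = h a * e and a = g b * a' one gets x = h (g b) * (h a' * e), and
  symmetrically on the other side.\<close>

lemma nd_ar_compose:
  assumes sg: "is_sgrp B" "is_sgrp A" "is_sgrp E"
    and g: "g \<in> sgrp_hom B A" "nd_ar (Arrow B A g)"
    and h: "h \<in> sgrp_hom A E" "nd_ar (Arrow A E h)"
  shows "nd_ar (Arrow B E (compose (carrier B) h g))"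
proof -
  have "(\<exists>b \<in> carrier B. \<exists>e \<in> carrier E. x = h (g b) \<star>\<^bsub>E\<^esub> e) \<and>
      (\<exists>b \<in> carrier B. \<exists>e \<in> carrier E. x = e \<star>\<^bsub>E\<^esub> h (g b))" if x: "x \<in> carrier E" for x
  proof
    obtain a e where ae: "a \<in> carrier A" "e \<in> carrier E" "x = h a \<star>\<^bsub>E\<^esub> e"
      using h x sg nd_ar_Arrow by metis
    then obtain b a' where b: "b \<in> carrier B" "a' \<in> carrier A" "a = g b \<star>\<^bsub>A\<^esub> a'"
      using g sg nd_ar_Arrow by metis
    have "x = h (g b) \<star>\<^bsub>E\<^esub> (h a' \<star>\<^bsub>E\<^esub> e)"
      using ae b sg sgrp_hom_closed[OF g(1)] sgrp_hom_closed[OF h(1)]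
      by (simp add: sgrp_hom_mult[OF h(1)] sgrp_assoc)
    moreover have "h a' \<star>\<^bsub>E\<^esub> e \<in> carrier E"
      using ae b sg sgrp_hom_closed[OF h(1)] by (simp add: sgrp_closed)
    ultimately show "\<exists>b \<in> carrier B. \<exists>e \<in> carrier E. x = h (g b) \<star>\<^bsub>E\<^esub> e"
      using b by blast
    obtain a e where ae: "a \<in> carrier A" "e \<in> carrier E" "x = e \<star>\<^bsub>E\<^esub> h a"
      using h x sg nd_ar_Arrow by metis
    then obtain b a' where b: "b \<in> carrier B" "a' \<in> carrier A" "a = a' \<star>\<^bsub>A\<^esub> g b"
      using g sg nd_ar_Arrow by metis
    have "x = (e \<star>\<^bsub>E\<^esub> h a') \<star>\<^bsub>E\<^esub> h (g b)"
      using ae b sg sgrp_hom_closed[OF g(1)] sgrp_hom_closed[OF h(1)]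
      by (simp add: sgrp_hom_mult[OF h(1)] sgrp_assoc)
    moreover have "e \<star>\<^bsub>E\<^esub> h a' \<in> carrier E"
      using ae b sg sgrp_hom_closed[OF h(1)] by (simp add: sgrp_closed)
    ultimately show "\<exists>b \<in> carrier B. \<exists>e \<in> carrier E. x = e \<star>\<^bsub>E\<^esub> h (g b)"
      using b by blast
  qed
  then show ?thesis
    using sg g h sgrp_hom_compose[OF g(1) h(1)] by (subst nd_ar_Arrow) (auto simp: compose_def)
qed

lemma category_Sem_nd: "category Sem_nd"
  unfolding Sem_nd_def
proof (rule restrict_category_category[OF category_Sem])
  show "nd_ar (Id Sem a)" if "a \<in> Obj Sem" "nd_ob a" for a :: "'a sgrp"
    using that by (simp add: nd_ar_id nd_ob_def)
  show "nd_ar (g \<cdot>\<^bsub>Sem\<^esub> f)"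
    if "f \<in> Arr Sem" "g \<in> Arr Sem" "Cod Sem f = Dom Sem g" "nd_ar f" "nd_ar g"
    for f g :: "('a sgrp, 'a \<Rightarrow> 'a) arrow"
    using that by (auto simp: Arr_Sem_iff intro: nd_ar_compose)
qed

section \<open>Coherence of units\<close>

context monoidal_category
begin

lemma unit_obj [simp]: "Unit C \<in> Obj C"
  by (rule unit_ob)

lemma ten_obj [simp]: "\<lbrakk>a \<in> Obj C; b \<in> Obj C\<rbrakk> \<Longrightarrow> a \<boxtimes>\<^sub>o b \<in> Obj C"
  by (rule ten_ob)

lemma ten_arr [simp]:
  assumes "f \<in> Arr C" "g \<in> Arr C"
  shows "f \<boxtimes>\<^sub>a g \<in> Arr C" "Dom C (f \<boxtimes>\<^sub>a g) = Dom C f \<boxtimes>\<^sub>o Dom C g"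
    "Cod C (f \<boxtimes>\<^sub>a g) = Cod C f \<boxtimes>\<^sub>o Cod C g"
  using ten_hom[of f "Dom C f" "Cod C f" g "Dom C g" "Cod C g"] assms by (simp_all add: Hom_iff)

lemma ten_ids [simp]: "\<lbrakk>a \<in> Obj C; b \<in> Obj C\<rbrakk> \<Longrightarrow> Id C a \<boxtimes>\<^sub>a Id C b = Id C (a \<boxtimes>\<^sub>o b)"
  by (rule ten_id)

text \<open>Oriented towards one tensor of composites, so that the simplifier merges consecutive
  tensors and two different splittings of an arrow meet in the same normal form.\<close>

lemma interchange:
  "\<lbrakk>f \<in> Arr C; f' \<in> Arr C; g \<in> Arr C; g' \<in> Arr C; Cod C f = Dom C f'; Cod C g = Dom C g'\<rbrakk>
    \<Longrightarrow> (f' \<boxtimes>\<^sub>a g') \<cdot> (f \<boxtimes>\<^sub>a g) = (f' \<cdot> f) \<boxtimes>\<^sub>a (g' \<cdot> g)"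
  using ten_comp[of f "Dom C f" "Dom C f'" f' "Cod C f'" g "Dom C g" "Dom C g'" g' "Cod C g'"]
  by (simp add: Hom_iff)

lemma interchange_extend:
  "\<lbrakk>f \<in> Arr C; f' \<in> Arr C; g \<in> Arr C; g' \<in> Arr C; Cod C f = Dom C f'; Cod C g = Dom C g';
    k \<in> Arr C; Cod C k = Dom C f \<boxtimes>\<^sub>o Dom C g\<rbrakk>
    \<Longrightarrow> (f' \<boxtimes>\<^sub>a g') \<cdot> ((f \<boxtimes>\<^sub>a g) \<cdot> k) = ((f' \<cdot> f) \<boxtimes>\<^sub>a (g' \<cdot> g)) \<cdot> k"
  by (rule comp_extend[OF interchange]) simp_all

lemma assoc_arr [simp]:
  assumes "a \<in> Obj C" "b \<in> Obj C" "c \<in> Obj C"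
  shows "Assoc C a b c \<in> Arr C" "Dom C (Assoc C a b c) = (a \<boxtimes>\<^sub>o b) \<boxtimes>\<^sub>o c"
    "Cod C (Assoc C a b c) = a \<boxtimes>\<^sub>o (b \<boxtimes>\<^sub>o c)" "is_iso C (Assoc C a b c)"
  using assoc_iso[OF assms] by (simp_all add: Hom_iff)

lemma lunit_arr [simp]:
  assumes "a \<in> Obj C"
  shows "LUnit C a \<in> Arr C" "Dom C (LUnit C a) = Unit C \<boxtimes>\<^sub>o a"
    "Cod C (LUnit C a) = a" "is_iso C (LUnit C a)"
  using lunit_iso[OF assms] by (simp_all add: Hom_iff)

lemma runit_arr [simp]:
  assumes "a \<in> Obj C"
  shows "RUnit C a \<in> Arr C" "Dom C (RUnit C a) = a \<boxtimes>\<^sub>o Unit C"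
    "Cod C (RUnit C a) = a" "is_iso C (RUnit C a)"
  using runit_iso[OF assms] by (simp_all add: Hom_iff)

lemma assoc_natural:
  "\<lbrakk>f \<in> Arr C; g \<in> Arr C; h \<in> Arr C; Cod C f = a'; Cod C g = b'; Cod C h = c';
    Dom C f = a; Dom C g = b; Dom C h = c\<rbrakk>
    \<Longrightarrow> Assoc C a' b' c' \<cdot> ((f \<boxtimes>\<^sub>a g) \<boxtimes>\<^sub>a h) = (f \<boxtimes>\<^sub>a (g \<boxtimes>\<^sub>a h)) \<cdot> Assoc C a b c"
  by (rule assoc_nat) (simp_all add: Hom_iff)

lemma lunit_natural:
  "\<lbrakk>f \<in> Arr C; Dom C f = a; Cod C f = b\<rbrakk>
    \<Longrightarrow> LUnit C b \<cdot> (Id C (Unit C) \<boxtimes>\<^sub>a f) = f \<cdot> LUnit C a"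
  by (rule lunit_nat) (simp add: Hom_iff)

lemma runit_natural:
  "\<lbrakk>f \<in> Arr C; Dom C f = a; Cod C f = b\<rbrakk>
    \<Longrightarrow> RUnit C b \<cdot> (f \<boxtimes>\<^sub>a Id C (Unit C)) = f \<cdot> RUnit C a"
  by (rule runit_nat) (simp add: Hom_iff)

lemma inverse_lunit_natural:
  assumes "f \<in> Arr C" "Dom C f = a" "Cod C f = b"
  shows "inverse_arr C (LUnit C b) \<cdot> f = (Id C (Unit C) \<boxtimes>\<^sub>a f) \<cdot> inverse_arr C (LUnit C a)"
proof (rule iso_cancel_left[of "LUnit C b"])
  have ob: "a \<in> Obj C" "b \<in> Obj C" using assms by auto
  show "LUnit C b \<cdot> (inverse_arr C (LUnit C b) \<cdot> f) =
      LUnit C b \<cdot> ((Id C (Unit C) \<boxtimes>\<^sub>a f) \<cdot> inverse_arr C (LUnit C a))"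
    using assms ob by (simp add: comp_extend2[OF lunit_natural])
qed (use assms in auto)

lemma inverse_runit_natural:
  assumes "f \<in> Arr C" "Dom C f = a" "Cod C f = b"
  shows "inverse_arr C (RUnit C b) \<cdot> f = (f \<boxtimes>\<^sub>a Id C (Unit C)) \<cdot> inverse_arr C (RUnit C a)"
proof (rule iso_cancel_left[of "RUnit C b"])
  have ob: "a \<in> Obj C" "b \<in> Obj C" using assms by auto
  show "RUnit C b \<cdot> (inverse_arr C (RUnit C b) \<cdot> f) =
      RUnit C b \<cdot> ((f \<boxtimes>\<^sub>a Id C (Unit C)) \<cdot> inverse_arr C (RUnit C a))"
    using assms ob by (simp add: comp_extend2[OF runit_natural])
qed (use assms in auto)

text \<open>Naturality of the invertible arrows \<lambda> makes tensoring with the unit conjugate to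
  the identity functor, hence faithful. This and its mirror image allow coherence equations to be
  checked after adding a unit factor.\<close>

lemma unit_ten_faithful:
  assumes "f \<in> Arr C" "g \<in> Arr C" "Dom C f = Dom C g" "Cod C f = Cod C g"
    and "Id C (Unit C) \<boxtimes>\<^sub>a f = Id C (Unit C) \<boxtimes>\<^sub>a g"
  shows "f = g"
proof (rule iso_cancel_right[of "LUnit C (Dom C g)"])
  show "f \<cdot> LUnit C (Dom C g) = g \<cdot> LUnit C (Dom C g)"
    using lunit_natural[of f] lunit_natural[of g] assms by metis
qed (use assms in auto)

lemma ten_unit_faithful:
  assumes "f \<in> Arr C" "g \<in> Arr C" "Dom C f = Dom C g" "Cod C f = Cod C g"
    and "f \<boxtimes>\<^sub>a Id C (Unit C) = g \<boxtimes>\<^sub>a Id C (Unit C)"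
  shows "f = g"
proof (rule iso_cancel_right[of "RUnit C (Dom C g)"])
  show "f \<cdot> RUnit C (Dom C g) = g \<cdot> RUnit C (Dom C g)"
    using runit_natural[of f] runit_natural[of g] assms by metis
qed (use assms in auto)

lemma ten_iso:
  assumes "is_iso C f" "is_iso C g"
  shows "is_iso C (f \<boxtimes>\<^sub>a g)"
proof -
  have "is_inverse C (f \<boxtimes>\<^sub>a g) (inverse_arr C f \<boxtimes>\<^sub>a inverse_arr C g)"
    using assms iso_arr[OF assms(1)] iso_arr[OF assms(2)]
    by (simp add: is_inverse_def Hom_iff interchange)
  then show ?thesis by (auto simp: is_iso_def)
qed

lemma comp_iso:
  assumes "is_iso C f" "is_iso C g" "Cod C f = Dom C g"
  shows "is_iso C (g \<cdot> f)"
proof -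
  have "is_inverse C (g \<cdot> f) (inverse_arr C f \<cdot> inverse_arr C g)"
    using assms iso_arr[OF assms(1)] iso_arr[OF assms(2)]
    by (simp add: is_inverse_def Hom_iff)
  then show ?thesis by (auto simp: is_iso_def)
qed

lemma id_iso: "a \<in> Obj C \<Longrightarrow> is_iso C (Id C a)"
  by (auto simp: is_iso_def is_inverse_def Hom_iff intro!: exI[of _ "Id C a"])

text \<open>Kelly's argument: after tensoring with the unit on the left, both sides are compared along
  the pentagon for \<open>I, I, a, b\<close>.\<close>

lemma lunit_tensor:
  assumes a: "a \<in> Obj C" and b: "b \<in> Obj C"
  shows "LUnit C (a \<boxtimes>\<^sub>o b) \<cdot> Assoc C (Unit C) a b = LUnit C a \<boxtimes>\<^sub>a Id C b"
proof (rule unit_ten_faithful)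
  let ?I = "Unit C"
  let ?i = "Id C ?I"
  \<comment> \<open>The first two arrows on the long side of the pentagon. Precomposing with
    \<open>?k\<close> makes the pentagon applicable, and since \<open>?k\<close> is invertible it
    can be cancelled at the end.\<close>
  let ?k = "Assoc C ?I (?I \<boxtimes>\<^sub>o a) b \<cdot> (Assoc C ?I ?I a \<boxtimes>\<^sub>a Id C b)"
  have k: "?k \<in> Arr C" "Dom C ?k = ((?I \<boxtimes>\<^sub>o ?I) \<boxtimes>\<^sub>o a) \<boxtimes>\<^sub>o b"
      "Cod C ?k = ?I \<boxtimes>\<^sub>o ((?I \<boxtimes>\<^sub>o a) \<boxtimes>\<^sub>o b)"
    using a b by simp_all
  have k_eq: "(?i \<boxtimes>\<^sub>a Assoc C ?I a b) \<cdot> ?k = Assoc C ?I ?I (a \<boxtimes>\<^sub>o b) \<cdot> Assoc C (?I \<boxtimes>\<^sub>o ?I) a b"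
    using pentagon[of ?I ?I a b] a b by simp
  have "(?i \<boxtimes>\<^sub>a (LUnit C (a \<boxtimes>\<^sub>o b) \<cdot> Assoc C ?I a b)) \<cdot> ?k =
      (?i \<boxtimes>\<^sub>a LUnit C (a \<boxtimes>\<^sub>o b)) \<cdot> ((?i \<boxtimes>\<^sub>a Assoc C ?I a b) \<cdot> ?k)"
    using a b k by (subst interchange_extend) simp_all
  also have "\<dots> = ((?i \<boxtimes>\<^sub>a LUnit C (a \<boxtimes>\<^sub>o b)) \<cdot> Assoc C ?I ?I (a \<boxtimes>\<^sub>o b)) \<cdot> Assoc C (?I \<boxtimes>\<^sub>o ?I) a b"
    unfolding k_eq using a b by simp
  also have "\<dots> = (RUnit C ?I \<boxtimes>\<^sub>a (Id C a \<boxtimes>\<^sub>a Id C b)) \<cdot> Assoc C (?I \<boxtimes>\<^sub>o ?I) a b"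
    using triangle[of ?I "a \<boxtimes>\<^sub>o b"] a b by simp
  also have "\<dots> = Assoc C ?I a b \<cdot> ((RUnit C ?I \<boxtimes>\<^sub>a Id C a) \<boxtimes>\<^sub>a Id C b)"
    using a b by (subst assoc_natural) simp_all
  also have "(RUnit C ?I \<boxtimes>\<^sub>a Id C a) \<boxtimes>\<^sub>a Id C b =
      ((?i \<boxtimes>\<^sub>a LUnit C a) \<boxtimes>\<^sub>a Id C b) \<cdot> (Assoc C ?I ?I a \<boxtimes>\<^sub>a Id C b)"
    using triangle[of ?I a, symmetric] a b by (simp add: interchange)
  also have "Assoc C ?I a b \<cdot> \<dots> = (?i \<boxtimes>\<^sub>a (LUnit C a \<boxtimes>\<^sub>a Id C b)) \<cdot> ?k"
    using a b comp_extend2[OF assoc_natural[of ?i "LUnit C a" "Id C b"], of "?I" a b] by simp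
  finally have eq: "(?i \<boxtimes>\<^sub>a (LUnit C (a \<boxtimes>\<^sub>o b) \<cdot> Assoc C ?I a b)) \<cdot> ?k =
      (?i \<boxtimes>\<^sub>a (LUnit C a \<boxtimes>\<^sub>a Id C b)) \<cdot> ?k" .
  show "?i \<boxtimes>\<^sub>a (LUnit C (a \<boxtimes>\<^sub>o b) \<cdot> Assoc C ?I a b) = ?i \<boxtimes>\<^sub>a (LUnit C a \<boxtimes>\<^sub>a Id C b)"
  proof (rule iso_cancel_right[OF _ _ _ _ _ eq])
    show "is_iso C ?k"
      using a b by (intro comp_iso ten_iso id_iso) simp_all
  qed (use a b k in simp_all)
qed (use assms in simp_all)

text \<open>The mirror image of Kelly's argument: after tensoring with the unit on the right and
  postcomposing with the invertible associator of a, b, I, both sides are compared along the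
  pentagon for a, b, I, I, with the triangle used at both ends.\<close>

lemma runit_tensor:
  assumes a: "a \<in> Obj C" and b: "b \<in> Obj C"
  shows "(Id C a \<boxtimes>\<^sub>a RUnit C b) \<cdot> Assoc C a b (Unit C) = RUnit C (a \<boxtimes>\<^sub>o b)"
proof (rule ten_unit_faithful)
  let ?I = "Unit C"
  let ?i = "Id C ?I"
  let ?A = "Assoc C a b ?I"
  have "?A \<cdot> (((Id C a \<boxtimes>\<^sub>a RUnit C b) \<cdot> ?A) \<boxtimes>\<^sub>a ?i) =
      ?A \<cdot> (((Id C a \<boxtimes>\<^sub>a RUnit C b) \<boxtimes>\<^sub>a ?i) \<cdot> (?A \<boxtimes>\<^sub>a ?i))"
    using a b by (simp add: interchange)
  also have "\<dots> = (Id C a \<boxtimes>\<^sub>a (RUnit C b \<boxtimes>\<^sub>a ?i)) \<cdot> (Assoc C a (b \<boxtimes>\<^sub>o ?I) ?I \<cdot> (?A \<boxtimes>\<^sub>a ?i))"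
    using a b comp_extend2[OF assoc_natural[of "Id C a" "RUnit C b" ?i], of a b ?I] by simp
  also have "\<dots> = (Id C a \<boxtimes>\<^sub>a (Id C b \<boxtimes>\<^sub>a LUnit C ?I)) \<cdot>
      ((Id C a \<boxtimes>\<^sub>a Assoc C b ?I ?I) \<cdot> (Assoc C a (b \<boxtimes>\<^sub>o ?I) ?I \<cdot> (?A \<boxtimes>\<^sub>a ?i)))"
    using triangle[of b ?I, symmetric] a b by (simp add: interchange_extend)
  also have "\<dots> = (Id C a \<boxtimes>\<^sub>a (Id C b \<boxtimes>\<^sub>a LUnit C ?I)) \<cdot>
      (Assoc C a b (?I \<boxtimes>\<^sub>o ?I) \<cdot> Assoc C (a \<boxtimes>\<^sub>o b) ?I ?I)"
    using pentagon[of a b ?I ?I] a b by simp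
  also have "\<dots> = ?A \<cdot> ((Id C (a \<boxtimes>\<^sub>o b) \<boxtimes>\<^sub>a LUnit C ?I) \<cdot> Assoc C (a \<boxtimes>\<^sub>o b) ?I ?I)"
    using a b comp_extend2[OF assoc_natural[of "Id C a" "Id C b" "LUnit C ?I", symmetric]] by simp
  also have "\<dots> = ?A \<cdot> (RUnit C (a \<boxtimes>\<^sub>o b) \<boxtimes>\<^sub>a ?i)"
    using triangle[of "a \<boxtimes>\<^sub>o b" ?I] a b by simp
  finally show "((Id C a \<boxtimes>\<^sub>a RUnit C b) \<cdot> ?A) \<boxtimes>\<^sub>a ?i = RUnit C (a \<boxtimes>\<^sub>o b) \<boxtimes>\<^sub>a ?i"
    by (rule iso_cancel_left[rotated -1]) (use a b in simp_all)
qed (use assms in simp_all)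

text \<open>This lemma and the next two restate the unit coherences with inverse unitors, the form
  in which canonical multipliers contain them. In \<open>mult_canon_closed\<close> each of the three
  settles one of the multiplier equations.\<close>

lemma assoc_inverse_lunit:
  assumes "a \<in> Obj C" "b \<in> Obj C"
  shows "Assoc C (Unit C) a b \<cdot> (inverse_arr C (LUnit C a) \<boxtimes>\<^sub>a Id C b) =
    inverse_arr C (LUnit C (a \<boxtimes>\<^sub>o b))"
proof (rule iso_cancel_left[of "LUnit C (a \<boxtimes>\<^sub>o b)"])
  show "LUnit C (a \<boxtimes>\<^sub>o b) \<cdot> (Assoc C (Unit C) a b \<cdot> (inverse_arr C (LUnit C a) \<boxtimes>\<^sub>a Id C b)) =
      LUnit C (a \<boxtimes>\<^sub>o b) \<cdot> inverse_arr C (LUnit C (a \<boxtimes>\<^sub>o b))"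
    using assms by (subst comp_extend[OF lunit_tensor]) (simp_all add: interchange)
qed (use assms in simp_all)

lemma assoc_inverse_runit:
  assumes "a \<in> Obj C" "b \<in> Obj C"
  shows "Assoc C a b (Unit C) \<cdot> inverse_arr C (RUnit C (a \<boxtimes>\<^sub>o b)) =
    Id C a \<boxtimes>\<^sub>a inverse_arr C (RUnit C b)"
proof (rule iso_cancel_left[of "Id C a \<boxtimes>\<^sub>a RUnit C b"])
  show "(Id C a \<boxtimes>\<^sub>a RUnit C b) \<cdot> (Assoc C a b (Unit C) \<cdot> inverse_arr C (RUnit C (a \<boxtimes>\<^sub>o b))) =
      (Id C a \<boxtimes>\<^sub>a RUnit C b) \<cdot> (Id C a \<boxtimes>\<^sub>a inverse_arr C (RUnit C b))"
    using assms by (subst comp_extend[OF runit_tensor]) (simp_all add: interchange)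
qed (use assms in \<open>simp_all add: ten_iso id_iso\<close>)

lemma assoc_inverse_triangle:
  assumes "a \<in> Obj C" "b \<in> Obj C"
  shows "Assoc C a (Unit C) b \<cdot> (inverse_arr C (RUnit C a) \<boxtimes>\<^sub>a Id C b) =
    Id C a \<boxtimes>\<^sub>a inverse_arr C (LUnit C b)"
proof (rule iso_cancel_left[of "Id C a \<boxtimes>\<^sub>a LUnit C b"])
  show "(Id C a \<boxtimes>\<^sub>a LUnit C b) \<cdot> (Assoc C a (Unit C) b \<cdot> (inverse_arr C (RUnit C a) \<boxtimes>\<^sub>a Id C b)) =
      (Id C a \<boxtimes>\<^sub>a LUnit C b) \<cdot> (Id C a \<boxtimes>\<^sub>a inverse_arr C (LUnit C b))"
    using assms by (subst comp_extend[OF triangle]) (simp_all add: interchange)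
qed (use assms in \<open>simp_all add: ten_iso id_iso\<close>)

text \<open>Naturality of \<lambda> along \<lambda>_I itself gives \<lambda> at I \<otimes> I as id
  \<otimes> \<lambda>_I. Then \<open>lunit_tensor\<close> and \<open>triangle\<close> at the unit
  have the same left-hand side, so \<lambda>_I and \<rho>_I agree after tensoring with the
  unit.\<close>

lemma lunit_eq_runit: "LUnit C (Unit C) = RUnit C (Unit C)"
proof -
  let ?I = "Unit C"
  let ?i = "Id C ?I"
  have "LUnit C (?I \<boxtimes>\<^sub>o ?I) = ?i \<boxtimes>\<^sub>a LUnit C ?I"
  proof (rule iso_cancel_left[of "LUnit C ?I"])
    show "LUnit C ?I \<cdot> LUnit C (?I \<boxtimes>\<^sub>o ?I) = LUnit C ?I \<cdot> (?i \<boxtimes>\<^sub>a LUnit C ?I)"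
      by (simp add: lunit_natural)
  qed simp_all
  then have "LUnit C ?I \<boxtimes>\<^sub>a ?i = RUnit C ?I \<boxtimes>\<^sub>a ?i"
    using lunit_tensor[of ?I ?I] triangle[of ?I ?I] by simp
  then show ?thesis
    by (rule ten_unit_faithful[rotated -1]) simp_all
qed

text \<open>The comultiplication I \<rightarrow> I \<otimes> I of the unit; with it the product of
  \<open>conv_sgrp\<close> is the usual convolution of arrows from a coalgebra to an
  algebra.\<close>

abbreviation unit_split :: 'm ("\<Delta>")
  where "\<Delta> \<equiv> inverse_arr C (LUnit C (Unit C))"

text \<open>Coassociativity of \<Delta>. It is the triangle in inverted form, once \<rho>_I is
  replaced by \<lambda>_I.\<close>

lemma unit_split_assoc:
  "Assoc C (Unit C) (Unit C) (Unit C) \<cdot> ((\<Delta> \<boxtimes>\<^sub>a Id C (Unit C)) \<cdot> \<Delta>) =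
    (Id C (Unit C) \<boxtimes>\<^sub>a \<Delta>) \<cdot> \<Delta>"
  using assoc_inverse_triangle[of "Unit C" "Unit C"]
  by (intro comp_extend) (simp_all flip: lunit_eq_runit)

end

section \<open>Convolution and multipliers\<close>

locale semigroup_object = monoidal_category C
  for C :: "('o, 'm) monoidal_data" (structure) +
  fixes S :: "('o, 'm) sg_object"
  assumes sg_object: "is_sg_object C S"
begin

abbreviation s where "s \<equiv> SOb S"
abbreviation \<mu> where "\<mu> \<equiv> SMu S"
abbreviation \<iota> where "\<iota> \<equiv> Id C s"
abbreviation points where "points \<equiv> Hom C (Unit C) s"
abbreviation conv where "conv \<equiv> sprod (conv_sgrp (C, S))"

lemma mu_arr [simp]:
  "s \<in> Obj C" "\<mu> \<in> Arr C" "Dom C \<mu> = s \<boxtimes>\<^sub>o s" "Cod C \<mu> = s"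
  using sg_object by (auto simp: is_sg_object_def Hom_iff)

lemma mu_assoc: "\<mu> \<cdot> (\<mu> \<boxtimes>\<^sub>a \<iota>) = \<mu> \<cdot> ((\<iota> \<boxtimes>\<^sub>a \<mu>) \<cdot> Assoc C s s s)"
  using sg_object by (simp add: is_sg_object_def)

lemma carrier_conv [simp]: "carrier (conv_sgrp (C, S)) = points"
  by (simp add: conv_sgrp_def)

lemma conv_eq: "\<lbrakk>g \<in> points; f \<in> points\<rbrakk> \<Longrightarrow> conv g f = \<mu> \<cdot> ((g \<boxtimes>\<^sub>a f) \<cdot> \<Delta>)"
  by (simp add: conv_sgrp_def Hom_iff)

lemma conv_closed: "\<lbrakk>g \<in> points; f \<in> points\<rbrakk> \<Longrightarrow> conv g f \<in> points"
  by (simp add: conv_eq) (simp add: Hom_iff)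

text \<open>The product of three points splits into \<mu> twice, a triple tensor and \<Delta> twice.
  Associativity of \<mu> introduces an associator, naturality moves it past the points, and
  coassociativity of \<Delta> absorbs it.\<close>

lemma conv_assoc:
  assumes "f \<in> points" "g \<in> points" "h \<in> points"
  shows "conv (conv f g) h = conv f (conv g h)"
proof -
  let ?i = "Id C (Unit C)"
  let ?A = "Assoc C (Unit C) (Unit C) (Unit C)"
  have a: "f \<in> Arr C" "Dom C f = Unit C" "Cod C f = s"
      "g \<in> Arr C" "Dom C g = Unit C" "Cod C g = s" "h \<in> Arr C" "Dom C h = Unit C" "Cod C h = s"
    using assms by (auto simp: Hom_iff)
  have "conv (conv f g) h = \<mu> \<cdot> (((\<mu> \<cdot> ((f \<boxtimes>\<^sub>a g) \<cdot> \<Delta>)) \<boxtimes>\<^sub>a h) \<cdot> \<Delta>)"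
    using conv_closed assms by (simp add: conv_eq)
  also have "\<dots> = (\<mu> \<cdot> (\<mu> \<boxtimes>\<^sub>a \<iota>)) \<cdot> ((((f \<boxtimes>\<^sub>a g) \<boxtimes>\<^sub>a h) \<cdot> (\<Delta> \<boxtimes>\<^sub>a ?i)) \<cdot> \<Delta>)"
    using a by (simp add: interchange interchange_extend)
  also have "\<dots> = \<mu> \<cdot> ((\<iota> \<boxtimes>\<^sub>a \<mu>) \<cdot> (Assoc C s s s \<cdot> (((f \<boxtimes>\<^sub>a g) \<boxtimes>\<^sub>a h) \<cdot> ((\<Delta> \<boxtimes>\<^sub>a ?i) \<cdot> \<Delta>))))"
    unfolding mu_assoc using a by simp
  also have "\<dots> = \<mu> \<cdot> ((\<iota> \<boxtimes>\<^sub>a \<mu>) \<cdot> ((f \<boxtimes>\<^sub>a (g \<boxtimes>\<^sub>a h)) \<cdot> (?A \<cdot> ((\<Delta> \<boxtimes>\<^sub>a ?i) \<cdot> \<Delta>))))"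
    using a by (simp add: comp_extend2[OF assoc_natural[of f g h]])
  also have "\<dots> = \<mu> \<cdot> ((\<iota> \<boxtimes>\<^sub>a \<mu>) \<cdot> ((f \<boxtimes>\<^sub>a (g \<boxtimes>\<^sub>a h)) \<cdot> ((?i \<boxtimes>\<^sub>a \<Delta>) \<cdot> \<Delta>)))"
    by (simp only: unit_split_assoc)
  also have "\<dots> = \<mu> \<cdot> ((f \<boxtimes>\<^sub>a (\<mu> \<cdot> ((g \<boxtimes>\<^sub>a h) \<cdot> \<Delta>))) \<cdot> \<Delta>)"
    using a by (simp add: interchange_extend)
  also have "\<dots> = conv f (conv g h)"
    using conv_closed assms by (simp add: conv_eq)
  finally show ?thesis .
qed

lemma is_sgrp_conv: "is_sgrp (conv_sgrp (C, S))"
  by (auto simp: is_sgrp_def conv_closed conv_assoc)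

section \<open>The multiplier monoid and canonical multipliers\<close>

lemma carrier_MultMon:
  "ArrPair L R \<in> carrier (MultMon C S) \<longleftrightarrow>
    L \<in> Arr C \<and> Dom C L = s \<and> Cod C L = s \<and> R \<in> Arr C \<and> Dom C R = s \<and> Cod C R = s \<and>
    L \<cdot> \<mu> = \<mu> \<cdot> (L \<boxtimes>\<^sub>a \<iota>) \<and> R \<cdot> \<mu> = \<mu> \<cdot> (\<iota> \<boxtimes>\<^sub>a R) \<and> \<mu> \<cdot> (\<iota> \<boxtimes>\<^sub>a L) = \<mu> \<cdot> (R \<boxtimes>\<^sub>a \<iota>)"
  by (auto simp: MultMon_def Hom_iff Let_def)

lemma MapPair_MultMon [simp]: "MapPair L R \<notin> carrier (MultMon C S)"
  by (simp add: MultMon_def Let_def)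

lemma MultMon_simps [simp]:
  "mult (MultMon C S) = mult_prod C" "one (MultMon C S) = ArrPair \<iota> \<iota>"
  by (simp_all add: MultMon_def Let_def)

text \<open>The mixed equation is the one that forces the reversed order in the second component: L'
  is traded for R' on the other tensor factor, R' then commutes with L because they act on different
  factors, and finally L is traded for R.\<close>

lemma mult_prod_closed:
  assumes "ArrPair L' R' \<in> carrier (MultMon C S)" "ArrPair L R \<in> carrier (MultMon C S)"
  shows "ArrPair (L' \<cdot> L) (R \<cdot> R') \<in> carrier (MultMon C S)"
proof -
  have a: "L \<in> Arr C" "Dom C L = s" "Cod C L = s" "R \<in> Arr C" "Dom C R = s" "Cod C R = s"
      "L' \<in> Arr C" "Dom C L' = s" "Cod C L' = s" "R' \<in> Arr C" "Dom C R' = s" "Cod C R' = s"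
    and e: "L \<cdot> \<mu> = \<mu> \<cdot> (L \<boxtimes>\<^sub>a \<iota>)" "R \<cdot> \<mu> = \<mu> \<cdot> (\<iota> \<boxtimes>\<^sub>a R)" "\<mu> \<cdot> (\<iota> \<boxtimes>\<^sub>a L) = \<mu> \<cdot> (R \<boxtimes>\<^sub>a \<iota>)"
      "L' \<cdot> \<mu> = \<mu> \<cdot> (L' \<boxtimes>\<^sub>a \<iota>)" "R' \<cdot> \<mu> = \<mu> \<cdot> (\<iota> \<boxtimes>\<^sub>a R')" "\<mu> \<cdot> (\<iota> \<boxtimes>\<^sub>a L') = \<mu> \<cdot> (R' \<boxtimes>\<^sub>a \<iota>)"
    using assms unfolding carrier_MultMon by auto
  have "\<mu> \<cdot> (\<iota> \<boxtimes>\<^sub>a (L' \<cdot> L)) = (\<mu> \<cdot> (\<iota> \<boxtimes>\<^sub>a L')) \<cdot> (\<iota> \<boxtimes>\<^sub>a L)"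
    using a by (simp add: interchange)
  also have "\<dots> = (\<mu> \<cdot> (\<iota> \<boxtimes>\<^sub>a L)) \<cdot> (R' \<boxtimes>\<^sub>a \<iota>)"
    unfolding e(6) using a by (simp add: interchange)
  also have "\<dots> = \<mu> \<cdot> ((R \<cdot> R') \<boxtimes>\<^sub>a \<iota>)"
    unfolding e(3) using a by (simp add: interchange)
  finally have "\<mu> \<cdot> (\<iota> \<boxtimes>\<^sub>a (L' \<cdot> L)) = \<mu> \<cdot> ((R \<cdot> R') \<boxtimes>\<^sub>a \<iota>)" .
  moreover have "L' \<cdot> (L \<cdot> \<mu>) = \<mu> \<cdot> ((L' \<cdot> L) \<boxtimes>\<^sub>a \<iota>)"
    using a by (simp add: e comp_extend2[OF e(4)] interchange)
  moreover have "R \<cdot> (R' \<cdot> \<mu>) = \<mu> \<cdot> (\<iota> \<boxtimes>\<^sub>a (R \<cdot> R'))"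
    using a by (simp add: e comp_extend2[OF e(2)] interchange)
  ultimately show ?thesis
    using a by (simp add: carrier_MultMon)
qed

lemma monoid_MultMon: "monoid (MultMon C S)"
proof
  show "x \<otimes>\<^bsub>MultMon C S\<^esub> y \<in> carrier (MultMon C S)"
    if "x \<in> carrier (MultMon C S)" "y \<in> carrier (MultMon C S)" for x y
    using that by (cases x; cases y) (simp_all add: mult_prod_closed)
  show "x \<otimes>\<^bsub>MultMon C S\<^esub> y \<otimes>\<^bsub>MultMon C S\<^esub> z = x \<otimes>\<^bsub>MultMon C S\<^esub> (y \<otimes>\<^bsub>MultMon C S\<^esub> z)"
    if "x \<in> carrier (MultMon C S)" "y \<in> carrier (MultMon C S)" "z \<in> carrier (MultMon C S)" for x y z
    using that by (cases x; cases y; cases z) (simp_all add: carrier_MultMon)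
  show "\<one>\<^bsub>MultMon C S\<^esub> \<in> carrier (MultMon C S)"
    by (simp add: carrier_MultMon)
  show "\<one>\<^bsub>MultMon C S\<^esub> \<otimes>\<^bsub>MultMon C S\<^esub> x = x" "x \<otimes>\<^bsub>MultMon C S\<^esub> \<one>\<^bsub>MultMon C S\<^esub> = x"
    if "x \<in> carrier (MultMon C S)" for x
    using that by (cases x; simp add: carrier_MultMon)+
qed

text \<open>The components of \<open>mult_canon\<close>, bracketed to the right as the simplifier
  normalizes composites.\<close>

definition left_mult where "left_mult f = \<mu> \<cdot> ((f \<boxtimes>\<^sub>a \<iota>) \<cdot> inverse_arr C (LUnit C s))"
definition right_mult where "right_mult f = \<mu> \<cdot> ((\<iota> \<boxtimes>\<^sub>a f) \<cdot> inverse_arr C (RUnit C s))"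

lemma mult_canon_eq: "f \<in> points \<Longrightarrow> mult_canon (C, S) f = ArrPair (left_mult f) (right_mult f)"
  by (simp add: mult_canon_def left_mult_def right_mult_def Let_def Hom_iff)

lemma left_mult_point:
  assumes "f \<in> points" "h \<in> points"
  shows "left_mult f \<cdot> h = conv f h"
proof -
  have a: "f \<in> Arr C" "Dom C f = Unit C" "Cod C f = s" "h \<in> Arr C" "Dom C h = Unit C" "Cod C h = s"
    using assms by (auto simp: Hom_iff)
  show ?thesis
    using assms a by (simp add: left_mult_def conv_eq inverse_lunit_natural[of h] interchange_extend)
qed

text \<open>Naturality of the right unitor leaves the inverse of \<rho>_I where convolution has the
  inverse of \<lambda>_I; \<open>lunit_eq_runit\<close> identifies the two.\<close>

lemma right_mult_point:
  assumes "f \<in> points" "h \<in> points"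
  shows "right_mult f \<cdot> h = conv h f"
proof -
  have a: "f \<in> Arr C" "Dom C f = Unit C" "Cod C f = s" "h \<in> Arr C" "Dom C h = Unit C" "Cod C h = s"
    using assms by (auto simp: Hom_iff)
  show ?thesis
    using assms a
    by (simp add: right_mult_def conv_eq inverse_runit_natural[of h] interchange_extend lunit_eq_runit)
qed

lemma point_arr:
  assumes "f \<in> points"
  shows "f \<in> Arr C" "Dom C f = Unit C" "Cod C f = s"
  using assms by (auto simp: Hom_iff)

lemma mult_arr [simp]:
  assumes "f \<in> points"
  shows "left_mult f \<in> Arr C" "Dom C (left_mult f) = s" "Cod C (left_mult f) = s"
    "right_mult f \<in> Arr C" "Dom C (right_mult f) = s" "Cod C (right_mult f) = s"
  using point_arr[OF assms] by (simp_all add: left_mult_def right_mult_def)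

text \<open>The first and last equations are the linearity of L and R over \<mu>. In the other two,
  naturality of the unitor places the multiplier on the tensor factor not occupied by f, and the
  mixed equation carries it over to f. In particular the canonical multipliers absorb products from
  both sides.\<close>

lemma multiplier_comp_canon:
  assumes x: "ArrPair L R \<in> carrier (MultMon C S)" and f: "f \<in> points"
  shows "L \<cdot> left_mult f = left_mult (L \<cdot> f)" "left_mult f \<cdot> L = left_mult (R \<cdot> f)"
    "right_mult f \<cdot> R = right_mult (L \<cdot> f)" "R \<cdot> right_mult f = right_mult (R \<cdot> f)"
proof -
  have a: "L \<in> Arr C" "Dom C L = s" "Cod C L = s" "R \<in> Arr C" "Dom C R = s" "Cod C R = s"
    and e: "L \<cdot> \<mu> = \<mu> \<cdot> (L \<boxtimes>\<^sub>a \<iota>)" "R \<cdot> \<mu> = \<mu> \<cdot> (\<iota> \<boxtimes>\<^sub>a R)" "\<mu> \<cdot> (\<iota> \<boxtimes>\<^sub>a L) = \<mu> \<cdot> (R \<boxtimes>\<^sub>a \<iota>)"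
    using x unfolding carrier_MultMon by auto
  note fa = point_arr[OF f]
  show "L \<cdot> left_mult f = left_mult (L \<cdot> f)"
    using a fa by (simp add: left_mult_def comp_extend2[OF e(1)] interchange_extend)
  show "R \<cdot> right_mult f = right_mult (R \<cdot> f)"
    using a fa by (simp add: right_mult_def comp_extend2[OF e(2)] interchange_extend)
  have "left_mult f \<cdot> L = \<mu> \<cdot> ((\<iota> \<boxtimes>\<^sub>a L) \<cdot> ((f \<boxtimes>\<^sub>a \<iota>) \<cdot> inverse_arr C (LUnit C s)))"
    using a fa by (simp add: left_mult_def inverse_lunit_natural[of L] interchange_extend)
  also have "\<dots> = left_mult (R \<cdot> f)"
    using a fa by (subst comp_extend2[OF e(3)]) (simp_all add: left_mult_def interchange_extend)
  finally show "left_mult f \<cdot> L = left_mult (R \<cdot> f)" .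
  have "right_mult f \<cdot> R = \<mu> \<cdot> ((R \<boxtimes>\<^sub>a \<iota>) \<cdot> ((\<iota> \<boxtimes>\<^sub>a f) \<cdot> inverse_arr C (RUnit C s)))"
    using a fa by (simp add: right_mult_def inverse_runit_natural[of R] interchange_extend)
  also have "\<dots> = right_mult (L \<cdot> f)"
    using a fa by (subst comp_extend2[OF e(3)[symmetric]]) (simp_all add: right_mult_def interchange_extend)
  finally show "right_mult f \<cdot> R = right_mult (L \<cdot> f)" .
qed

text \<open>Each equation is associativity of \<mu> with the point f inserted in one of the three
  arguments: first for the left equation, last for the right one, in the middle for the mixed one.
  The remaining associator is absorbed by the matching inverse-unitor lemma.\<close>

lemma mult_canon_closed:
  assumes "f \<in> points"
  shows "mult_canon (C, S) f \<in> carrier (MultMon C S)"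
proof -
  note fa = point_arr[OF assms]
  let ?l = "inverse_arr C (LUnit C s)" and ?r = "inverse_arr C (RUnit C s)"
  have "left_mult f \<cdot> \<mu> = (\<mu> \<cdot> ((\<iota> \<boxtimes>\<^sub>a \<mu>) \<cdot> (f \<boxtimes>\<^sub>a (\<iota> \<boxtimes>\<^sub>a \<iota>)))) \<cdot> inverse_arr C (LUnit C (s \<boxtimes>\<^sub>o s))"
    using fa by (simp add: left_mult_def inverse_lunit_natural[of \<mu>] interchange_extend)
  also have "\<dots> = \<mu> \<cdot> ((\<iota> \<boxtimes>\<^sub>a \<mu>) \<cdot> ((f \<boxtimes>\<^sub>a (\<iota> \<boxtimes>\<^sub>a \<iota>)) \<cdot> (Assoc C (Unit C) s s \<cdot> (?l \<boxtimes>\<^sub>a \<iota>))))"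
    using fa by (simp add: assoc_inverse_lunit)
  \<comment> \<open>The rule \<open>ten_ids\<close> is withheld, since it would fuse \<iota>
    \<otimes> \<iota> into one identity and hide the triple tensor that associator naturality
    needs.\<close>
  also have "\<dots> = (\<mu> \<cdot> ((\<iota> \<boxtimes>\<^sub>a \<mu>) \<cdot> Assoc C s s s)) \<cdot> (((f \<boxtimes>\<^sub>a \<iota>) \<boxtimes>\<^sub>a \<iota>) \<cdot> (?l \<boxtimes>\<^sub>a \<iota>))"
    using fa comp_extend2[OF assoc_natural[of f \<iota> \<iota>]] by (simp del: ten_ids)
  also have "\<dots> = \<mu> \<cdot> (left_mult f \<boxtimes>\<^sub>a \<iota>)"
    unfolding mu_assoc[symmetric] using fa by (simp add: left_mult_def interchange)
  finally have 1: "left_mult f \<cdot> \<mu> = \<mu> \<cdot> (left_mult f \<boxtimes>\<^sub>a \<iota>)" .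
  have "right_mult f \<cdot> \<mu> = (\<mu> \<cdot> (\<mu> \<boxtimes>\<^sub>a \<iota>)) \<cdot> (((\<iota> \<boxtimes>\<^sub>a \<iota>) \<boxtimes>\<^sub>a f) \<cdot> inverse_arr C (RUnit C (s \<boxtimes>\<^sub>o s)))"
    using fa by (simp add: right_mult_def inverse_runit_natural[of \<mu>] interchange_extend)
  also have "\<dots> = \<mu> \<cdot> ((\<iota> \<boxtimes>\<^sub>a \<mu>) \<cdot> ((\<iota> \<boxtimes>\<^sub>a (\<iota> \<boxtimes>\<^sub>a f)) \<cdot>
      (Assoc C s s (Unit C) \<cdot> inverse_arr C (RUnit C (s \<boxtimes>\<^sub>o s)))))"
    unfolding mu_assoc using fa comp_extend2[OF assoc_natural[of \<iota> \<iota> f]] by (simp del: ten_ids)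
  also have "\<dots> = \<mu> \<cdot> (\<iota> \<boxtimes>\<^sub>a right_mult f)"
    using fa by (simp add: right_mult_def assoc_inverse_runit interchange)
  finally have 2: "right_mult f \<cdot> \<mu> = \<mu> \<cdot> (\<iota> \<boxtimes>\<^sub>a right_mult f)" .
  have "\<mu> \<cdot> (right_mult f \<boxtimes>\<^sub>a \<iota>) = (\<mu> \<cdot> (\<mu> \<boxtimes>\<^sub>a \<iota>)) \<cdot> (((\<iota> \<boxtimes>\<^sub>a f) \<boxtimes>\<^sub>a \<iota>) \<cdot> (?r \<boxtimes>\<^sub>a \<iota>))"
    using fa by (simp add: right_mult_def interchange)
  also have "\<dots> = \<mu> \<cdot> ((\<iota> \<boxtimes>\<^sub>a \<mu>) \<cdot> ((\<iota> \<boxtimes>\<^sub>a (f \<boxtimes>\<^sub>a \<iota>)) \<cdot> (Assoc C s (Unit C) s \<cdot> (?r \<boxtimes>\<^sub>a \<iota>))))"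
    unfolding mu_assoc using fa comp_extend2[OF assoc_natural[of \<iota> f \<iota>]] by (simp del: ten_ids)
  also have "\<dots> = \<mu> \<cdot> (\<iota> \<boxtimes>\<^sub>a left_mult f)"
    using fa by (simp add: left_mult_def assoc_inverse_triangle interchange)
  finally show ?thesis
    using assms 1 2 by (simp add: mult_canon_eq carrier_MultMon)
qed

end

section \<open>Translational hulls\<close>

lemma carrier_TrHullMon:
  "MapPair L R \<in> carrier (TrHullMon A) \<longleftrightarrow>
    L \<in> carrier A \<rightarrow>\<^sub>E carrier A \<and> R \<in> carrier A \<rightarrow>\<^sub>E carrier A \<and>
    (\<forall>x \<in> carrier A. \<forall>y \<in> carrier A.
       L (x \<star>\<^bsub>A\<^esub> y) = L x \<star>\<^bsub>A\<^esub> y \<and> R (x \<star>\<^bsub>A\<^esub> y) = x \<star>\<^bsub>A\<^esub> R y \<and> R x \<star>\<^bsub>A\<^esub> y = x \<star>\<^bsub>A\<^esub> L y)"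
  by (auto simp: TrHullMon_def)

lemma translationD:
  assumes "MapPair L R \<in> carrier (TrHullMon A)"
  shows "x \<in> carrier A \<Longrightarrow> L x \<in> carrier A" "x \<in> carrier A \<Longrightarrow> R x \<in> carrier A"
    "\<lbrakk>x \<in> carrier A; y \<in> carrier A\<rbrakk> \<Longrightarrow> L (x \<star>\<^bsub>A\<^esub> y) = L x \<star>\<^bsub>A\<^esub> y"
    "\<lbrakk>x \<in> carrier A; y \<in> carrier A\<rbrakk> \<Longrightarrow> R (x \<star>\<^bsub>A\<^esub> y) = x \<star>\<^bsub>A\<^esub> R y"
    "\<lbrakk>x \<in> carrier A; y \<in> carrier A\<rbrakk> \<Longrightarrow> R x \<star>\<^bsub>A\<^esub> y = x \<star>\<^bsub>A\<^esub> L y"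
  using assms by (auto simp: carrier_TrHullMon)

lemma ArrPair_TrHullMon [simp]: "ArrPair L R \<notin> carrier (TrHullMon A)"
  by (simp add: TrHullMon_def)

lemma TrHullMon_simps [simp]:
  "mult (TrHullMon A) = hull_prod (carrier A)"
  "one (TrHullMon A) = MapPair (\<lambda>x \<in> carrier A. x) (\<lambda>x \<in> carrier A. x)"
  by (simp_all add: TrHullMon_def)

lemma monoid_TrHullMon:
  assumes "is_sgrp A"
  shows "monoid (TrHullMon A)"
proof
  show "p \<otimes>\<^bsub>TrHullMon A\<^esub> q \<in> carrier (TrHullMon A)"
    if pq: "p \<in> carrier (TrHullMon A)" "q \<in> carrier (TrHullMon A)" for p q
  proof -
    obtain L R L' R' where e: "p = MapPair L R" "q = MapPair L' R'"
      using pq by (cases p; cases q) auto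
    note d = translationD[OF pq(1)[unfolded e]] translationD[OF pq(2)[unfolded e]]
    show ?thesis
      unfolding e by (simp add: carrier_TrHullMon compose_eq d sgrp_closed[OF assms])
        (use pq e in \<open>auto simp: carrier_TrHullMon compose_def\<close>)
  qed
  show "p \<otimes>\<^bsub>TrHullMon A\<^esub> q \<otimes>\<^bsub>TrHullMon A\<^esub> r = p \<otimes>\<^bsub>TrHullMon A\<^esub> (q \<otimes>\<^bsub>TrHullMon A\<^esub> r)"
    if "p \<in> carrier (TrHullMon A)" "q \<in> carrier (TrHullMon A)" "r \<in> carrier (TrHullMon A)" for p q r
    using that
    by (cases p; cases q; cases r) (auto simp: carrier_TrHullMon compose_def fun_eq_iff PiE_mem)
  show "\<one>\<^bsub>TrHullMon A\<^esub> \<in> carrier (TrHullMon A)"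
    using sgrp_closed[OF assms] by (auto simp: carrier_TrHullMon)
  show "\<one>\<^bsub>TrHullMon A\<^esub> \<otimes>\<^bsub>TrHullMon A\<^esub> p = p" "p \<otimes>\<^bsub>TrHullMon A\<^esub> \<one>\<^bsub>TrHullMon A\<^esub> = p"
    if "p \<in> carrier (TrHullMon A)" for p
    using that
    by (cases p; auto simp: carrier_TrHullMon PiE_def compose_id_left compose_id_right)+
qed

lemma canon_closed: "\<lbrakk>is_sgrp A; x \<in> carrier A\<rbrakk> \<Longrightarrow> canon A x \<in> carrier (TrHullMon A)"
  by (auto simp: canon_def carrier_TrHullMon sgrp_closed sgrp_assoc)

text \<open>If \<open>g\<close> is non-degenerate, every element of \<open>A\<close> has the forms \<open>g b * a\<close> and \<open>a * g b\<close>, so that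
  \<open>p\<close> determines \<open>q\<close>.\<close>

definition lifts :: "'b sgrp \<Rightarrow> 'a sgrp \<Rightarrow> ('b \<Rightarrow> 'a) \<Rightarrow> 'b pairs \<Rightarrow> 'a pairs \<Rightarrow> bool" where
  "lifts B A g p q \<longleftrightarrow> q \<in> carrier (TrHullMon A) \<and> (\<exists>L R L' R'. p = MapPair L R \<and> q = MapPair L' R' \<and>
     (\<forall>b \<in> carrier B. \<forall>a \<in> carrier A.
        L' (g b \<star>\<^bsub>A\<^esub> a) = g (L b) \<star>\<^bsub>A\<^esub> a \<and> R' (a \<star>\<^bsub>A\<^esub> g b) = a \<star>\<^bsub>A\<^esub> g (R b)))"

text \<open>The description is justified by \<open>lifts_exists\<close> and
  \<open>lifts_unique\<close> below; the restriction to the carrier makes the map extensional, as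
  \<open>monoid_hom\<close> demands.\<close>

definition hull_map :: "'b sgrp \<Rightarrow> 'a sgrp \<Rightarrow> ('b \<Rightarrow> 'a) \<Rightarrow> 'b pairs \<Rightarrow> 'a pairs" where
  "hull_map B A g = (\<lambda>p \<in> carrier (TrHullMon B). THE q. lifts B A g p q)"

text \<open>The elements \<open>c b\<close> play the role of canonical elements of M, and L, R
  record how x multiplies them. Applying k to \<open>xc\<close> and \<open>cx\<close> turns these
  into equations between products with canonical translations of A; evaluating them at a gives the
  two conditions of \<open>lifts\<close>. M is left abstract so that it can be a translational hull
  as well as a multiplier monoid.\<close>

lemma lifts_of_hom:
  assumes B: "is_sgrp B" and A: "is_sgrp A" and g: "g \<in> sgrp_hom B A"
    and L: "L \<in> carrier B \<rightarrow> carrier B" and R: "R \<in> carrier B \<rightarrow> carrier B"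
    and k: "k \<in> hom M (TrHullMon A)" and x: "x \<in> carrier M" and c: "c \<in> carrier B \<rightarrow> carrier M"
    and kc: "\<And>b. b \<in> carrier B \<Longrightarrow> k (c b) = canon A (g b)"
    and xc: "\<And>b. b \<in> carrier B \<Longrightarrow> x \<otimes>\<^bsub>M\<^esub> c b = c (L b)"
    and cx: "\<And>b. b \<in> carrier B \<Longrightarrow> c b \<otimes>\<^bsub>M\<^esub> x = c (R b)"
  shows "lifts B A g (MapPair L R) (k x)"
proof -
  have kx: "k x \<in> carrier (TrHullMon A)"
    using k x by (auto simp: hom_def)
  then obtain L' R' where LR: "k x = MapPair L' R'"
    by (cases "k x") auto
  have "L' (g b \<star>\<^bsub>A\<^esub> a) = g (L b) \<star>\<^bsub>A\<^esub> a \<and> R' (a \<star>\<^bsub>A\<^esub> g b) = a \<star>\<^bsub>A\<^esub> g (R b)"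
    if b: "b \<in> carrier B" and a: "a \<in> carrier A" for a b
  proof
    have "k x \<otimes>\<^bsub>TrHullMon A\<^esub> canon A (g b) = k (x \<otimes>\<^bsub>M\<^esub> c b)"
      using k x c b by (auto simp: hom_def kc Pi_iff)
    also have "\<dots> = canon A (g (L b))"
      using L b by (auto simp: xc kc Pi_iff)
    finally have "compose (carrier A) L' (\<lambda>y \<in> carrier A. g b \<star>\<^bsub>A\<^esub> y) = (\<lambda>y \<in> carrier A. g (L b) \<star>\<^bsub>A\<^esub> y)"
      by (simp add: LR canon_def)
    from fun_cong[OF this, of a] show "L' (g b \<star>\<^bsub>A\<^esub> a) = g (L b) \<star>\<^bsub>A\<^esub> a"
      using a by (simp add: compose_def)
    \<comment> \<open>The factors are exchanged because \<open>hull_prod\<close> reverses second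
      components: in this order the canonical translation acts first on a, which produces the
      argument \<open>a * g b\<close> of \<open>R'\<close>.\<close>
    have "canon A (g b) \<otimes>\<^bsub>TrHullMon A\<^esub> k x = k (c b \<otimes>\<^bsub>M\<^esub> x)"
      using k x c b by (auto simp: hom_def kc Pi_iff)
    also have "\<dots> = canon A (g (R b))"
      using R b by (auto simp: cx kc Pi_iff)
    finally have "compose (carrier A) R' (\<lambda>y \<in> carrier A. y \<star>\<^bsub>A\<^esub> g b) = (\<lambda>y \<in> carrier A. y \<star>\<^bsub>A\<^esub> g (R b))"
      by (simp add: LR canon_def)
    from fun_cong[OF this, of a] show "R' (a \<star>\<^bsub>A\<^esub> g b) = a \<star>\<^bsub>A\<^esub> g (R b)"
      using a by (simp add: compose_def)
  qed
  then show ?thesis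
    using kx LR by (auto simp: lifts_def)
qed

section \<open>Extension of translations along a non-degenerate homomorphism\<close>

locale nondegenerate_hom =
  fixes B :: "'b sgrp" and A :: "'a sgrp" and g :: "'b \<Rightarrow> 'a"
  assumes B: "is_sgrp B" and A: "is_sgrp A" and g: "g \<in> sgrp_hom B A" and nd_A: "nondegenerate A"
    and left_factor: "x \<in> carrier A \<Longrightarrow> \<exists>b \<in> carrier B. \<exists>a \<in> carrier A. x = g b \<star>\<^bsub>A\<^esub> a"
    and right_factor: "x \<in> carrier A \<Longrightarrow> \<exists>b \<in> carrier B. \<exists>a \<in> carrier A. x = a \<star>\<^bsub>A\<^esub> g b"
begin

lemma hom_closed [simp]: "b \<in> carrier B \<Longrightarrow> g b \<in> carrier A"
  using g by (rule sgrp_hom_closed)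

lemma prod_closed [simp]: "\<lbrakk>x \<in> carrier A; y \<in> carrier A\<rbrakk> \<Longrightarrow> x \<star>\<^bsub>A\<^esub> y \<in> carrier A"
  using A by (rule sgrp_closed)

lemma prod_assoc [simp]:
  "\<lbrakk>x \<in> carrier A; y \<in> carrier A; z \<in> carrier A\<rbrakk> \<Longrightarrow> (x \<star>\<^bsub>A\<^esub> y) \<star>\<^bsub>A\<^esub> z = x \<star>\<^bsub>A\<^esub> (y \<star>\<^bsub>A\<^esub> z)"
  using A by (rule sgrp_assoc)

lemma hom_mult: "\<lbrakk>b \<in> carrier B; c \<in> carrier B\<rbrakk> \<Longrightarrow> g (b \<star>\<^bsub>B\<^esub> c) = g b \<star>\<^bsub>A\<^esub> g c"
  using g by (rule sgrp_hom_mult)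

text \<open>Since every element of A has the form a * g b, the separation condition of
  non-degeneracy can be tested on such products. The visible factor g b is what the linking equation
  of a translation of B can act on.\<close>

lemma cancel_left:
  assumes "y \<in> carrier A" "z \<in> carrier A"
    and "\<And>a b. \<lbrakk>a \<in> carrier A; b \<in> carrier B\<rbrakk> \<Longrightarrow> a \<star>\<^bsub>A\<^esub> (g b \<star>\<^bsub>A\<^esub> y) = a \<star>\<^bsub>A\<^esub> (g b \<star>\<^bsub>A\<^esub> z)"
  shows "y = z"
proof -
  have "x \<star>\<^bsub>A\<^esub> y = x \<star>\<^bsub>A\<^esub> z" if "x \<in> carrier A" for x
    using right_factor[OF that] assms by auto
  then show ?thesis
    using nd_A assms(1,2) unfolding nondegenerate_def by blast
qed

lemma cancel_right:
  assumes "y \<in> carrier A" "z \<in> carrier A"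
    and "\<And>a b. \<lbrakk>a \<in> carrier A; b \<in> carrier B\<rbrakk> \<Longrightarrow> y \<star>\<^bsub>A\<^esub> (g b \<star>\<^bsub>A\<^esub> a) = z \<star>\<^bsub>A\<^esub> (g b \<star>\<^bsub>A\<^esub> a)"
  shows "y = z"
proof -
  have "y \<star>\<^bsub>A\<^esub> x = z \<star>\<^bsub>A\<^esub> x" if "x \<in> carrier A" for x
    using left_factor[OF that] assms by auto
  then show ?thesis
    using nd_A assms(1,2) unfolding nondegenerate_def by blast
qed

lemma lifts_unique:
  assumes "lifts B A g p q" "lifts B A g p q'"
  shows "q = q'"
proof -
  obtain L R L1 R1 L2 R2 where p: "p = MapPair L R" and q: "q = MapPair L1 R1" "q' = MapPair L2 R2"
    and mem: "MapPair L1 R1 \<in> carrier (TrHullMon A)" "MapPair L2 R2 \<in> carrier (TrHullMon A)"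
    and 1: "\<forall>b \<in> carrier B. \<forall>a \<in> carrier A.
        L1 (g b \<star>\<^bsub>A\<^esub> a) = g (L b) \<star>\<^bsub>A\<^esub> a \<and> R1 (a \<star>\<^bsub>A\<^esub> g b) = a \<star>\<^bsub>A\<^esub> g (R b)"
    and 2: "\<forall>b \<in> carrier B. \<forall>a \<in> carrier A.
        L2 (g b \<star>\<^bsub>A\<^esub> a) = g (L b) \<star>\<^bsub>A\<^esub> a \<and> R2 (a \<star>\<^bsub>A\<^esub> g b) = a \<star>\<^bsub>A\<^esub> g (R b)"
    using assms by (auto simp: lifts_def)
  have "L1 x = L2 x" if "x \<in> carrier A" for x
    using left_factor[OF that] 1 2 by auto
  moreover have "R1 x = R2 x" if "x \<in> carrier A" for x
    using right_factor[OF that] 1 2 by auto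
  ultimately show ?thesis
    using mem unfolding q carrier_TrHullMon by (auto intro: PiE_ext)
qed

lemma lifts_exists:
  assumes p: "p \<in> carrier (TrHullMon B)"
  shows "\<exists>q. lifts B A g p q"
proof -
  obtain L R where LR: "p = MapPair L R"
    using p by (cases p) auto
  have L [simp]: "L b \<in> carrier B" and R [simp]: "R b \<in> carrier B" if "b \<in> carrier B" for b
    using p that unfolding LR carrier_TrHullMon by auto
  \<comment> \<open>The linking equation R b * c = b * L c of p, transported to A along g.\<close>
  have mid: "g (R b) \<star>\<^bsub>A\<^esub> g c = g b \<star>\<^bsub>A\<^esub> g (L c)" if "b \<in> carrier B" "c \<in> carrier B" for b c
    using p that unfolding LR carrier_TrHullMon by (metis L R hom_mult)
  have mid': "g (R b) \<star>\<^bsub>A\<^esub> (g c \<star>\<^bsub>A\<^esub> a) = g b \<star>\<^bsub>A\<^esub> (g (L c) \<star>\<^bsub>A\<^esub> a)"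
    if "b \<in> carrier B" "c \<in> carrier B" "a \<in> carrier A" for a b c
    using mid[of b c] prod_assoc[of "g (R b)" "g c" a] prod_assoc[of "g b" "g (L c)" a] that by simp
  obtain \<beta> \<alpha> where l: "\<And>x. x \<in> carrier A \<Longrightarrow> \<beta> x \<in> carrier B" "\<And>x. x \<in> carrier A \<Longrightarrow> \<alpha> x \<in> carrier A"
    and l_eq: "\<And>x. x \<in> carrier A \<Longrightarrow> g (\<beta> x) \<star>\<^bsub>A\<^esub> \<alpha> x = x"
    using left_factor by metis
  obtain \<delta> \<gamma> where r: "\<And>x. x \<in> carrier A \<Longrightarrow> \<delta> x \<in> carrier B" "\<And>x. x \<in> carrier A \<Longrightarrow> \<gamma> x \<in> carrier A"
    and r_eq: "\<And>x. x \<in> carrier A \<Longrightarrow> \<gamma> x \<star>\<^bsub>A\<^esub> g (\<delta> x) = x"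
    using right_factor by metis
  \<comment> \<open>The values are read off a chosen factorization. The facts \<open>L'\<close> and
    \<open>R'\<close> below show that the choice does not matter, and the translation laws are then
    deduced from these facts.\<close>
  define L' where "L' = (\<lambda>x \<in> carrier A. g (L (\<beta> x)) \<star>\<^bsub>A\<^esub> \<alpha> x)"
  define R' where "R' = (\<lambda>x \<in> carrier A. \<gamma> x \<star>\<^bsub>A\<^esub> g (R (\<delta> x)))"
  have L'_in: "L' \<in> carrier A \<rightarrow>\<^sub>E carrier A" and R'_in: "R' \<in> carrier A \<rightarrow>\<^sub>E carrier A"
    using l r by (auto simp: L'_def R'_def)
  then have cl [simp]: "L' x \<in> carrier A" "R' x \<in> carrier A" if "x \<in> carrier A" for x
    using that by auto
  have L': "L' (g b \<star>\<^bsub>A\<^esub> a) = g (L b) \<star>\<^bsub>A\<^esub> a" if b: "b \<in> carrier B" and a: "a \<in> carrier A" for a b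
  proof (rule cancel_left)
    let ?x = "g b \<star>\<^bsub>A\<^esub> a"
    have x: "?x \<in> carrier A" using a b by simp
    fix a' c assume a': "a' \<in> carrier A" and c: "c \<in> carrier B"
    \<comment> \<open>After multiplication by g c the value becomes g (R c) * x, where x = g b * a
      enters as a whole: its factorization is no longer visible.\<close>
    have "g c \<star>\<^bsub>A\<^esub> L' ?x = g (R c) \<star>\<^bsub>A\<^esub> (g (\<beta> ?x) \<star>\<^bsub>A\<^esub> \<alpha> ?x)"
      using l c x by (simp add: L'_def mid')
    also have "\<dots> = g c \<star>\<^bsub>A\<^esub> (g (L b) \<star>\<^bsub>A\<^esub> a)"
      unfolding l_eq[OF x] by (rule mid'[OF c b a])
    finally show "a' \<star>\<^bsub>A\<^esub> (g c \<star>\<^bsub>A\<^esub> L' ?x) = a' \<star>\<^bsub>A\<^esub> (g c \<star>\<^bsub>A\<^esub> (g (L b) \<star>\<^bsub>A\<^esub> a))"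
      by simp
  qed (use a b in simp_all)
  have R': "R' (a \<star>\<^bsub>A\<^esub> g b) = a \<star>\<^bsub>A\<^esub> g (R b)" if b: "b \<in> carrier B" and a: "a \<in> carrier A" for a b
  proof (rule cancel_right)
    let ?x = "a \<star>\<^bsub>A\<^esub> g b"
    have x: "?x \<in> carrier A" using a b by simp
    fix a' c assume a': "a' \<in> carrier A" and c: "c \<in> carrier B"
    have "R' ?x \<star>\<^bsub>A\<^esub> (g c \<star>\<^bsub>A\<^esub> a') = (\<gamma> ?x \<star>\<^bsub>A\<^esub> g (\<delta> ?x)) \<star>\<^bsub>A\<^esub> (g (L c) \<star>\<^bsub>A\<^esub> a')"
      using r c x a' by (simp add: R'_def mid')
    also have "\<dots> = (a \<star>\<^bsub>A\<^esub> g (R b)) \<star>\<^bsub>A\<^esub> (g c \<star>\<^bsub>A\<^esub> a')"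
      unfolding r_eq[OF x] using a b c a' by (simp add: mid')
    finally show "R' ?x \<star>\<^bsub>A\<^esub> (g c \<star>\<^bsub>A\<^esub> a') = (a \<star>\<^bsub>A\<^esub> g (R b)) \<star>\<^bsub>A\<^esub> (g c \<star>\<^bsub>A\<^esub> a')" .
  qed (use a b in simp_all)
  have "L' (x \<star>\<^bsub>A\<^esub> y) = L' x \<star>\<^bsub>A\<^esub> y \<and> R' (x \<star>\<^bsub>A\<^esub> y) = x \<star>\<^bsub>A\<^esub> R' y \<and> R' x \<star>\<^bsub>A\<^esub> y = x \<star>\<^bsub>A\<^esub> L' y"
    if x: "x \<in> carrier A" and y: "y \<in> carrier A" for x y
  proof (intro conjI)
    obtain b a where "b \<in> carrier B" "a \<in> carrier A" "x = g b \<star>\<^bsub>A\<^esub> a"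
      using left_factor[OF x] by blast
    then show "L' (x \<star>\<^bsub>A\<^esub> y) = L' x \<star>\<^bsub>A\<^esub> y"
      using y by (simp add: L')
    obtain b a where "b \<in> carrier B" "a \<in> carrier A" "y = a \<star>\<^bsub>A\<^esub> g b"
      using right_factor[OF y] by blast
    then show "R' (x \<star>\<^bsub>A\<^esub> y) = x \<star>\<^bsub>A\<^esub> R' y"
      using x R'[of b "x \<star>\<^bsub>A\<^esub> a"] by (simp add: R')
    \<comment> \<open>The factors are taken on the inner sides, x = a * g b and y = g c * d, so that
      the linking equation applies in the middle of the product.\<close>
    obtain b a c d where "b \<in> carrier B" "a \<in> carrier A" "x = a \<star>\<^bsub>A\<^esub> g b"
      "c \<in> carrier B" "d \<in> carrier A" "y = g c \<star>\<^bsub>A\<^esub> d"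
      using right_factor[OF x] left_factor[OF y] by metis
    then show "R' x \<star>\<^bsub>A\<^esub> y = x \<star>\<^bsub>A\<^esub> L' y"
      by (simp add: L' R' mid')
  qed
  then have "MapPair L' R' \<in> carrier (TrHullMon A)"
    using L'_in R'_in by (simp add: carrier_TrHullMon)
  then show ?thesis
    using L' R' by (auto simp: lifts_def LR)
qed

lemma lifts_hull_map: "p \<in> carrier (TrHullMon B) \<Longrightarrow> lifts B A g p (hull_map B A g p)"
  using theI'[of "lifts B A g p"] lifts_exists lifts_unique by (metis hull_map_def restrict_apply')

lemma hull_map_eqI: "\<lbrakk>p \<in> carrier (TrHullMon B); lifts B A g p q\<rbrakk> \<Longrightarrow> hull_map B A g p = q"
  using lifts_hull_map lifts_unique by blast

text \<open>By uniqueness of lifts this makes \<open>hull_map\<close> multiplicative.\<close>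

lemma lifts_mult:
  assumes "lifts B A g p q" "lifts B A g p' q'"
    and "p \<in> carrier (TrHullMon B)" "p' \<in> carrier (TrHullMon B)"
  shows "lifts B A g (p \<otimes>\<^bsub>TrHullMon B\<^esub> p') (q \<otimes>\<^bsub>TrHullMon A\<^esub> q')"
proof -
  have "q \<otimes>\<^bsub>TrHullMon A\<^esub> q' \<in> carrier (TrHullMon A)"
    using assms(1,2) monoid.m_closed[OF monoid_TrHullMon[OF A]] unfolding lifts_def by blast
  moreover obtain L R L' R' where e: "p = MapPair L R" "p' = MapPair L' R'"
    using assms(3,4) by (cases p; cases p') auto
  note d = translationD[OF assms(3)[unfolded e]] translationD[OF assms(4)[unfolded e]]
  ultimately show ?thesis
    using assms(1,2) by (auto simp: lifts_def e compose_eq d simp del: prod_assoc)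
qed

lemma hull_map_hom: "hull_map B A g \<in> monoid_hom (TrHullMon B) (TrHullMon A)"
proof -
  have "lifts B A g \<one>\<^bsub>TrHullMon B\<^esub> \<one>\<^bsub>TrHullMon A\<^esub>"
    using monoid.one_closed[OF monoid_TrHullMon[OF A]] by (auto simp: lifts_def)
  then have "hull_map B A g \<one>\<^bsub>TrHullMon B\<^esub> = \<one>\<^bsub>TrHullMon A\<^esub>"
    by (intro hull_map_eqI monoid.one_closed[OF monoid_TrHullMon[OF B]])
  moreover have "hull_map B A g (p \<otimes>\<^bsub>TrHullMon B\<^esub> q) = hull_map B A g p \<otimes>\<^bsub>TrHullMon A\<^esub> hull_map B A g q"
    if "p \<in> carrier (TrHullMon B)" "q \<in> carrier (TrHullMon B)" for p q
    using that
    by (intro hull_map_eqI lifts_mult lifts_hull_map monoid.m_closed[OF monoid_TrHullMon[OF B]])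
  moreover have "hull_map B A g p \<in> carrier (TrHullMon A)" if "p \<in> carrier (TrHullMon B)" for p
    using lifts_hull_map[OF that] by (simp add: lifts_def)
  ultimately show ?thesis
    by (auto simp: monoid_hom_def hom_def) (simp add: hull_map_def)
qed

lemma hull_map_canon:
  assumes b: "b \<in> carrier B"
  shows "hull_map B A g (canon B b) = canon A (g b)"
proof (rule hull_map_eqI)
  show "lifts B A g (canon B b) (canon A (g b))"
    using b canon_closed[OF A, of "g b"] by (auto simp: lifts_def canon_def hom_mult)
qed (rule canon_closed[OF B b])

end

text \<open>For uniqueness: p * canon b = canon (L b) and canon b * p = canon (R b) in the hull of
  B, so by \<open>lifts_of_hom\<close> any homomorphism h with the prescribed values on canonical
  translations sends p to a lift of p, and there is one lift only.\<close>

lemma hull_extension_iff: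
  fixes A B :: "'a sgrp"
  assumes "nondegenerate_hom B A g"
  shows "hull_extension (Arrow B A g) m \<longleftrightarrow> m = Arrow (TrHullMon B) (TrHullMon A) (hull_map B A g)"
proof -
  interpret nondegenerate_hom B A g by fact
  show ?thesis
  proof
    assume "m = Arrow (TrHullMon B) (TrHullMon A) (hull_map B A g)"
    then show "hull_extension (Arrow B A g) m"
      by (simp add: hull_extension_def Hom_Mon_iff monoid_TrHullMon B A hull_map_hom hull_map_canon)
  next
    assume "hull_extension (Arrow B A g) m"
    then obtain h where m: "m = Arrow (TrHullMon B) (TrHullMon A) h"
      and h: "h \<in> monoid_hom (TrHullMon B) (TrHullMon A)"
      and hc: "\<And>b. b \<in> carrier B \<Longrightarrow> h (canon B b) = canon A (g b)"
      by (auto simp: hull_extension_def Hom_Mon_iff)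
    have "hull_map B A g p = h p" if p: "p \<in> carrier (TrHullMon B)" for p
    proof (rule hull_map_eqI[OF p])
      obtain L R where LR: "p = MapPair L R"
        using p by (cases p) auto
      then have mem: "L \<in> carrier B \<rightarrow>\<^sub>E carrier B" "R \<in> carrier B \<rightarrow>\<^sub>E carrier B"
        "\<And>x y. \<lbrakk>x \<in> carrier B; y \<in> carrier B\<rbrakk> \<Longrightarrow>
          L (x \<star>\<^bsub>B\<^esub> y) = L x \<star>\<^bsub>B\<^esub> y \<and> R (x \<star>\<^bsub>B\<^esub> y) = x \<star>\<^bsub>B\<^esub> R y \<and> R x \<star>\<^bsub>B\<^esub> y = x \<star>\<^bsub>B\<^esub> L y"
        using p by (auto simp: carrier_TrHullMon)
      show "lifts B A g p (h p)"
        unfolding LR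
      proof (rule lifts_of_hom[OF B A g, where M = "TrHullMon B" and k = h and x = "MapPair L R" and c = "canon B"])
        show "h \<in> hom (TrHullMon B) (TrHullMon A)"
          using h by (simp add: monoid_hom_def)
        show "MapPair L R \<otimes>\<^bsub>TrHullMon B\<^esub> canon B b = canon B (L b)"
          "canon B b \<otimes>\<^bsub>TrHullMon B\<^esub> MapPair L R = canon B (R b)" if "b \<in> carrier B" for b
          using mem that by (auto simp: canon_def compose_def fun_eq_iff)
      qed (use mem p LR hc canon_closed[OF B] in auto)
    qed
    then have "h = hull_map B A g"
      using h by (auto simp: monoid_hom_def hull_map_def fun_eq_iff extensional_def)
    with m show "m = Arrow (TrHullMon B) (TrHullMon A) (hull_map B A g)"
      by simp
  qed
qed

section \<open>Functoriality of the translational hull\<close>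

lemma TrHull_Arrow:
  "nondegenerate_hom B A g \<Longrightarrow>
    FAr TrHull (Arrow B A g) = Arrow (TrHullMon B) (TrHullMon A) (hull_map B A g)"
  unfolding TrHull_def by simp (rule the_equality; simp add: hull_extension_iff)

text \<open>The rule for \<open>L2\<close> refers to \<open>L1\<close>, whose own rule covers
  products g b * a. So x is first factored as h a * y: then h (g b) * x becomes h (g b * a) * y, to
  which both rules apply in turn. The right-hand maps are treated symmetrically.\<close>

lemma lifts_compose:
  assumes "nondegenerate_hom B A g" "nondegenerate_hom A E h"
    and p: "p \<in> carrier (TrHullMon B)" and pq: "lifts B A g p q" and qr: "lifts A E h q r"
  shows "lifts B E (compose (carrier B) h g) p r"
proof -
  interpret g: nondegenerate_hom B A g by fact
  interpret h: nondegenerate_hom A E h by fact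
  obtain L R L1 R1 L2 R2 where e: "p = MapPair L R" "q = MapPair L1 R1" "r = MapPair L2 R2"
    and 1: "\<And>b a. \<lbrakk>b \<in> carrier B; a \<in> carrier A\<rbrakk> \<Longrightarrow> L1 (g b \<star>\<^bsub>A\<^esub> a) = g (L b) \<star>\<^bsub>A\<^esub> a"
      "\<And>b a. \<lbrakk>b \<in> carrier B; a \<in> carrier A\<rbrakk> \<Longrightarrow> R1 (a \<star>\<^bsub>A\<^esub> g b) = a \<star>\<^bsub>A\<^esub> g (R b)"
    and 2: "\<And>b a. \<lbrakk>b \<in> carrier A; a \<in> carrier E\<rbrakk> \<Longrightarrow> L2 (h b \<star>\<^bsub>E\<^esub> a) = h (L1 b) \<star>\<^bsub>E\<^esub> a"
      "\<And>b a. \<lbrakk>b \<in> carrier A; a \<in> carrier E\<rbrakk> \<Longrightarrow> R2 (a \<star>\<^bsub>E\<^esub> h b) = a \<star>\<^bsub>E\<^esub> h (R1 b)"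
    using pq qr by (auto simp: lifts_def)
  have LR: "L b \<in> carrier B" "R b \<in> carrier B" if "b \<in> carrier B" for b
    using p that unfolding e carrier_TrHullMon by auto
  have "L2 (h (g b) \<star>\<^bsub>E\<^esub> x) = h (g (L b)) \<star>\<^bsub>E\<^esub> x \<and> R2 (x \<star>\<^bsub>E\<^esub> h (g b)) = x \<star>\<^bsub>E\<^esub> h (g (R b))"
    if b: "b \<in> carrier B" and x: "x \<in> carrier E" for b x
  proof
    obtain a y where a: "a \<in> carrier A" "y \<in> carrier E" "x = h a \<star>\<^bsub>E\<^esub> y"
      using h.left_factor[OF x] by blast
    have "L2 (h (g b \<star>\<^bsub>A\<^esub> a) \<star>\<^bsub>E\<^esub> y) = h (g (L b) \<star>\<^bsub>A\<^esub> a) \<star>\<^bsub>E\<^esub> y"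
      using a b by (simp add: 1 2)
    then show "L2 (h (g b) \<star>\<^bsub>E\<^esub> x) = h (g (L b)) \<star>\<^bsub>E\<^esub> x"
      using a b LR by (simp add: h.hom_mult)
    obtain a y where a: "a \<in> carrier A" "y \<in> carrier E" "x = y \<star>\<^bsub>E\<^esub> h a"
      using h.right_factor[OF x] by blast
    have "R2 (y \<star>\<^bsub>E\<^esub> h (a \<star>\<^bsub>A\<^esub> g b)) = y \<star>\<^bsub>E\<^esub> h (a \<star>\<^bsub>A\<^esub> g (R b))"
      using a b by (simp add: 1 2)
    then show "R2 (x \<star>\<^bsub>E\<^esub> h (g b)) = x \<star>\<^bsub>E\<^esub> h (g (R b))"
      using a b LR by (simp add: h.hom_mult)
  qed
  then show ?thesis
    using qr LR by (auto simp: lifts_def e compose_eq)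
qed

lemma Hom_Sem_nd:
  assumes "p \<in> Hom Sem_nd B A"
  obtains g where "p = Arrow B A g" "nondegenerate_hom B A g"
proof -
  obtain g where p: "p = Arrow B A g" and sg: "is_sgrp B" "is_sgrp A" "g \<in> sgrp_hom B A"
    and nd: "nd_ob A" "nd_ar (Arrow B A g)"
    using assms by (auto simp: Sem_nd_def Hom_iff Arr_Sem_iff)
  have "nondegenerate_hom B A g"
    using sg nd nd_ar_Arrow[OF sg(2,3)] by unfold_locales (auto simp: nd_ob_def)
  with that p show thesis by blast
qed

text \<open>Both functor laws come from uniqueness of lifts: along an identity p is a lift of
  itself, and a lift of a lift is a lift along the composite.\<close>

lemma TrHull_functor: "cat_functor Sem_nd Mon TrHull"
proof -
  interpret S: category Sem_nd by (rule category_Sem_nd)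
  interpret M: category Mon by (rule category_Mon)
  show ?thesis
  proof unfold_locales
    show "FOb TrHull A \<in> Obj Mon" if "A \<in> Obj Sem_nd" for A :: "'a sgrp"
      using that by (simp add: TrHull_def Sem_nd_def monoid_TrHullMon)
    show "FAr TrHull p \<in> Hom Mon (FOb TrHull B) (FOb TrHull A)" if p: "p \<in> Hom Sem_nd B A"
      for p and B A :: "'a sgrp"
    proof -
      obtain g where "p = Arrow B A g" "nondegenerate_hom B A g"
        using p by (rule Hom_Sem_nd)
      then interpret nondegenerate_hom B A g by simp
      show ?thesis
        using \<open>p = Arrow B A g\<close> nondegenerate_hom_axioms hull_map_hom
        by (simp add: TrHull_Arrow Hom_Mon_iff) (simp add: TrHull_def B A monoid_TrHullMon)
    qed
    show "FAr TrHull (Id Sem_nd A) = Id Mon (FOb TrHull A)" if A: "A \<in> Obj Sem_nd" for A :: "'a sgrp"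
    proof -
      let ?i = "\<lambda>x \<in> carrier A. x"
      interpret nondegenerate_hom A A ?i
        using S.id_hom[OF A] by (rule Hom_Sem_nd) (simp add: Sem_nd_def)
      have "hull_map A A ?i p = p" if p: "p \<in> carrier (TrHullMon A)" for p
      proof (rule hull_map_eqI[OF p])
        show "lifts A A ?i p p"
          using p by (cases p) (auto simp: lifts_def carrier_TrHullMon)
      qed
      then show ?thesis
        using TrHull_Arrow[OF nondegenerate_hom_axioms] hull_map_hom
        by (auto simp: Sem_nd_def TrHull_def fun_eq_iff monoid_hom_def extensional_def)
    qed
    show "FAr TrHull (q \<cdot>\<^bsub>Sem_nd\<^esub> p) = FAr TrHull q \<cdot>\<^bsub>Mon\<^esub> FAr TrHull p"
      if p: "p \<in> Hom Sem_nd B A" and q: "q \<in> Hom Sem_nd A E" for p q and B A E :: "'a sgrp"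
    proof -
      obtain g where g: "p = Arrow B A g" "nondegenerate_hom B A g"
        using p by (rule Hom_Sem_nd)
      obtain h where h: "q = Arrow A E h" "nondegenerate_hom A E h"
        using q by (rule Hom_Sem_nd)
      let ?k = "compose (carrier B) h g"
      have qp: "q \<cdot>\<^bsub>Sem_nd\<^esub> p = Arrow B E ?k"
        using g h by (simp add: Sem_nd_def)
      interpret g: nondegenerate_hom B A g by fact
      interpret h: nondegenerate_hom A E h by fact
      interpret k: nondegenerate_hom B E ?k
        using S.comp_hom[OF p q] by (rule Hom_Sem_nd) (simp add: qp)
      have "hull_map B E ?k x = hull_map A E h (hull_map B A g x)" if x: "x \<in> carrier (TrHullMon B)" for x
      proof -
        have "hull_map B A g x \<in> carrier (TrHullMon A)"
          using g.lifts_hull_map[OF x] by (simp add: lifts_def)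
        then show ?thesis
          using x g.lifts_hull_map h.lifts_hull_map
          by (intro k.hull_map_eqI[OF x] lifts_compose[OF g(2) h(2)])
      qed
      then have "hull_map B E ?k = compose (carrier (TrHullMon B)) (hull_map A E h) (hull_map B A g)"
        by (auto simp: compose_def fun_eq_iff) (simp add: hull_map_def)
      then show ?thesis
        unfolding qp TrHull_Arrow[OF k.nondegenerate_hom_axioms] using g h by (simp add: TrHull_Arrow)
    qed
  qed
qed

section \<open>Concretization\<close>

context semigroup_object
begin

abbreviation conc_map where "conc_map \<equiv> arr_data (Conc (C, S))"

lemma Conc_src_tgt:
  "arr_src (Conc (C, S)) = MultMon C S" "arr_tgt (Conc (C, S)) = TrHullMon (conv_sgrp (C, S))"
  by (simp_all add: Conc_def Let_def)

lemma conc_map_eq: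
  "ArrPair L R \<in> carrier (MultMon C S) \<Longrightarrow>
    conc_map (ArrPair L R) = MapPair (\<lambda>h \<in> points. L \<cdot> h) (\<lambda>h \<in> points. R \<cdot> h)"
  by (simp add: Conc_def Let_def)

text \<open>Precomposing the three multiplier equations with (g \<otimes> f) \<cdot> \<Delta> gives
  the three equations of a translation of the convolution semigroup.\<close>

lemma multiplier_conv:
  assumes x: "ArrPair L R \<in> carrier (MultMon C S)" and g: "g \<in> points" and f: "f \<in> points"
  shows "L \<cdot> g \<in> points" "R \<cdot> g \<in> points"
    "L \<cdot> conv g f = conv (L \<cdot> g) f" "R \<cdot> conv g f = conv g (R \<cdot> f)" "conv (R \<cdot> g) f = conv g (L \<cdot> f)"
proof -
  have a: "L \<in> Arr C" "Dom C L = s" "Cod C L = s" "R \<in> Arr C" "Dom C R = s" "Cod C R = s"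
    and e: "L \<cdot> \<mu> = \<mu> \<cdot> (L \<boxtimes>\<^sub>a \<iota>)" "R \<cdot> \<mu> = \<mu> \<cdot> (\<iota> \<boxtimes>\<^sub>a R)" "\<mu> \<cdot> (\<iota> \<boxtimes>\<^sub>a L) = \<mu> \<cdot> (R \<boxtimes>\<^sub>a \<iota>)"
    using x unfolding carrier_MultMon by auto
  note ga = point_arr[OF g] and fa = point_arr[OF f]
  have pts: "L \<cdot> h \<in> points" "R \<cdot> h \<in> points" if "h \<in> points" for h
    using a point_arr[OF that] by (simp_all add: Hom_iff)
  then show "L \<cdot> g \<in> points" "R \<cdot> g \<in> points"
    using g by simp_all
  show "L \<cdot> conv g f = conv (L \<cdot> g) f" "R \<cdot> conv g f = conv g (R \<cdot> f)"
    using a ga fa g f pts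
    by (simp_all add: conv_eq comp_extend2[OF e(1)] comp_extend2[OF e(2)] interchange_extend)
  have "conv (R \<cdot> g) f = (\<mu> \<cdot> (R \<boxtimes>\<^sub>a \<iota>)) \<cdot> ((g \<boxtimes>\<^sub>a f) \<cdot> \<Delta>)"
    using a ga fa g f pts by (simp add: conv_eq interchange_extend)
  also have "\<dots> = conv g (L \<cdot> f)"
    unfolding e(3)[symmetric] using a ga fa g f pts by (simp add: conv_eq interchange_extend)
  finally show "conv (R \<cdot> g) f = conv g (L \<cdot> f)" .
qed

lemma conc_map_hom: "conc_map \<in> monoid_hom (MultMon C S) (TrHullMon (conv_sgrp (C, S)))"
proof -
  have "conc_map x \<in> carrier (TrHullMon (conv_sgrp (C, S)))" if "x \<in> carrier (MultMon C S)" for x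
    using that
    by (cases x) (auto simp: conc_map_eq carrier_TrHullMon multiplier_conv conv_closed)
  moreover have "conc_map (x \<otimes>\<^bsub>MultMon C S\<^esub> y) = conc_map x \<otimes>\<^bsub>TrHullMon (conv_sgrp (C, S))\<^esub> conc_map y"
    if x: "x \<in> carrier (MultMon C S)" and y: "y \<in> carrier (MultMon C S)" for x y
  proof -
    obtain L R L' R' where e: "x = ArrPair L R" "y = ArrPair L' R'"
      using x y by (cases x; cases y) auto
    have "L \<in> Arr C" "Dom C L = s" "Cod C L = s" "R \<in> Arr C" "Dom C R = s" "Cod C R = s"
      "L' \<in> Arr C" "Dom C L' = s" "Cod C L' = s" "R' \<in> Arr C" "Dom C R' = s" "Cod C R' = s"
      using x y by (auto simp: e carrier_MultMon)
    then show ?thesis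
      using x y unfolding e
      by (auto simp: conc_map_eq mult_prod_closed compose_def fun_eq_iff multiplier_conv point_arr)
  qed
  moreover have "conc_map \<one>\<^bsub>MultMon C S\<^esub> = \<one>\<^bsub>TrHullMon (conv_sgrp (C, S))\<^esub>"
    using monoid.one_closed[OF monoid_MultMon] by (auto simp: conc_map_eq fun_eq_iff point_arr)
  ultimately show ?thesis
    by (auto simp: monoid_hom_def hom_def) (simp add: Conc_def Let_def)
qed

lemma Conc_hom: "Conc (C, S) \<in> Hom Mon (MultMon C S) (TrHullMon (conv_sgrp (C, S)))"
  using conc_map_hom monoid_MultMon monoid_TrHullMon[OF is_sgrp_conv]
  by (cases "Conc (C, S)") (use Conc_src_tgt in \<open>simp add: Hom_Mon_iff\<close>)

text \<open>Through this equation a homomorphism prescribed on canonical multipliers becomes, after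
  concretization, one prescribed on canonical translations, as \<open>lifts_of_hom\<close>
  requires.\<close>

lemma conc_map_canon: "f \<in> points \<Longrightarrow> conc_map (mult_canon (C, S) f) = canon (conv_sgrp (C, S)) f"
  using mult_canon_closed[of f]
  by (auto simp: mult_canon_eq conc_map_eq canon_def left_mult_point right_mult_point)

end

section \<open>Lax monoidal functors\<close>

context lax_monoidal_functor
begin

lemma phi_arr [simp]:
  assumes "a \<in> Obj C" "b \<in> Obj C"
  shows "LaxTen F (a, b) \<in> Arr D" "Dom D (LaxTen F (a, b)) = FOb F a \<boxtimes>\<^sub>o\<^bsub>D\<^esub> FOb F b"
    "Cod D (LaxTen F (a, b)) = FOb F (a \<boxtimes>\<^sub>o\<^bsub>C\<^esub> b)"
  using phi_hom[OF assms] by (simp_all add: Hom_iff)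

lemma lax_unit_arr [simp]:
  "LaxUnit F \<in> Arr D" "Dom D (LaxUnit F) = Unit D" "Cod D (LaxUnit F) = FOb F (Unit C)"
  using unit_hom by (simp_all add: Hom_iff)

lemma phi_natural:
  "\<lbrakk>f \<in> Arr C; g \<in> Arr C; Dom C f = a; Dom C g = b; Cod C f = a'; Cod C g = b'\<rbrakk>
    \<Longrightarrow> FAr F (f \<boxtimes>\<^sub>a\<^bsub>C\<^esub> g) \<cdot>\<^bsub>D\<^esub> LaxTen F (a, b) = LaxTen F (a', b') \<cdot>\<^bsub>D\<^esub> (FAr F f \<boxtimes>\<^sub>a\<^bsub>D\<^esub> FAr F g)"
  by (rule phi_nat) (simp_all add: Hom_iff)

lemma lax_assoc':
  assumes "a \<in> Obj C" "b \<in> Obj C" "c \<in> Obj C"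
  shows "FAr F (Assoc C a b c) \<cdot>\<^bsub>D\<^esub> (LaxTen F (a \<boxtimes>\<^sub>o\<^bsub>C\<^esub> b, c) \<cdot>\<^bsub>D\<^esub> (LaxTen F (a, b) \<boxtimes>\<^sub>a\<^bsub>D\<^esub> Id D (FOb F c))) =
    LaxTen F (a, b \<boxtimes>\<^sub>o\<^bsub>C\<^esub> c) \<cdot>\<^bsub>D\<^esub> ((Id D (FOb F a) \<boxtimes>\<^sub>a\<^bsub>D\<^esub> LaxTen F (b, c)) \<cdot>\<^bsub>D\<^esub>
      Assoc D (FOb F a) (FOb F b) (FOb F c))"
  using lax_assoc[OF assms] assms by simp

lemma lax_lunit':
  "a \<in> Obj C \<Longrightarrow> FAr F (LUnit C a) \<cdot>\<^bsub>D\<^esub> (LaxTen F (Unit C, a) \<cdot>\<^bsub>D\<^esub> (LaxUnit F \<boxtimes>\<^sub>a\<^bsub>D\<^esub> Id D (FOb F a))) =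
    LUnit D (FOb F a)"
  using lax_lunit[of a] by simp

lemma lax_runit':
  "a \<in> Obj C \<Longrightarrow> FAr F (RUnit C a) \<cdot>\<^bsub>D\<^esub> (LaxTen F (a, Unit C) \<cdot>\<^bsub>D\<^esub> (Id D (FOb F a) \<boxtimes>\<^sub>a\<^bsub>D\<^esub> LaxUnit F)) =
    RUnit D (FOb F a)"
  using lax_runit[of a] by simp

text \<open>Compatibility of \<phi> with the comultiplications \<Delta> of the two units. Since F
  preserves the inverse of \<lambda>_I, it can be tested after F(\<lambda>_I), where the lax unit
  law at I and naturality of \<lambda> along \<phi> reduce the right-hand side to \<phi>.\<close>

lemma lax_unit_split:
  "FAr F (inverse_arr C (LUnit C (Unit C))) \<cdot>\<^bsub>D\<^esub> LaxUnit F =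
    LaxTen F (Unit C, Unit C) \<cdot>\<^bsub>D\<^esub> ((LaxUnit F \<boxtimes>\<^sub>a\<^bsub>D\<^esub> LaxUnit F) \<cdot>\<^bsub>D\<^esub> inverse_arr D (LUnit D (Unit D)))"
  (is "FAr F ?lC \<cdot>\<^bsub>D\<^esub> ?\<phi> = ?\<Phi> \<cdot>\<^bsub>D\<^esub> ((?\<phi> \<boxtimes>\<^sub>a\<^bsub>D\<^esub> ?\<phi>) \<cdot>\<^bsub>D\<^esub> ?lD)")
proof -
  let ?I = "Unit C" and ?J = "Unit D"
  let ?j = "Id D ?J"
  have inv: "FAr F ?lC \<cdot>\<^bsub>D\<^esub> FAr F (LUnit C ?I) = Id D (FOb F (?I \<boxtimes>\<^sub>o\<^bsub>C\<^esub> ?I))"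
    by (simp flip: functor_comp)
  have "FAr F (LUnit C ?I) \<cdot>\<^bsub>D\<^esub> (?\<Phi> \<cdot>\<^bsub>D\<^esub> (?\<phi> \<boxtimes>\<^sub>a\<^bsub>D\<^esub> ?\<phi>)) =
      (FAr F (LUnit C ?I) \<cdot>\<^bsub>D\<^esub> (?\<Phi> \<cdot>\<^bsub>D\<^esub> (?\<phi> \<boxtimes>\<^sub>a\<^bsub>D\<^esub> Id D (FOb F ?I)))) \<cdot>\<^bsub>D\<^esub> (?j \<boxtimes>\<^sub>a\<^bsub>D\<^esub> ?\<phi>)"
    by (simp add: target.interchange)
  also have "\<dots> = ?\<phi> \<cdot>\<^bsub>D\<^esub> LUnit D ?J"
    by (simp add: lax_lunit' target.lunit_natural)
  finally have "FAr F ?lC \<cdot>\<^bsub>D\<^esub> ((?\<phi> \<cdot>\<^bsub>D\<^esub> LUnit D ?J) \<cdot>\<^bsub>D\<^esub> ?lD) =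
      FAr F ?lC \<cdot>\<^bsub>D\<^esub> ((FAr F (LUnit C ?I) \<cdot>\<^bsub>D\<^esub> (?\<Phi> \<cdot>\<^bsub>D\<^esub> (?\<phi> \<boxtimes>\<^sub>a\<^bsub>D\<^esub> ?\<phi>))) \<cdot>\<^bsub>D\<^esub> ?lD)"
    by simp
  then show ?thesis
    by (simp add: target.comp_extend[OF inv])
qed

end

lemma lax_id_simps [simp]:
  "a \<in> Obj C \<Longrightarrow> FOb (lax_id C) a = a" "f \<in> Arr C \<Longrightarrow> FAr (lax_id C) f = f"
  "\<lbrakk>a \<in> Obj C; b \<in> Obj C\<rbrakk> \<Longrightarrow> LaxTen (lax_id C) (a, b) = Id C (a \<boxtimes>\<^sub>o\<^bsub>C\<^esub> b)"
  "LaxUnit (lax_id C) = Id C (Unit C)"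
  by (simp_all add: lax_id_def)

lemma lax_comp_simps [simp]:
  "a \<in> Obj C \<Longrightarrow> FOb (lax_comp C E G F) a = FOb G (FOb F a)"
  "f \<in> Arr C \<Longrightarrow> FAr (lax_comp C E G F) f = FAr G (FAr F f)"
  "\<lbrakk>a \<in> Obj C; b \<in> Obj C\<rbrakk> \<Longrightarrow> LaxTen (lax_comp C E G F) (a, b) =
    FAr G (LaxTen F (a, b)) \<cdot>\<^bsub>E\<^esub> LaxTen G (FOb F a, FOb F b)"
  "LaxUnit (lax_comp C E G F) = FAr G (LaxUnit F) \<cdot>\<^bsub>E\<^esub> LaxUnit G"
  by (simp_all add: lax_comp_def compose_def)

lemma lax_extensional_id: "lax_extensional C (lax_id C)"
  by (simp add: lax_extensional_def lax_id_def)

lemma lax_extensional_comp: "lax_extensional C (lax_comp C E G F)"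
  by (simp add: lax_extensional_def lax_comp_def)

lemma lax_data_eqI:
  assumes "lax_extensional C F" "lax_extensional C G"
    and "\<And>a. a \<in> Obj C \<Longrightarrow> FOb F a = FOb G a" "\<And>f. f \<in> Arr C \<Longrightarrow> FAr F f = FAr G f"
    and "\<And>a b. \<lbrakk>a \<in> Obj C; b \<in> Obj C\<rbrakk> \<Longrightarrow> LaxTen F (a, b) = LaxTen G (a, b)"
    and "LaxUnit F = LaxUnit G"
  shows "F = G"
proof (rule lax_data.equality)
  show "FOb F = FOb G" "FAr F = FAr G"
    using assms(1-4) by (auto simp: lax_extensional_def intro: extensionalityI)
  show "LaxTen F = LaxTen G"
    using assms(1,2,5) by (auto simp: lax_extensional_def intro!: extensionalityI)
qed (use assms in simp_all)

lemma lax_id_functor: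
  assumes "monoidal_category C"
  shows "lax_monoidal_functor C C (lax_id C)"
proof -
  interpret monoidal_category C by fact
  show ?thesis
    by unfold_locales (auto simp: Hom_iff)
qed

text \<open>Each coherence law is proved by the same pattern: naturality of the tensor comparison of
  G gathers all data of F under G, the law of F is applied there, and the law of G finishes.\<close>

lemma lax_comp_functor:
  assumes "lax_monoidal_functor C D F" "lax_monoidal_functor D E G"
  shows "lax_monoidal_functor C E (lax_comp C E G F)"
proof -
  interpret F: lax_monoidal_functor C D F by fact
  interpret G: lax_monoidal_functor D E G by fact
  show ?thesis
  proof unfold_locales
    fix f a a' g b b' assume "f \<in> Hom C a a'" "g \<in> Hom C b b'"
    then have a: "f \<in> Arr C" "Dom C f = a" "Cod C f = a'" "g \<in> Arr C" "Dom C g = b" "Cod C g = b'"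
      by (auto simp: Hom_iff)
    then have o: "a \<in> Obj C" "a' \<in> Obj C" "b \<in> Obj C" "b' \<in> Obj C"
      by auto
    have "FAr G (FAr F (f \<boxtimes>\<^sub>a\<^bsub>C\<^esub> g) \<cdot>\<^bsub>D\<^esub> LaxTen F (a, b)) \<cdot>\<^bsub>E\<^esub> LaxTen G (FOb F a, FOb F b) =
        FAr G (LaxTen F (a', b')) \<cdot>\<^bsub>E\<^esub> (FAr G (FAr F f \<boxtimes>\<^sub>a\<^bsub>D\<^esub> FAr F g) \<cdot>\<^bsub>E\<^esub> LaxTen G (FOb F a, FOb F b))"
      using a o by (simp add: F.phi_natural)
    then show "FAr (lax_comp C E G F) (f \<boxtimes>\<^sub>a\<^bsub>C\<^esub> g) \<cdot>\<^bsub>E\<^esub> LaxTen (lax_comp C E G F) (a, b) =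
        LaxTen (lax_comp C E G F) (a', b') \<cdot>\<^bsub>E\<^esub> (FAr (lax_comp C E G F) f \<boxtimes>\<^sub>a\<^bsub>E\<^esub> FAr (lax_comp C E G F) g)"
      using a o by (simp add: G.phi_natural)
  next
    fix a b c assume o: "a \<in> Obj C" "b \<in> Obj C" "c \<in> Obj C"
    let ?a = "FOb F a" and ?b = "FOb F b" and ?c = "FOb F c"
    let ?\<Phi> = "\<lambda>a b. LaxTen F (a, b)" and ?\<Gamma> = "\<lambda>a b. LaxTen G (a, b)"
    let ?\<alpha> = "Assoc E (FOb G ?a) (FOb G ?b) (FOb G ?c)"
    \<comment> \<open>Writing the identity on \<open>FOb G ?c\<close> as the image under G of
      \<open>Id D ?c\<close> exposes an instance of \<open>phi_natural\<close> for G.\<close>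
    have "FAr G (FAr F (Assoc C a b c)) \<cdot>\<^bsub>E\<^esub> (FAr G (?\<Phi> (a \<boxtimes>\<^sub>o\<^bsub>C\<^esub> b) c) \<cdot>\<^bsub>E\<^esub>
          (?\<Gamma> (FOb F (a \<boxtimes>\<^sub>o\<^bsub>C\<^esub> b)) ?c \<cdot>\<^bsub>E\<^esub> ((FAr G (?\<Phi> a b) \<cdot>\<^bsub>E\<^esub> ?\<Gamma> ?a ?b) \<boxtimes>\<^sub>a\<^bsub>E\<^esub> Id E (FOb G ?c)))) =
        FAr G (FAr F (Assoc C a b c)) \<cdot>\<^bsub>E\<^esub> (FAr G (?\<Phi> (a \<boxtimes>\<^sub>o\<^bsub>C\<^esub> b) c) \<cdot>\<^bsub>E\<^esub>
          ((?\<Gamma> (FOb F (a \<boxtimes>\<^sub>o\<^bsub>C\<^esub> b)) ?c \<cdot>\<^bsub>E\<^esub> (FAr G (?\<Phi> a b) \<boxtimes>\<^sub>a\<^bsub>E\<^esub> FAr G (Id D ?c))) \<cdot>\<^bsub>E\<^esub>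
            (?\<Gamma> ?a ?b \<boxtimes>\<^sub>a\<^bsub>E\<^esub> Id E (FOb G ?c))))"
      using o by (simp add: G.target.interchange)
    also have "\<dots> = FAr G (FAr F (Assoc C a b c) \<cdot>\<^bsub>D\<^esub> (?\<Phi> (a \<boxtimes>\<^sub>o\<^bsub>C\<^esub> b) c \<cdot>\<^bsub>D\<^esub> (?\<Phi> a b \<boxtimes>\<^sub>a\<^bsub>D\<^esub> Id D ?c))) \<cdot>\<^bsub>E\<^esub>
        (?\<Gamma> (?a \<boxtimes>\<^sub>o\<^bsub>D\<^esub> ?b) ?c \<cdot>\<^bsub>E\<^esub> (?\<Gamma> ?a ?b \<boxtimes>\<^sub>a\<^bsub>E\<^esub> Id E (FOb G ?c)))"
      using o by (subst G.phi_natural[OF _ _ refl refl, symmetric]) simp_all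
    also have "\<dots> = FAr G (?\<Phi> a (b \<boxtimes>\<^sub>o\<^bsub>C\<^esub> c)) \<cdot>\<^bsub>E\<^esub> (FAr G (Id D ?a \<boxtimes>\<^sub>a\<^bsub>D\<^esub> ?\<Phi> b c) \<cdot>\<^bsub>E\<^esub>
        (FAr G (Assoc D ?a ?b ?c) \<cdot>\<^bsub>E\<^esub> (?\<Gamma> (?a \<boxtimes>\<^sub>o\<^bsub>D\<^esub> ?b) ?c \<cdot>\<^bsub>E\<^esub> (?\<Gamma> ?a ?b \<boxtimes>\<^sub>a\<^bsub>E\<^esub> Id E (FOb G ?c)))))"
      unfolding F.lax_assoc'[OF o] using o by simp
    also have "\<dots> = FAr G (?\<Phi> a (b \<boxtimes>\<^sub>o\<^bsub>C\<^esub> c)) \<cdot>\<^bsub>E\<^esub> ((FAr G (Id D ?a \<boxtimes>\<^sub>a\<^bsub>D\<^esub> ?\<Phi> b c) \<cdot>\<^bsub>E\<^esub>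
        ?\<Gamma> ?a (?b \<boxtimes>\<^sub>o\<^bsub>D\<^esub> ?c)) \<cdot>\<^bsub>E\<^esub> ((Id E (FOb G ?a) \<boxtimes>\<^sub>a\<^bsub>E\<^esub> ?\<Gamma> ?b ?c) \<cdot>\<^bsub>E\<^esub> ?\<alpha>))"
      using o by (simp add: G.lax_assoc')
    also have "\<dots> = FAr G (?\<Phi> a (b \<boxtimes>\<^sub>o\<^bsub>C\<^esub> c)) \<cdot>\<^bsub>E\<^esub> (?\<Gamma> ?a (FOb F (b \<boxtimes>\<^sub>o\<^bsub>C\<^esub> c)) \<cdot>\<^bsub>E\<^esub>
        ((Id E (FOb G ?a) \<boxtimes>\<^sub>a\<^bsub>E\<^esub> (FAr G (?\<Phi> b c) \<cdot>\<^bsub>E\<^esub> ?\<Gamma> ?b ?c)) \<cdot>\<^bsub>E\<^esub> ?\<alpha>))"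
      using o by (subst G.phi_natural[OF _ _ _ _ refl refl]) (simp_all add: G.target.interchange_extend)
    finally show "FAr (lax_comp C E G F) (Assoc C a b c) \<cdot>\<^bsub>E\<^esub> LaxTen (lax_comp C E G F) (a \<boxtimes>\<^sub>o\<^bsub>C\<^esub> b, c) \<cdot>\<^bsub>E\<^esub>
          (LaxTen (lax_comp C E G F) (a, b) \<boxtimes>\<^sub>a\<^bsub>E\<^esub> Id E (FOb (lax_comp C E G F) c)) =
        LaxTen (lax_comp C E G F) (a, b \<boxtimes>\<^sub>o\<^bsub>C\<^esub> c) \<cdot>\<^bsub>E\<^esub>
          (Id E (FOb (lax_comp C E G F) a) \<boxtimes>\<^sub>a\<^bsub>E\<^esub> LaxTen (lax_comp C E G F) (b, c)) \<cdot>\<^bsub>E\<^esub>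
          Assoc E (FOb (lax_comp C E G F) a) (FOb (lax_comp C E G F) b) (FOb (lax_comp C E G F) c)"
      using o by simp
  next
    fix a assume o: "a \<in> Obj C"
    let ?a = "FOb F a" and ?I = "Unit C" and ?J = "Unit D"
    have "FAr G (FAr F (LUnit C a)) \<cdot>\<^bsub>E\<^esub> (FAr G (LaxTen F (?I, a)) \<cdot>\<^bsub>E\<^esub> (LaxTen G (FOb F ?I, ?a) \<cdot>\<^bsub>E\<^esub>
          ((FAr G (LaxUnit F) \<cdot>\<^bsub>E\<^esub> LaxUnit G) \<boxtimes>\<^sub>a\<^bsub>E\<^esub> Id E (FOb G ?a)))) =
        FAr G (FAr F (LUnit C a)) \<cdot>\<^bsub>E\<^esub> (FAr G (LaxTen F (?I, a)) \<cdot>\<^bsub>E\<^esub> ((LaxTen G (FOb F ?I, ?a) \<cdot>\<^bsub>E\<^esub>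
          (FAr G (LaxUnit F) \<boxtimes>\<^sub>a\<^bsub>E\<^esub> FAr G (Id D ?a))) \<cdot>\<^bsub>E\<^esub> (LaxUnit G \<boxtimes>\<^sub>a\<^bsub>E\<^esub> Id E (FOb G ?a))))"
      using o by (simp add: G.target.interchange)
    also have "\<dots> = FAr G (FAr F (LUnit C a) \<cdot>\<^bsub>D\<^esub> (LaxTen F (?I, a) \<cdot>\<^bsub>D\<^esub> (LaxUnit F \<boxtimes>\<^sub>a\<^bsub>D\<^esub> Id D ?a))) \<cdot>\<^bsub>E\<^esub>
        (LaxTen G (?J, ?a) \<cdot>\<^bsub>E\<^esub> (LaxUnit G \<boxtimes>\<^sub>a\<^bsub>E\<^esub> Id E (FOb G ?a)))"
      using o by (subst G.phi_natural[OF _ _ refl refl, symmetric]) simp_all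
    also have "\<dots> = LUnit E (FOb G ?a)"
      unfolding F.lax_lunit'[OF o] using o by (simp add: G.lax_lunit')
    finally show "FAr (lax_comp C E G F) (LUnit C a) \<cdot>\<^bsub>E\<^esub> LaxTen (lax_comp C E G F) (?I, a) \<cdot>\<^bsub>E\<^esub>
        (LaxUnit (lax_comp C E G F) \<boxtimes>\<^sub>a\<^bsub>E\<^esub> Id E (FOb (lax_comp C E G F) a)) = LUnit E (FOb (lax_comp C E G F) a)"
      using o by simp
    have "FAr G (FAr F (RUnit C a)) \<cdot>\<^bsub>E\<^esub> (FAr G (LaxTen F (a, ?I)) \<cdot>\<^bsub>E\<^esub> (LaxTen G (?a, FOb F ?I) \<cdot>\<^bsub>E\<^esub>
          (Id E (FOb G ?a) \<boxtimes>\<^sub>a\<^bsub>E\<^esub> (FAr G (LaxUnit F) \<cdot>\<^bsub>E\<^esub> LaxUnit G)))) =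
        FAr G (FAr F (RUnit C a)) \<cdot>\<^bsub>E\<^esub> (FAr G (LaxTen F (a, ?I)) \<cdot>\<^bsub>E\<^esub> ((LaxTen G (?a, FOb F ?I) \<cdot>\<^bsub>E\<^esub>
          (FAr G (Id D ?a) \<boxtimes>\<^sub>a\<^bsub>E\<^esub> FAr G (LaxUnit F))) \<cdot>\<^bsub>E\<^esub> (Id E (FOb G ?a) \<boxtimes>\<^sub>a\<^bsub>E\<^esub> LaxUnit G)))"
      using o by (simp add: G.target.interchange)
    also have "\<dots> = FAr G (FAr F (RUnit C a) \<cdot>\<^bsub>D\<^esub> (LaxTen F (a, ?I) \<cdot>\<^bsub>D\<^esub> (Id D ?a \<boxtimes>\<^sub>a\<^bsub>D\<^esub> LaxUnit F))) \<cdot>\<^bsub>E\<^esub>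
        (LaxTen G (?a, ?J) \<cdot>\<^bsub>E\<^esub> (Id E (FOb G ?a) \<boxtimes>\<^sub>a\<^bsub>E\<^esub> LaxUnit G))"
      using o by (subst G.phi_natural[OF _ _ refl refl, symmetric]) simp_all
    also have "\<dots> = RUnit E (FOb G ?a)"
      unfolding F.lax_runit'[OF o] using o by (simp add: G.lax_runit')
    finally show "FAr (lax_comp C E G F) (RUnit C a) \<cdot>\<^bsub>E\<^esub> LaxTen (lax_comp C E G F) (a, ?I) \<cdot>\<^bsub>E\<^esub>
        (Id E (FOb (lax_comp C E G F) a) \<boxtimes>\<^sub>a\<^bsub>E\<^esub> LaxUnit (lax_comp C E G F)) = RUnit E (FOb (lax_comp C E G F) a)"
      using o by simp
  qed (auto simp: Hom_iff)
qed

section \<open>Internal semigroups and the convolution functor\<close>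

locale intsem_arrow =
  lax_monoidal_functor C D F + source_sg: semigroup_object C S + target_sg: semigroup_object D T
  for C D :: "('o, 'm) monoidal_data" and F :: "('o, 'm, 'o, 'm) lax_data"
    and S T :: "('o, 'm) sg_object" +
  fixes f :: 'm
  assumes extensional: "lax_extensional C F" and sg_hom: "f \<in> sg_object_hom D (sg_image D F S) T"
begin

lemma hom_arr [simp]: "f \<in> Arr D" "Dom D f = FOb F (SOb S)" "Cod D f = SOb T"
  using sg_hom by (auto simp: sg_object_hom_def sg_image_def Hom_iff)

lemma hom_eq:
  "f \<cdot>\<^bsub>D\<^esub> (FAr F (SMu S) \<cdot>\<^bsub>D\<^esub> LaxTen F (SOb S, SOb S)) = SMu T \<cdot>\<^bsub>D\<^esub> (f \<boxtimes>\<^sub>a\<^bsub>D\<^esub> f)"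
  using sg_hom by (simp add: sg_object_hom_def sg_image_def)

definition conv_map :: "'m \<Rightarrow> 'm" where
  "conv_map = (\<lambda>g \<in> Hom C (Unit C) (SOb S). f \<cdot>\<^bsub>D\<^esub> (FAr F g \<cdot>\<^bsub>D\<^esub> LaxUnit F))"

text \<open>Three compatibilities are used in turn: of \<phi> with the comultiplications of the
  units, of \<Phi> with the tensor of the two points, and of f with the multiplications.\<close>

lemma conv_map_hom: "conv_map \<in> sgrp_hom (conv_sgrp (C, S)) (conv_sgrp (D, T))"
proof -
  have pt: "conv_map g \<in> Hom D (Unit D) (SOb T)" if "g \<in> Hom C (Unit C) (SOb S)" for g
    using that source_sg.point_arr[OF that] by (simp add: conv_map_def) (simp add: Hom_iff)
  have "conv_map (source_sg.conv g h) = target_sg.conv (conv_map g) (conv_map h)"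
    if g: "g \<in> Hom C (Unit C) (SOb S)" and h: "h \<in> Hom C (Unit C) (SOb S)" for g h
  proof -
    note a = source_sg.point_arr[OF g] source_sg.point_arr[OF h]
    let ?\<phi> = "LaxUnit F" and ?l = "inverse_arr D (LUnit D (Unit D))"
    have "conv_map (source_sg.conv g h) = f \<cdot>\<^bsub>D\<^esub> (FAr F (SMu S) \<cdot>\<^bsub>D\<^esub> (FAr F (g \<boxtimes>\<^sub>a\<^bsub>C\<^esub> h) \<cdot>\<^bsub>D\<^esub>
        (FAr F (inverse_arr C (LUnit C (Unit C))) \<cdot>\<^bsub>D\<^esub> ?\<phi>)))"
      using a source_sg.conv_closed[OF g h] by (simp add: conv_map_def source_sg.conv_eq g h)
    also have "\<dots> = f \<cdot>\<^bsub>D\<^esub> (FAr F (SMu S) \<cdot>\<^bsub>D\<^esub> ((FAr F (g \<boxtimes>\<^sub>a\<^bsub>C\<^esub> h) \<cdot>\<^bsub>D\<^esub> LaxTen F (Unit C, Unit C)) \<cdot>\<^bsub>D\<^esub>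
        ((?\<phi> \<boxtimes>\<^sub>a\<^bsub>D\<^esub> ?\<phi>) \<cdot>\<^bsub>D\<^esub> ?l)))"
      unfolding lax_unit_split using a by simp
    also have "\<dots> = (f \<cdot>\<^bsub>D\<^esub> (FAr F (SMu S) \<cdot>\<^bsub>D\<^esub> LaxTen F (SOb S, SOb S))) \<cdot>\<^bsub>D\<^esub>
        ((FAr F g \<boxtimes>\<^sub>a\<^bsub>D\<^esub> FAr F h) \<cdot>\<^bsub>D\<^esub> ((?\<phi> \<boxtimes>\<^sub>a\<^bsub>D\<^esub> ?\<phi>) \<cdot>\<^bsub>D\<^esub> ?l))"
      using a by (subst phi_natural[OF _ _ _ _ refl refl]) simp_all
    also have "\<dots> = target_sg.conv (conv_map g) (conv_map h)"
      unfolding hom_eq target_sg.conv_eq[OF pt[OF g] pt[OF h]]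
      using a g h by (simp add: conv_map_def target.interchange_extend)
    finally show ?thesis .
  qed
  then show ?thesis
    using pt by (auto simp: sgrp_hom_def) (simp add: conv_map_def)
qed

lemma Conv_Arrow:
  "FAr Conv (Arrow (C, S) (D, T) (F, f)) = Arrow (conv_sgrp (C, S)) (conv_sgrp (D, T)) conv_map"
proof -
  have "(\<lambda>g \<in> Hom C (Unit C) (SOb S). f \<cdot>\<^bsub>D\<^esub> FAr F g \<cdot>\<^bsub>D\<^esub> LaxUnit F) = conv_map"
    using source_sg.point_arr by (auto simp: conv_map_def fun_eq_iff)
  then show ?thesis
    by (simp add: Conv_def)
qed

end

section \<open>The category laws of \<open>IntSem\<close>\<close>

lemma IntSem_simps [simp]:
  "Obj IntSem = intsem_obs" "Dom IntSem = arr_src" "Cod IntSem = arr_tgt"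
  "Id IntSem (C, S) = Arrow (C, S) (C, S) (lax_id C, Id C (SOb S))"
  "Arrow (D, T) (E, U) (G, g) \<cdot>\<^bsub>IntSem\<^esub> Arrow (C, S) (D, T) (F, f) =
    Arrow (C, S) (E, U) (lax_comp C E G F, g \<cdot>\<^bsub>E\<^esub> FAr G f)"
  by (simp_all add: IntSem_def)

lemma intsem_obs_iff: "(C, S) \<in> intsem_obs \<longleftrightarrow> semigroup_object C S"
  by (auto simp: intsem_obs_def semigroup_object_def semigroup_object_axioms_def)

lemma Hom_IntSem_iff:
  "p \<in> Hom IntSem (C, S) (D, T) \<longleftrightarrow> (\<exists>F f. p = Arrow (C, S) (D, T) (F, f) \<and> intsem_arrow C D F S T f)"
  by (auto simp: Hom_iff IntSem_def intsem_obs_iff intsem_arrow_def intsem_arrow_axioms_def)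

lemma intsem_arrow_id:
  assumes "semigroup_object C S"
  shows "intsem_arrow C C (lax_id C) S S (Id C (SOb S))"
proof -
  interpret semigroup_object C S by fact
  show ?thesis
    by (intro intsem_arrow.intro intsem_arrow_axioms.intro lax_id_functor lax_extensional_id)
      (unfold_locales, simp add: sg_object_hom_def sg_image_def Hom_iff)
qed

text \<open>The law of f is applied under G, naturality of the tensor comparison of G brings f
  \<otimes> f out as G f \<otimes> G f, and the law of g applies to what is left.\<close>

lemma intsem_arrow_comp:
  assumes "intsem_arrow C D F S T f" "intsem_arrow D E G T U g"
  shows "intsem_arrow C E (lax_comp C E G F) S U (g \<cdot>\<^bsub>E\<^esub> FAr G f)"
proof -
  interpret F: intsem_arrow C D F S T f by fact
  interpret G: intsem_arrow D E G T U g by fact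
  show ?thesis
  proof (intro intsem_arrow.intro intsem_arrow_axioms.intro lax_extensional_comp)
    show "lax_monoidal_functor C E (lax_comp C E G F)"
      by (rule lax_comp_functor) unfold_locales
    show "semigroup_object C S" "semigroup_object E U"
      by unfold_locales
    have "(g \<cdot>\<^bsub>E\<^esub> FAr G f) \<cdot>\<^bsub>E\<^esub> (FAr G (FAr F (SMu S)) \<cdot>\<^bsub>E\<^esub> (FAr G (LaxTen F (SOb S, SOb S)) \<cdot>\<^bsub>E\<^esub>
          LaxTen G (FOb F (SOb S), FOb F (SOb S)))) =
        g \<cdot>\<^bsub>E\<^esub> (FAr G (f \<cdot>\<^bsub>D\<^esub> (FAr F (SMu S) \<cdot>\<^bsub>D\<^esub> LaxTen F (SOb S, SOb S))) \<cdot>\<^bsub>E\<^esub>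
          LaxTen G (FOb F (SOb S), FOb F (SOb S)))"
      by simp
    also have "\<dots> = g \<cdot>\<^bsub>E\<^esub> (FAr G (SMu T) \<cdot>\<^bsub>E\<^esub> (FAr G (f \<boxtimes>\<^sub>a\<^bsub>D\<^esub> f) \<cdot>\<^bsub>E\<^esub>
          LaxTen G (FOb F (SOb S), FOb F (SOb S))))"
      unfolding F.hom_eq by simp
    also have "\<dots> = (g \<cdot>\<^bsub>E\<^esub> (FAr G (SMu T) \<cdot>\<^bsub>E\<^esub> LaxTen G (SOb T, SOb T))) \<cdot>\<^bsub>E\<^esub> (FAr G f \<boxtimes>\<^sub>a\<^bsub>E\<^esub> FAr G f)"
      by (subst G.phi_natural[OF _ _ _ _ refl refl]) simp_all
    also have "\<dots> = SMu U \<cdot>\<^bsub>E\<^esub> ((g \<cdot>\<^bsub>E\<^esub> FAr G f) \<boxtimes>\<^sub>a\<^bsub>E\<^esub> (g \<cdot>\<^bsub>E\<^esub> FAr G f))"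
      unfolding G.hom_eq by (simp add: G.target.interchange)
    finally show "g \<cdot>\<^bsub>E\<^esub> FAr G f \<in> sg_object_hom E (sg_image E (lax_comp C E G F) S) U"
      by (simp add: sg_object_hom_def sg_image_def Hom_iff)
  qed
qed

lemma lax_comp_id_left:
  assumes "lax_monoidal_functor C D F" "lax_extensional C F"
  shows "lax_comp C D (lax_id D) F = F"
proof -
  interpret lax_monoidal_functor C D F by fact
  show ?thesis
    using assms(2) by (rule lax_data_eqI[OF lax_extensional_comp]) simp_all
qed

lemma lax_comp_id_right:
  assumes "lax_monoidal_functor C D F" "lax_extensional C F"
  shows "lax_comp C D F (lax_id C) = F"
proof -
  interpret lax_monoidal_functor C D F by fact
  show ?thesis
    using assms(2) by (rule lax_data_eqI[OF lax_extensional_comp]) simp_all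
qed

lemma lax_comp_assoc:
  assumes "lax_monoidal_functor C D F" "lax_monoidal_functor D E G" "lax_monoidal_functor E K H"
  shows "lax_comp C K (lax_comp D K H G) F = lax_comp C K H (lax_comp C E G F)"
proof -
  interpret F: lax_monoidal_functor C D F by fact
  interpret G: lax_monoidal_functor D E G by fact
  interpret H: lax_monoidal_functor E K H by fact
  show ?thesis
    by (rule lax_data_eqI[OF lax_extensional_comp lax_extensional_comp]) simp_all
qed

lemma category_IntSem: "category IntSem"
proof unfold_locales
  show "q \<cdot>\<^bsub>IntSem\<^esub> p \<in> Hom IntSem X Z" if "p \<in> Hom IntSem X Y" "q \<in> Hom IntSem Y Z"
    for X Y Z :: "('o, 'm) intsem_ob" and p q
    using that by (cases X; cases Y; cases Z) (auto simp: Hom_IntSem_iff intro: intsem_arrow_comp)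
  show "Id IntSem X \<in> Hom IntSem X X" if "X \<in> Obj IntSem" for X :: "('o, 'm) intsem_ob"
    using that by (cases X) (simp add: Hom_IntSem_iff intsem_obs_iff intsem_arrow_id)
  show "Id IntSem Y \<cdot>\<^bsub>IntSem\<^esub> p = p" if p: "p \<in> Hom IntSem X Y" for X Y :: "('o, 'm) intsem_ob" and p
  proof -
    obtain C S D T F f where e: "X = (C, S)" "Y = (D, T)" "p = Arrow (C, S) (D, T) (F, f)"
      and "intsem_arrow C D F S T f"
      using p by (cases X; cases Y) (auto simp: Hom_IntSem_iff)
    interpret intsem_arrow C D F S T f by fact
    show ?thesis
      by (simp add: e lax_comp_id_left[OF lax_monoidal_functor_axioms extensional])
  qed
  show "p \<cdot>\<^bsub>IntSem\<^esub> Id IntSem X = p" if p: "p \<in> Hom IntSem X Y" for X Y :: "('o, 'm) intsem_ob" and p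
  proof -
    obtain C S D T F f where e: "X = (C, S)" "Y = (D, T)" "p = Arrow (C, S) (D, T) (F, f)"
      and "intsem_arrow C D F S T f"
      using p by (cases X; cases Y) (auto simp: Hom_IntSem_iff)
    interpret intsem_arrow C D F S T f by fact
    show ?thesis
      by (simp add: e lax_comp_id_right[OF lax_monoidal_functor_axioms extensional])
  qed
  show "(r \<cdot>\<^bsub>IntSem\<^esub> q) \<cdot>\<^bsub>IntSem\<^esub> p = r \<cdot>\<^bsub>IntSem\<^esub> (q \<cdot>\<^bsub>IntSem\<^esub> p)"
    if p: "p \<in> Hom IntSem X Y" and q: "q \<in> Hom IntSem Y Z" and r: "r \<in> Hom IntSem Z W"
    for X Y Z W :: "('o, 'm) intsem_ob" and p q r
  proof -
    obtain C S D T E U K V where ob: "X = (C, S)" "Y = (D, T)" "Z = (E, U)" "W = (K, V)"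
      by (cases X; cases Y; cases Z; cases W) auto
    obtain F f G g H h where e: "p = Arrow (C, S) (D, T) (F, f)" "q = Arrow (D, T) (E, U) (G, g)"
        "r = Arrow (E, U) (K, V) (H, h)"
      and a: "intsem_arrow C D F S T f" "intsem_arrow D E G T U g" "intsem_arrow E K H U V h"
      using p q r unfolding ob Hom_IntSem_iff by blast
    interpret F: intsem_arrow C D F S T f by fact
    interpret G: intsem_arrow D E G T U g by fact
    interpret H: intsem_arrow E K H U V h by fact
    show ?thesis
      by (simp add: e lax_comp_assoc[OF F.lax_monoidal_functor_axioms G.lax_monoidal_functor_axioms
            H.lax_monoidal_functor_axioms])
  qed
  show "Dom IntSem p \<in> Obj IntSem \<and> Cod IntSem p \<in> Obj IntSem" if "p \<in> Arr IntSem"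
    for p :: "('o, 'm) intsem_ar"
    using that by (auto simp: IntSem_def)
qed

section \<open>Functoriality of convolution\<close>

lemma Conv_functor: "cat_functor IntSem Sem Conv"
proof -
  interpret I: category IntSem by (rule category_IntSem)
  interpret S: category Sem by (rule category_Sem)
  show ?thesis
  proof unfold_locales
    show "FOb Conv X \<in> Obj Sem" if "X \<in> Obj IntSem" for X :: "('o, 'm) intsem_ob"
      using that by (cases X) (simp add: Conv_def intsem_obs_iff semigroup_object.is_sgrp_conv)
    show "FAr Conv p \<in> Hom Sem (FOb Conv X) (FOb Conv Y)" if p: "p \<in> Hom IntSem X Y"
      for X Y :: "('o, 'm) intsem_ob" and p
    proof -
      obtain C S D T F f where e: "X = (C, S)" "Y = (D, T)" "p = Arrow (C, S) (D, T) (F, f)"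
        and "intsem_arrow C D F S T f"
        using p by (cases X; cases Y) (auto simp: Hom_IntSem_iff)
      interpret intsem_arrow C D F S T f by fact
      show ?thesis
        unfolding e Conv_Arrow using conv_map_hom source_sg.is_sgrp_conv target_sg.is_sgrp_conv
        by (simp add: Hom_Sem_iff) (simp add: Conv_def)
    qed
    show "FAr Conv (Id IntSem X) = Id Sem (FOb Conv X)" if X: "X \<in> Obj IntSem"
      for X :: "('o, 'm) intsem_ob"
    proof -
      obtain C S where e: "X = (C, S)" and "semigroup_object C S"
        using X by (cases X) (simp add: intsem_obs_iff)
      interpret semigroup_object C S by fact
      interpret A: intsem_arrow C C "lax_id C" S S "Id C (SOb S)"
        by (rule intsem_arrow_id) unfold_locales
      have "A.conv_map = (\<lambda>g \<in> points. g)"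
        using point_arr by (auto simp: A.conv_map_def fun_eq_iff)
      then show ?thesis
        by (simp add: e A.Conv_Arrow) (simp add: Conv_def)
    qed
    show "FAr Conv (q \<cdot>\<^bsub>IntSem\<^esub> p) = FAr Conv q \<cdot>\<^bsub>Sem\<^esub> FAr Conv p"
      if p: "p \<in> Hom IntSem X Y" and q: "q \<in> Hom IntSem Y Z" for X Y Z :: "('o, 'm) intsem_ob" and p q
    proof -
      obtain C S D T E U where ob: "X = (C, S)" "Y = (D, T)" "Z = (E, U)"
        by (cases X; cases Y; cases Z) auto
      obtain F f G g where e: "p = Arrow (C, S) (D, T) (F, f)" "q = Arrow (D, T) (E, U) (G, g)"
        and a: "intsem_arrow C D F S T f" "intsem_arrow D E G T U g"
        using p q unfolding ob Hom_IntSem_iff by blast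
      interpret F: intsem_arrow C D F S T f by fact
      interpret G: intsem_arrow D E G T U g by fact
      interpret GF: intsem_arrow C E "lax_comp C E G F" S U "g \<cdot>\<^bsub>E\<^esub> FAr G f"
        using a by (rule intsem_arrow_comp)
      have "GF.conv_map h = G.conv_map (F.conv_map h)" if h: "h \<in> Hom C (Unit C) (SOb S)" for h
      proof -
        have "F.conv_map h \<in> Hom D (Unit D) (SOb T)"
          using h sgrp_hom_closed[OF F.conv_map_hom] by simp
        then show ?thesis
          using h F.source_sg.point_arr[OF h] by (simp add: G.conv_map_def) (simp add: F.conv_map_def GF.conv_map_def)
      qed
      then have "GF.conv_map = compose (Hom C (Unit C) (SOb S)) G.conv_map F.conv_map"
        by (auto simp: compose_def fun_eq_iff) (simp add: GF.conv_map_def)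
      then show ?thesis
        by (simp add: e F.Conv_Arrow G.Conv_Arrow GF.Conv_Arrow)
    qed
  qed
qed

section \<open>Naturality of the concretization\<close>

lemma restrict_category_subcategory:
  assumes "category C" "category (restrict_category C P Q)"
  shows "subcategory (restrict_category C P Q) C"
  using assms by (auto simp: subcategory_def)

lemma Conv_Sem_nd:
  assumes "p \<in> Arr IntSem" "nd_ob (FOb Conv (arr_src p))" "nd_ob (FOb Conv (arr_tgt p))" "nd_ar (FAr Conv p)"
  shows "FAr Conv p \<in> Arr Sem_nd"
  using assms cat_functor.functor_arr[OF Conv_functor assms(1)] by (simp add: Sem_nd_def)

text \<open>Non-degeneracy of arrows is a condition on their images under the functor
  \<open>Conv\<close>, so closure under composition is pulled back from
  \<open>Sem_nd\<close>.\<close>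

lemma category_IntSem_nd: "category IntSem_nd"
  unfolding IntSem_nd_def
proof (rule restrict_category_category[OF category_IntSem])
  interpret Conv: cat_functor IntSem Sem Conv by (rule Conv_functor)
  interpret Sem_nd: category Sem_nd by (rule category_Sem_nd)
  show "nd_ar (FAr Conv (Id IntSem X))" if "X \<in> Obj IntSem" "nd_ob (FOb Conv X)"
    for X :: "('o, 'm) intsem_ob"
    using that Conv.functor_ob[OF that(1)] Conv.functor_id[OF that(1)] by (simp add: nd_ar_id nd_ob_def)
  show "nd_ar (FAr Conv (q \<cdot>\<^bsub>IntSem\<^esub> p))"
    if a: "p \<in> Arr IntSem" "q \<in> Arr IntSem" "Cod IntSem p = Dom IntSem q"
      and nd: "nd_ob (FOb Conv (Dom IntSem p))" "nd_ob (FOb Conv (Cod IntSem p))"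
        "nd_ob (FOb Conv (Cod IntSem q))" "nd_ar (FAr Conv p)" "nd_ar (FAr Conv q)"
    for p q :: "('o, 'm) intsem_ar"
  proof -
    have "FAr Conv p \<in> Arr Sem_nd" "FAr Conv q \<in> Arr Sem_nd"
      using a nd by (auto intro: Conv_Sem_nd)
    then have "FAr Conv q \<cdot>\<^bsub>Sem_nd\<^esub> FAr Conv p \<in> Arr Sem_nd"
      using a Conv.functor_arr[OF a(1)] Conv.functor_arr[OF a(2)]
      by (intro Sem_nd.comp_arr) (simp_all add: Sem_nd_def)
    then show ?thesis
      using Conv.functor_comp[OF a] by (simp add: Sem_nd_def)
  qed
qed

lemma subcategory_conc_IntSem_nd: "subcategory conc_IntSem_nd IntSem_nd"
  unfolding conc_IntSem_nd_def full_subcategory_def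
  by (intro restrict_category_subcategory restrict_category_category category_IntSem_nd) simp_all

lemma Conv_nd_functor: "cat_functor conc_IntSem_nd Sem_nd Conv_nd"
proof (rule cat_functor_subcategory[OF _ subcategory_conc_IntSem_nd])
  show "cat_functor IntSem_nd Sem_nd Conv_nd"
    using Conv_functor category_IntSem_nd category_Sem_nd unfolding IntSem_nd_def Sem_nd_def
    by (rule restrict_category_functor) simp_all
qed

lemma Hom_conc_IntSem_nd: "p \<in> Hom conc_IntSem_nd X Y \<Longrightarrow> p \<in> Hom IntSem X Y"
  by (simp add: Hom_iff conc_IntSem_nd_def full_subcategory_def IntSem_nd_def)

lemma Obj_conc_IntSem_nd:
  "X \<in> Obj conc_IntSem_nd \<Longrightarrow> X \<in> Obj IntSem" "X \<in> Obj conc_IntSem_nd \<Longrightarrow> onto (Conc X)"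
  by (simp_all add: conc_IntSem_nd_def full_subcategory_def IntSem_nd_def concrete_def)

lemma Conc_Hom:
  assumes "X \<in> Obj IntSem"
  shows "Conc X \<in> Hom Mon (FOb Mult X) (FOb (TrHull \<circ>\<^sub>F Conv) X)"
proof -
  obtain C S where "X = (C, S)" "semigroup_object C S"
    using assms by (cases X) (simp add: intsem_obs_iff)
  then show ?thesis
    using semigroup_object.Conc_hom by (simp add: Mult_def TrHull_def Conv_def functor_comp_def)
qed

text \<open>Stated for an arbitrary extension m instead of \<open>FAr Mult p\<close>: one proof then
  serves the natural transformation as well as the squares at arrows where the value of
  \<open>Mult\<close> need not be determined.\<close>

lemma Conc_natural:
  assumes p: "p \<in> Hom conc_IntSem_nd X Y" and m: "mult_extension p m"
  shows "FAr (TrHull \<circ>\<^sub>F Conv_nd) p \<cdot>\<^bsub>Mon\<^esub> Conc X = Conc Y \<cdot>\<^bsub>Mon\<^esub> m"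
proof -
  obtain C S D T where XY: "X = (C, S)" "Y = (D, T)"
    by (cases X; cases Y) auto
  obtain F f where e: "p = Arrow (C, S) (D, T) (F, f)" and "intsem_arrow C D F S T f"
    using Hom_conc_IntSem_nd[OF p] unfolding XY Hom_IntSem_iff by blast
  interpret intsem_arrow C D F S T f by fact
  let ?B = "conv_sgrp (C, S)" and ?A = "conv_sgrp (D, T)"
  have "FAr Conv p \<in> Hom Sem_nd ?B ?A"
    using cat_functor.ar[OF Conv_nd_functor p] by (simp add: XY Conv_def)
  then interpret nd: nondegenerate_hom ?B ?A conv_map
    by (rule Hom_Sem_nd) (simp add: e Conv_Arrow)
  obtain h where m_eq: "m = Arrow (MultMon C S) (MultMon D T) h"
    and h: "h \<in> monoid_hom (MultMon C S) (MultMon D T)"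
    and h_canon: "\<And>g. g \<in> carrier ?B \<Longrightarrow> h (mult_canon (C, S) g) = mult_canon (D, T) (conv_map g)"
    using m by (auto simp: mult_extension_def Hom_Mon_iff e Conv_Arrow)
  have h_mult: "h (x \<otimes>\<^bsub>MultMon C S\<^esub> y) = h x \<otimes>\<^bsub>MultMon D T\<^esub> h y" and h_closed: "h x \<in> carrier (MultMon D T)"
    if "x \<in> carrier (MultMon C S)" "y \<in> carrier (MultMon C S)" for x y
    using h that by (auto simp: monoid_hom_def hom_def)
  have "hull_map ?B ?A conv_map (source_sg.conc_map x) = target_sg.conc_map (h x)"
    if x: "x \<in> carrier (MultMon C S)" for x
  proof (rule nd.hull_map_eqI)
    show "source_sg.conc_map x \<in> carrier (TrHullMon ?B)"
      using source_sg.conc_map_hom x by (auto simp: monoid_hom_def hom_def)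
    obtain L R where LR: "x = ArrPair L R"
      using x by (cases x) auto
    note LR_mem = x[unfolded LR]
    show "lifts ?B ?A conv_map (source_sg.conc_map x) (target_sg.conc_map (h x))"
      unfolding LR source_sg.conc_map_eq[OF LR_mem]
    proof (rule lifts_of_hom[OF nd.B nd.A nd.g, where M = "MultMon C S" and x = "ArrPair L R"
          and k = "\<lambda>x. target_sg.conc_map (h x)" and c = "mult_canon (C, S)"])
      show "(\<lambda>x. target_sg.conc_map (h x)) \<in> hom (MultMon C S) (TrHullMon ?A)"
        using target_sg.conc_map_hom h by (auto simp: monoid_hom_def hom_def Pi_iff)
      show "mult_canon (C, S) \<in> carrier ?B \<rightarrow> carrier (MultMon C S)"
        by (simp add: source_sg.mult_canon_closed)
      show "target_sg.conc_map (h (mult_canon (C, S) b)) = canon ?A (conv_map b)" if "b \<in> carrier ?B" for b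
        using that nd.hom_closed[OF that] by (simp add: h_canon target_sg.conc_map_canon)
      show "ArrPair L R \<otimes>\<^bsub>MultMon C S\<^esub> mult_canon (C, S) b =
          mult_canon (C, S) ((\<lambda>h \<in> Hom C (Unit C) (SOb S). L \<cdot>\<^bsub>C\<^esub> h) b)"
        "mult_canon (C, S) b \<otimes>\<^bsub>MultMon C S\<^esub> ArrPair L R =
          mult_canon (C, S) ((\<lambda>h \<in> Hom C (Unit C) (SOb S). R \<cdot>\<^bsub>C\<^esub> h) b)"
        if "b \<in> carrier ?B" for b
        using that LR_mem
        by (simp_all add: source_sg.mult_canon_eq source_sg.multiplier_conv source_sg.multiplier_comp_canon)
    qed (use LR_mem source_sg.multiplier_conv in auto)
  qed
  then have "compose (carrier (MultMon C S)) (hull_map ?B ?A conv_map) source_sg.conc_map =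
      compose (carrier (MultMon C S)) target_sg.conc_map h"
    by (auto simp: compose_def fun_eq_iff)
  moreover have "FAr (TrHull \<circ>\<^sub>F Conv_nd) p = Arrow (TrHullMon ?B) (TrHullMon ?A) (hull_map ?B ?A conv_map)"
    by (simp add: functor_comp_def e Conv_Arrow TrHull_Arrow[OF nd.nondegenerate_hom_axioms])
  ultimately show ?thesis
    by (simp add: XY m_eq source_sg.Conc_src_tgt target_sg.Conc_src_tgt)
qed

section \<open>Functoriality of \<open>Mult\<close>\<close>

lemma mult_extension_id:
  assumes "X \<in> Obj IntSem"
  shows "mult_extension (Id IntSem X) (Id Mon (FOb Mult X))"
proof -
  interpret Conv: cat_functor IntSem Sem Conv by (rule Conv_functor)
  obtain C S where X: "X = (C, S)" and "semigroup_object C S"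
    using assms by (cases X) (simp add: intsem_obs_iff)
  interpret semigroup_object C S by fact
  have "FAr Conv (Id IntSem (C, S)) = Id Sem (FOb Conv (C, S))"
    using assms unfolding X by (rule Conv.functor_id)
  then show ?thesis
    using category.id_hom[OF category_Mon, of "MultMon C S"] monoid_MultMon mult_canon_closed
    by (simp add: mult_extension_def X Mult_def) (simp add: Conv_def)
qed

text \<open>Together with the case of identities this turns uniqueness of extensions into the
  functor laws of \<open>Mult\<close>.\<close>

lemma mult_extension_comp:
  assumes p: "p \<in> Hom IntSem X Y" and q: "q \<in> Hom IntSem Y Z"
    and m: "mult_extension p m" and n: "mult_extension q n"
  shows "mult_extension (q \<cdot>\<^bsub>IntSem\<^esub> p) (n \<cdot>\<^bsub>Mon\<^esub> m)"
proof -
  interpret I: category IntSem by (rule category_IntSem)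
  interpret Conv: cat_functor IntSem Sem Conv by (rule Conv_functor)
  have src: "arr_src p = X" "arr_tgt p = Y" "arr_src q = Y" "arr_tgt q = Z"
    using p q by (auto simp: Hom_iff)
  have qp: "arr_src (q \<cdot>\<^bsub>IntSem\<^esub> p) = X" "arr_tgt (q \<cdot>\<^bsub>IntSem\<^esub> p) = Z"
    using I.comp_hom[OF p q] by (auto simp: Hom_iff)
  have mn: "m \<in> Hom Mon (case_prod MultMon X) (case_prod MultMon Y)"
    "n \<in> Hom Mon (case_prod MultMon Y) (case_prod MultMon Z)"
    using m n by (auto simp: mult_extension_def src)
  then have mn_src: "arr_src m = case_prod MultMon X"
    by (simp add: Hom_iff)
  have Cp: "FAr Conv p \<in> Hom Sem (conv_sgrp X) (conv_sgrp Y)"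
    using Conv.ar[OF p] by (simp add: Conv_def)
  have "arr_data (n \<cdot>\<^bsub>Mon\<^esub> m) (mult_canon X g) = mult_canon Z (arr_data (FAr Conv (q \<cdot>\<^bsub>IntSem\<^esub> p)) g)"
    if g: "g \<in> carrier (conv_sgrp X)" for g
  proof -
    \<comment> \<open>Composition in \<open>Mon\<close> is restricted to the carrier, so the
      composite can be evaluated at a canonical multiplier only after membership is known.\<close>
    have "mult_canon X g \<in> carrier (case_prod MultMon X)"
    proof (cases X)
      case (Pair C S)
      then interpret semigroup_object C S
        using I.dom_obj[of p] p by (simp add: Hom_iff intsem_obs_iff)
      show ?thesis
        using g by (simp add: Pair mult_canon_closed)
    qed
    moreover have "arr_data (FAr Conv p) g \<in> carrier (conv_sgrp Y)" "arr_src (FAr Conv p) = conv_sgrp X"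
      using Cp g by (auto simp: Hom_Sem_iff sgrp_hom_closed)
    ultimately show ?thesis
      using m n g Conv.pres_comp[OF p q]
      by (simp add: mult_extension_def src mn_src compose_eq)
  qed
  then show ?thesis
    unfolding mult_extension_def qp using category.comp_hom[OF category_Mon mn] by blast
qed

lemma Mult_functor:
  assumes K: "subcategory K conc_IntSem_nd" and ex1: "Mult_defined_on K"
  shows "cat_functor K Mon Mult"
proof -
  interpret K: category K using K by (simp add: subcategory_def)
  interpret M: category Mon by (rule category_Mon)
  have ext: "mult_extension p (FAr Mult p)" if "p \<in> Arr K" for p
    using ex1 that theI'[of "mult_extension p"] by (auto simp: Mult_defined_on_def Mult_def)
  have unique: "FAr Mult p = m" if "p \<in> Arr K" "mult_extension p m" for p m
    using ex1 that ext[OF that(1)] by (auto simp: Mult_defined_on_def)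
  have Hom: "p \<in> Hom IntSem X Y" if "p \<in> Hom K X Y" for p X Y
    using that K by (intro Hom_conc_IntSem_nd) (auto simp: subcategory_def Hom_iff)
  have Obj: "X \<in> Obj IntSem" if "X \<in> Obj K" for X
    using that K by (intro Obj_conc_IntSem_nd(1)) (auto simp: subcategory_def)
  show ?thesis
  proof unfold_locales
    show "FOb Mult X \<in> Obj Mon" if "X \<in> Obj K" for X
      using Conc_Hom[OF Obj[OF that]] by (auto simp: Hom_Mon_iff)
    show "FAr Mult p \<in> Hom Mon (FOb Mult X) (FOb Mult Y)" if "p \<in> Hom K X Y" for p X Y
      using ext[of p] that Hom[OF that] by (auto simp: mult_extension_def Hom_iff Mult_def)
    show "FAr Mult (Id K X) = Id Mon (FOb Mult X)" if X: "X \<in> Obj K" for X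
    proof (rule unique)
      have "Id K X = Id IntSem X"
        using X K by (auto simp: subcategory_def conc_IntSem_nd_def full_subcategory_def IntSem_nd_def)
      then show "mult_extension (Id K X) (Id Mon (FOb Mult X))"
        using mult_extension_id[OF Obj[OF X]] by simp
    qed (use X in simp)
    show "FAr Mult (q \<cdot>\<^bsub>K\<^esub> p) = FAr Mult q \<cdot>\<^bsub>Mon\<^esub> FAr Mult p"
      if p: "p \<in> Hom K X Y" and q: "q \<in> Hom K Y Z" for p q X Y Z
    proof (rule unique)
      have "q \<cdot>\<^bsub>K\<^esub> p = q \<cdot>\<^bsub>IntSem\<^esub> p"
        using p q K
        by (auto simp: subcategory_def Hom_iff conc_IntSem_nd_def full_subcategory_def IntSem_nd_def)
      then show "mult_extension (q \<cdot>\<^bsub>K\<^esub> p) (FAr Mult q \<cdot>\<^bsub>Mon\<^esub> FAr Mult p)"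
        using mult_extension_comp[OF Hom[OF p] Hom[OF q] ext ext] p q by (simp add: Hom_iff)
      show "q \<cdot>\<^bsub>K\<^esub> p \<in> Arr K"
        using K.comp_hom[OF p q] by (simp add: Hom_iff)
    qed
  qed
qed

lemma Conc_natural_transformation:
  assumes K: "subcategory K conc_IntSem_nd" and "Mult_defined_on K"
  shows "natural_transformation K Mon Mult (TrHull \<circ>\<^sub>F Conv_nd) Conc"
proof -
  interpret Mult: cat_functor K Mon Mult
    using assms by (rule Mult_functor)
  interpret TC: cat_functor K Mon "TrHull \<circ>\<^sub>F Conv_nd"
    by (rule cat_functor_subcategory[OF functor_comp_cat_functor[OF Conv_nd_functor TrHull_functor] K])
  show ?thesis
  proof unfold_locales
    show "Conc X \<in> Hom Mon (FOb Mult X) (FOb (TrHull \<circ>\<^sub>F Conv_nd) X)" if "X \<in> Obj K" for X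
      using that K by (intro Conc_Hom Obj_conc_IntSem_nd(1)) (auto simp: subcategory_def)
    show "FAr (TrHull \<circ>\<^sub>F Conv_nd) p \<cdot>\<^bsub>Mon\<^esub> Conc X = Conc Y \<cdot>\<^bsub>Mon\<^esub> FAr Mult p" if p: "p \<in> Hom K X Y" for p X Y
    proof (rule Conc_natural)
      show "p \<in> Hom conc_IntSem_nd X Y"
        using p K by (auto simp: subcategory_def Hom_iff)
      show "mult_extension p (FAr Mult p)"
        using p assms(2) theI'[of "mult_extension p"] by (auto simp: Mult_defined_on_def Mult_def Hom_iff)
    qed
  qed
qed

text \<open>The first conjunct is the claim for \<open>Mult\<close> as a functor on K, with
  \<open>conc_IntSem_nd\<close> itself as one possible K. The last conjunct gives the naturality
  square at every arrow of \<open>conc_IntSem_nd\<close>, for each homomorphism that satisfies the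
  equation describing \<open>Mult\<close>. Surjectivity of the components is the meaning of
  \<open>concrete\<close>.\<close>

theorem mainTheorem5:
  shows
    "(\<forall>K :: (('o, 'm) intsem_ob, ('o, 'm) intsem_ar) category.
        subcategory K conc_IntSem_nd \<and> Mult_defined_on K \<longrightarrow>
        natural_transformation K Mon Mult (TrHull \<circ>\<^sub>F Conv_nd) Conc \<and>
        (\<forall>X \<in> Obj K. onto (Conc X))) \<and>
     cat_functor (conc_IntSem_nd :: (('o, 'm) intsem_ob, ('o, 'm) intsem_ar) category) Sem_nd Conv_nd \<and>
     cat_functor (Sem_nd :: ('m sgrp, ('m sgrp, 'm \<Rightarrow> 'm) arrow) category) Mon TrHull \<and>
     (\<forall>X :: ('o, 'm) intsem_ob. X \<in> Obj conc_IntSem_nd \<longrightarrow>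
        Conc X \<in> Hom Mon (FOb Mult X) (FOb (TrHull \<circ>\<^sub>F Conv_nd) X) \<and> onto (Conc X)) \<and>
     (\<forall>(X :: ('o, 'm) intsem_ob) Y. \<forall>p \<in> Hom conc_IntSem_nd X Y. \<forall>m. mult_extension p m \<longrightarrow>
        FAr (TrHull \<circ>\<^sub>F Conv_nd) p \<cdot>\<^bsub>Mon\<^esub> Conc X = Conc Y \<cdot>\<^bsub>Mon\<^esub> m)"
proof (intro conjI allI impI ballI)
  show "onto (Conc X)" if "subcategory K conc_IntSem_nd \<and> Mult_defined_on K" "X \<in> Obj K"
    for K :: "(('o, 'm) intsem_ob, ('o, 'm) intsem_ar) category" and X
    using that by (intro Obj_conc_IntSem_nd(2)) (auto simp: subcategory_def)
qed (blast intro: Conc_natural_transformation Conv_nd_functor TrHull_functor Conc_Hom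
    Obj_conc_IntSem_nd Conc_natural)+

end
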